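(* Let $0<\beta<1$, let $X_\beta$ be the weighted space built from $\beta$ and $\chi$ as in the context, and let $\alpha_\beta=4\left[8\pi^2(1-\beta)\right]^{\frac{1}{1-\beta}}$. Suppose that there exist constants $C_1>0$ and $C_2>0$ such that for all integers $k\ge 1$ $$\int_{1}^{+\infty}r^3\left(\int_{r}^{+\infty}\frac{1}{\chi(y)y}\,\mathrm{d}y\right)^{\frac{k}{1-\beta}}\mathrm{d}r<C_1^k$$ and $$\int_{1}^{+\infty}r^{3-\frac{2k}{1-\beta}}\left(\int_{1}^{r}\frac{y}{\chi(y)}\,\mathrm{d}y\right)^{\frac{k}{1-\beta}}\mathrm{d}r<C_2^k .$$ Let $\{u_n\}\subset X_\beta$ and $u\in X_\beta\setminus\{0\}$ be such that $\|u_n\|_\beta=1$ for all $n$ and $u_n\rightharpoonup u$ weakly in $X_\beta$. Then $$\sup_n\int_{\mathbb{R}^4}\left(e^{p\alpha_\beta|u_n|^{\frac{2}{1-\beta}}}-1\right)\mathrm{d}x<+\infty\qquad\text{for all } 0<p<P_\beta(u),$$ where $P_\beta(u)=\left(1-\|u\|_\beta^2\right)^{-\frac{1}{1-\beta}}$ if $\|u\|_\beta<1$ and $P_\beta(u)=+\infty$ if $\|u\|_\beta=1$.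
   Context: Let $0<\beta<1$. The function $\chi:[1,+\infty)\to(0,+\infty)$ is continuous with $\chi(1)=1$, $\inf_{t\ge1}\chi(t)>0$, $\int_1^{+\infty}\chi(y)^{-1}y^{-1}\,\mathrm{d}y<+\infty$ and $\int_1^{+\infty}\chi(y)^{-1}y\,\mathrm{d}y<+\infty$. It is also assumed that there is a constant $M>0$ such that for all $r\ge1$: $$\frac{1}{r^8}\left(\int_1^r t^3\chi(t)\,\mathrm{d}t\right)\left(\int_1^r\frac{t^3}{\chi(t)}\,\mathrm{d}t\right)\le M,\qquad \frac{1}{r^8}\int_1^r t^3\chi(t)\,\mathrm{d}t\le M,\qquad \frac{\max_{r\le t\le4r}\chi(t)}{\min_{r\le t\le4r}\chi(t)}\le M.$$ The radial weight is $$\omega_\beta(x)=\left(\log\frac{e}{|x|}\right)^{\beta}\ \text{ if }|x|<1,\qquad \omega_\beta(x)=\chi(|x|)\ \text{ if }|x|\ge1 .$$ The weighted Sobolev space is $$X_\beta=\Big\{u\in L^{\frac{2}{1-\beta}}_{rad}(\mathbb{R}^4):\ \int_{\mathbb{R}^4}\omega_\beta(x)|\Delta u|^2\,\mathrm{d}x<+\infty\Big\},\qquad \|u\|_\beta^2=\int_{\mathbb{R}^4}\omega_\beta(x)|\Delta u|^2\,\mathrm{d}x,$$ where $L^{\frac{2}{1-\beta}}_{rad}(\mathbb{R}^4)$ denotes the radial functions in $L^{\frac{2}{1-\beta}}(\mathbb{R}^4)$. Weak convergence in $X_\beta$ is with respect to the norm $\|\cdot\|_\beta$ (induced by the inner product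 $\int_{\mathbb{R}^4}\omega_\beta\,\Delta u\,\Delta v\,\mathrm{d}x$). *)

theory Defs
  imports "HOL-Analysis.Analysis"
begin

section \<open>Test functions and the distributional Laplacian\<close>

definition partial_deriv :: "'n::finite \<Rightarrow> (real^'n \<Rightarrow> real) \<Rightarrow> real^'n \<Rightarrow> real" where
  "partial_deriv i f x = frechet_derivative f (at x) (axis i 1)"

definition laplacian :: "(real^'n::finite \<Rightarrow> real) \<Rightarrow> real^'n \<Rightarrow> real" where
  "laplacian f x = (\<Sum>i\<in>UNIV. partial_deriv i (partial_deriv i f) x)"

text \<open>Differentiability of every iterated partial derivative also makes all of them continuous,
  so this is the class of infinitely often continuously differentiable functions.\<close>

definition smooth :: "(real^'n::finite \<Rightarrow> real) \<Rightarrow> bool" where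
  "smooth f \<longleftrightarrow> (\<forall>is x. foldr partial_deriv is f differentiable (at x))"

definition test_function :: "(real^'n::finite \<Rightarrow> real) \<Rightarrow> bool" where
  "test_function \<phi> \<longleftrightarrow> smooth \<phi> \<and> compact (closure {x. \<phi> x \<noteq> 0})"

definition locally_integrable :: "(real^'n::finite \<Rightarrow> real) \<Rightarrow> bool" where
  "locally_integrable f \<longleftrightarrow> (\<forall>K. compact K \<longrightarrow> set_integrable lebesgue K f)"

definition has_weak_laplacian ::
    "(real^'n::finite \<Rightarrow> real) \<Rightarrow> (real^'n \<Rightarrow> real) \<Rightarrow> bool" where
  "has_weak_laplacian u g \<longleftrightarrow> locally_integrable u \<and> locally_integrable g \<and>
     (\<forall>\<phi>. test_function \<phi> \<longrightarrow>
        (LINT x|lebesgue. u x * laplacian \<phi> x) = (LINT x|lebesgue. g x * \<phi> x))"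

text \<open>A weak Laplacian is unique up to a null set; only quantities insensitive to
  null sets are formed from the representative chosen here.\<close>

definition weak_laplacian :: "(real^'n::finite \<Rightarrow> real) \<Rightarrow> real^'n \<Rightarrow> real" where
  "weak_laplacian u = (SOME g. has_weak_laplacian u g)"


section \<open>The weight\<close>

definition admissible_chi :: "(real \<Rightarrow> real) \<Rightarrow> bool" where
  "admissible_chi chi \<longleftrightarrow>
     continuous_on {1..} chi \<and> (\<forall>t\<ge>1. chi t > 0) \<and> chi 1 = 1 \<and>
     (INF t\<in>{1..}. chi t) > 0 \<and>
     set_integrable lborel {1..} (\<lambda>y. inverse (chi y) * inverse y) \<and>
     set_integrable lborel {1..} (\<lambda>y. inverse (chi y) * y) \<and>
     (\<exists>M>0. \<forall>r\<ge>1.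
        1 / r^8 * (LBINT t:{1..r}. t^3 * chi t) * (LBINT t:{1..r}. t^3 / chi t) \<le> M \<and>
        1 / r^8 * (LBINT t:{1..r}. t^3 * chi t) \<le> M \<and>
        (SUP t\<in>{r..4*r}. chi t) / (INF t\<in>{r..4*r}. chi t) \<le> M)"

definition weight :: "real \<Rightarrow> (real \<Rightarrow> real) \<Rightarrow> real^4 \<Rightarrow> real" where
  "weight \<beta> chi x =
     (if norm x < 1 then ln (exp 1 / norm x) powr \<beta> else chi (norm x))"


section \<open>The weighted Sobolev space\<close>

text \<open>Elements of Lebesgue spaces are represented by functions, with equality almost everywhere
  as the intended equality; radial symmetry is accordingly required up to a null set.\<close>

definition radial_ae :: "(real^'n::finite \<Rightarrow> real) \<Rightarrow> bool" where
  "radial_ae u \<longleftrightarrow> (\<exists>f. AE x in lebesgue. u x = f (norm x))"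

definition L_rad :: "real \<Rightarrow> (real^'n::finite \<Rightarrow> real) set" where
  "L_rad q = {u. u \<in> borel_measurable lebesgue \<and>
                 integrable lebesgue (\<lambda>x. \<bar>u x\<bar> powr q) \<and> radial_ae u}"

definition X_space :: "real \<Rightarrow> (real \<Rightarrow> real) \<Rightarrow> (real^4 \<Rightarrow> real) set" where
  "X_space \<beta> chi = {u \<in> L_rad (2 / (1 - \<beta>)).
     (\<exists>g. has_weak_laplacian u g) \<and>
     integrable lebesgue (\<lambda>x. weight \<beta> chi x * (weak_laplacian u x)\<^sup>2)}"

definition X_norm :: "real \<Rightarrow> (real \<Rightarrow> real) \<Rightarrow> (real^4 \<Rightarrow> real) \<Rightarrow> real" where
  "X_norm \<beta> chi u = sqrt (LINT x|lebesgue. weight \<beta> chi x * (weak_laplacian u x)\<^sup>2)"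

text \<open>The bound makes a functional depend only on the almost-everywhere class of its argument.\<close>

definition X_dual :: "real \<Rightarrow> (real \<Rightarrow> real) \<Rightarrow> ((real^4 \<Rightarrow> real) \<Rightarrow> real) set" where
  "X_dual \<beta> chi = {F.
     (\<forall>u\<in>X_space \<beta> chi. \<forall>v\<in>X_space \<beta> chi. F (\<lambda>x. u x + v x) = F u + F v) \<and>
     (\<forall>c. \<forall>u\<in>X_space \<beta> chi. F (\<lambda>x. c * u x) = c * F u) \<and>
     (\<exists>C. \<forall>u\<in>X_space \<beta> chi. \<bar>F u\<bar> \<le> C * X_norm \<beta> chi u)}"

definition weakly_converges ::
    "real \<Rightarrow> (real \<Rightarrow> real) \<Rightarrow> (nat \<Rightarrow> real^4 \<Rightarrow> real) \<Rightarrow> (real^4 \<Rightarrow> real) \<Rightarrow> bool" where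
  "weakly_converges \<beta> chi un u \<longleftrightarrow> (\<forall>F\<in>X_dual \<beta> chi. (\<lambda>n. F (un n)) \<longlonglongrightarrow> F u)"


section \<open>Critical constants\<close>

definition alpha_crit :: "real \<Rightarrow> real" where
  "alpha_crit \<beta> = 4 * (8 * pi\<^sup>2 * (1 - \<beta>)) powr (1 / (1 - \<beta>))"

text \<open>Only functions of norm at most one are relevant, so the second branch is the case
  of norm one.\<close>

definition P_crit :: "real \<Rightarrow> (real \<Rightarrow> real) \<Rightarrow> (real^4 \<Rightarrow> real) \<Rightarrow> ereal" where
  "P_crit \<beta> chi u =
     (if X_norm \<beta> chi u < 1
      then ereal ((1 - (X_norm \<beta> chi u)\<^sup>2) powr (- (1 / (1 - \<beta>))))
      else \<infinity>)"

end

theory Submission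
  imports Defs "HOL-Computational_Algebra.Polynomial"
begin

text \<open>A radial function \<open>u\<close> of the space is the Newton potential of its weak Laplacian \<open>g\<close>: averaging
  the kernel over spheres gives \<open>u(x) = -(1/4\<pi>\<^sup>2) \<integral> g(y) max(|x|, |y|)\<^sup>-\<^sup>2 dy\<close>. By
  Cauchy-Schwarz \<open>|u(x)|\<close> is at most \<open>\<parallel>u\<parallel>\<close> times an explicit function of \<open>|x|\<close>, whose growth at the
  origin makes \<open>exp (p \<alpha> |u| powr (2/(1-\<beta>)))\<close> integrable as soon as \<open>p \<parallel>u\<parallel> powr (2/(1-\<beta>)) < 1\<close>; this
  subcritical case is all that is needed. Weak convergence gives \<open>\<parallel>u\<^sub>n - u\<parallel>\<^sup>2 \<longlonglongrightarrow> 1 - \<parallel>u\<parallel>\<^sup>2\<close>, and the fixed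
  function \<open>u\<close> is of smaller order at the origin than the Cauchy-Schwarz bound, so
  \<open>u\<^sub>n = (u\<^sub>n - u) + u\<close> is subcritical uniformly for large \<open>n\<close>. Outside the unit ball both
  \<open>|u\<^sub>n|\<close> and the integral of \<open>|u\<^sub>n| powr (2/(1-\<beta>))\<close> are uniformly bounded.\<close>

section \<open>Smooth functions\<close>

text \<open>The constant in \<open>alpha_crit\<close> is the one that turns the Cauchy-Schwarz bound
  into a multiple of a logarithm. With L = ln (e/|x|) that bound is, to leading order, |u(x)| <=
  ||u|| (L^(1-\<beta>) / (8 pi^2 (1-\<beta>)))^(1/2). Hence \<open>alpha_crit \<beta>\<close>
  |u|^(2/(1-\<beta>)) is at most about 4 ||u||^(2/(1-\<beta>)) L, and exp (4 \<theta> L) is a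
  multiple of |x|^(-4 \<theta>), integrable near the origin of R^4 exactly for \<theta> < 1. The
  delicate point is the representation. The profile of u is not known to be measurable, nor g to be
  radial. Radial test functions h(|x|^2) see only spherical means of g, which is why the averaged
  kernel works for arbitrary g. A radial function that is harmonic off the origin may still be c +
  d/|x|^2: testing across the origin excludes d, and integrability of |u|^(2/(1-\<beta>)) at
  infinity excludes c.\<close>

definition flat :: "real poly \<Rightarrow> real \<Rightarrow> real" where
  "flat P x = (if x > 0 then poly P (1 / x) * exp (- (1 / x)) else 0)"

lemma tendsto_poly_times_exp_uminus:
  fixes P :: "real poly"
  shows "((\<lambda>t. poly P t * exp (- t)) \<longlongrightarrow> 0) at_top"
proof -
  have "((\<lambda>t. \<Sum>i\<le>degree P. coeff P i * (t ^ i / exp t)) \<longlongrightarrow> (\<Sum>i\<le>degree P. coeff P i * 0)) at_top"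
    by (intro tendsto_intros tendsto_power_div_exp_0)
  moreover have "poly P t * exp (- t) = (\<Sum>i\<le>degree P. coeff P i * (t ^ i / exp t))" for t
    by (simp add: poly_altdef sum_distrib_right exp_minus divide_inverse mult.assoc)
  ultimately show ?thesis by simp
qed

text \<open>The product rule turns P(1/x) exp(-1/x) into x^(-2) (P - P')(1/x) exp(-1/x), so the
  family indexed by polynomials is closed under differentiation. At 0 the exponential beats every
  power of 1/x, including the extra one from the difference quotient.\<close>

lemma flat_has_derivative:
  "(flat P has_real_derivative flat ([:0, 0, 1:] * (P - pderiv P)) x) (at x)"
proof -
  consider "x > 0" | "x < 0" | "x = 0" by linarith
  then show ?thesis
  proof cases
    case 1
    have "((\<lambda>x. poly P (1 / x) * exp (- (1 / x))) has_real_derivative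
        flat ([:0, 0, 1:] * (P - pderiv P)) x) (at x)"
      using 1 by (auto intro!: derivative_eq_intros DERIV_chain2[OF poly_DERIV]
          simp: flat_def field_simps power2_eq_square)
    moreover have "\<forall>\<^sub>F y in nhds x. poly P (1 / y) * exp (- (1 / y)) = flat P y"
      using eventually_nhds_in_open[of "{0<..}" x] 1
      by (auto elim!: eventually_mono simp: flat_def)
    ultimately show ?thesis
      by (subst (asm) DERIV_cong_ev[OF refl _ refl]) auto
  next
    case 2
    have "((\<lambda>x. 0) has_real_derivative flat ([:0, 0, 1:] * (P - pderiv P)) x) (at x)"
      using 2 by (auto simp: flat_def)
    moreover have "\<forall>\<^sub>F y in nhds x. 0 = flat P y"
      using eventually_nhds_in_open[of "{..<0}" x] 2
      by (auto elim!: eventually_mono simp: flat_def)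
    ultimately show ?thesis
      by (subst (asm) DERIV_cong_ev[OF refl _ refl]) auto
  next
    case 3
    have "((\<lambda>h. flat P h / h) \<longlongrightarrow> 0) (at_right 0)"
    proof -
      have "((\<lambda>h. poly ([:0,1:] * P) (inverse h) * exp (- inverse h)) \<longlongrightarrow> 0) (at_right 0)"
        by (rule filterlim_compose[OF tendsto_poly_times_exp_uminus filterlim_inverse_at_top_right])
      moreover have "\<forall>\<^sub>F h in at_right 0. poly ([:0,1:] * P) (inverse h) * exp (- inverse h) = flat P h / h"
        by (auto simp: eventually_at_filter flat_def field_simps)
      ultimately show ?thesis
        by (rule Lim_transform_eventually)
    qed
    moreover have "((\<lambda>h. flat P h / h) \<longlongrightarrow> 0) (at_left 0)"
      by (rule tendsto_eventually) (auto simp: eventually_at_filter flat_def)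
    ultimately have "((\<lambda>h. flat P h / h) \<longlongrightarrow> 0) (at 0)"
      by (simp add: filterlim_split_at)
    then show ?thesis
      using 3 by (simp add: DERIV_def flat_def)
  qed
qed

text \<open>Each generator has its derivative in the class, so smoothness follows by rule induction without
  iterated product rules. In the last rule the junk value at \<open>s = 0\<close> is the correct one.\<close>

inductive smooth1 :: "(real \<Rightarrow> real) \<Rightarrow> bool" where
  flat: "smooth1 (\<lambda>x. flat P (a * x + b))"
| const: "smooth1 (\<lambda>_. c)"
| add: "smooth1 f \<Longrightarrow> smooth1 g \<Longrightarrow> smooth1 (\<lambda>x. f x + g x)"
| mult: "smooth1 f \<Longrightarrow> smooth1 g \<Longrightarrow> smooth1 (\<lambda>x. f x * g x)"
| antideriv: "smooth1 f \<Longrightarrow> (\<And>x. (F has_real_derivative f x) (at x)) \<Longrightarrow> smooth1 F"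
| divide: "smooth1 f \<Longrightarrow> 0 < a \<Longrightarrow> (\<And>s. s < a \<Longrightarrow> f s = 0) \<Longrightarrow> smooth1 (\<lambda>s. f s / s)"

text \<open>Passes the vanishing condition of the rule \<open>smooth1.divide\<close> from a function
  to its derivative.\<close>

lemma has_real_derivative_zero_on_ray:
  fixes f :: "real \<Rightarrow> real"
  assumes "\<And>s. s < a \<Longrightarrow> f s = 0" "(f has_real_derivative D) (at s)" "s < a"
  shows "D = 0"
proof -
  have "\<forall>\<^sub>F y in nhds s. f y = 0"
    using eventually_nhds_in_open[of "{..<a}" s] assms by (auto elim!: eventually_mono)
  then have "((\<lambda>_. 0) has_real_derivative D) (at s)"
    using assms(2) by (subst (asm) DERIV_cong_ev[OF refl _ refl]) auto
  then show ?thesis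
    using DERIV_unique[OF _ DERIV_const] by blast
qed

lemma smooth1_derivative:
  assumes "smooth1 f"
  obtains f' where "smooth1 f'" "\<And>x. (f has_real_derivative f' x) (at x)"
proof -
  from assms have "\<exists>f'. smooth1 f' \<and> (\<forall>x. (f has_real_derivative f' x) (at x))"
  proof induction
    case (flat P a b)
    have "smooth1 (\<lambda>x. flat ([:0, 0, 1:] * (P - pderiv P)) (a * x + b) * a)"
      by (intro smooth1.intros)
    moreover have "((\<lambda>x. flat P (a * x + b)) has_real_derivative
        flat ([:0, 0, 1:] * (P - pderiv P)) (a * x + b) * a) (at x)" for x
      by (rule DERIV_chain2[OF flat_has_derivative]) (auto intro!: derivative_eq_intros)
    ultimately show ?case by blast
  next
    case (const c)
    show ?case by (rule exI[of _ "\<lambda>_. 0"]) (auto intro: smooth1.intros)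
  next
    case (add f g)
    then obtain f' g' where "smooth1 f'" "smooth1 g'"
      "\<And>x. (f has_real_derivative f' x) (at x)" "\<And>x. (g has_real_derivative g' x) (at x)"
      by blast
    then show ?case
      by (intro exI[of _ "\<lambda>x. f' x + g' x"]) (auto intro: smooth1.intros DERIV_add)
  next
    case (mult f g)
    then obtain f' g' where "smooth1 f'" "smooth1 g'"
      "\<And>x. (f has_real_derivative f' x) (at x)" "\<And>x. (g has_real_derivative g' x) (at x)"
      by blast
    then show ?case using mult.hyps
      by (intro exI[of _ "\<lambda>x. f' x * g x + g' x * f x"]) (auto intro: smooth1.intros DERIV_mult)
  next
    case (antideriv f F)
    then show ?case by blast
  next
    case (divide f a)
    then obtain f' where f': "smooth1 f'" "\<And>x. (f has_real_derivative f' x) (at x)" by blast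
    have zero: "f' s = 0" if "s < a" for s
      using has_real_derivative_zero_on_ray[OF divide.hyps(3) f'(2) that] .
    \<comment> \<open>The quotient rule is written with \<open>f s / s / s\<close> so that
      membership follows from iterated use of \<open>smooth1.divide\<close>. At s = 0 the expression
      evaluates to 0, which is the true derivative because f vanishes near 0.\<close>
    have "smooth1 (\<lambda>s. f' s / s + (-1) * (f s / s / s))"
      using divide.hyps f'(1) zero by (intro smooth1.intros(2,3,4) smooth1.divide) auto
    moreover have "((\<lambda>s. f s / s) has_real_derivative f' s / s + (-1) * (f s / s / s)) (at s)" for s
    proof (cases "s = 0")
      case True
      have "\<forall>\<^sub>F y in nhds s. 0 = f y / y"
        using eventually_nhds_in_open[of "{..<a}" s] divide.hyps True
        by (auto elim!: eventually_mono)
      then have "((\<lambda>s. f s / s) has_real_derivative 0) (at s)"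
        using DERIV_cong_ev[OF refl _ refl, of "\<lambda>_. 0" "\<lambda>s. f s / s" s 0] by simp
      then show ?thesis using True by simp
    next
      case False
      then show ?thesis
        by (auto intro!: derivative_eq_intros f' simp: field_simps)
    qed
    ultimately show ?case by blast
  qed
  then show thesis using that by blast
qed

lemma smooth1_linear: "smooth1 (\<lambda>x. c * x)"
  by (rule smooth1.antideriv[OF smooth1.const]) (auto intro!: derivative_eq_intros)

text \<open>The radial generators depend on \<open>x \<bullet> x\<close>, a polynomial, so the
  origin is no exception. Their partial derivatives are products of
  \<open>h' (x \<bullet> x)\<close> with a coordinate and stay in the class thanks to the coordinate
  generators.\<close>

inductive smooth_class :: "(real^'n::finite \<Rightarrow> real) \<Rightarrow> bool" where
  coordinate: "smooth1 h \<Longrightarrow> smooth_class (\<lambda>x. h (x $ i))"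
| radial: "smooth1 h \<Longrightarrow> smooth_class (\<lambda>x. h (x \<bullet> x))"
| add: "smooth_class f \<Longrightarrow> smooth_class g \<Longrightarrow> smooth_class (\<lambda>x. f x + g x)"
| mult: "smooth_class f \<Longrightarrow> smooth_class g \<Longrightarrow> smooth_class (\<lambda>x. f x * g x)"

lemma partial_deriv_eq:
  fixes f :: "real^'n::finite \<Rightarrow> real"
  assumes "\<And>x. (f has_derivative (\<lambda>v. \<Sum>i\<in>UNIV. D i x * v $ i)) (at x)"
  shows "partial_deriv i f = D i"
proof
  fix x
  have "frechet_derivative f (at x) = (\<lambda>v. \<Sum>i\<in>UNIV. D i x * v $ i)"
    using frechet_derivative_at[OF assms] by metis
  then show "partial_deriv i f x = D i x"
    by (simp add: partial_deriv_def axis_def if_distrib cong: if_cong)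
qed

lemma has_derivative_radial:
  fixes x :: "real^'n::finite"
  assumes "(h has_real_derivative h') (at (x \<bullet> x))"
  shows "((\<lambda>x. h (x \<bullet> x)) has_derivative (\<lambda>v. \<Sum>i\<in>UNIV. h' * (2 * x $ i) * v $ i)) (at x)"
proof -
  have "((\<lambda>x. x \<bullet> x) has_derivative (\<lambda>v. 2 * (x \<bullet> v))) (at x)"
    by (auto intro!: derivative_eq_intros simp: inner_commute)
  from has_derivative_compose[OF this assms[unfolded has_field_derivative_def]]
  have "((\<lambda>x. h (x \<bullet> x)) has_derivative (\<lambda>v. h' * (2 * (x \<bullet> v)))) (at x)" .
  moreover have "h' * (2 * (x \<bullet> v)) = (\<Sum>i\<in>UNIV. h' * (2 * x $ i) * v $ i)" for v
    by (simp add: inner_vec_def sum_distrib_left mult_ac)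
  ultimately show ?thesis by simp
qed

text \<open>\<open>smooth\<close> demands full differentiability of every iterated partial
  derivative; keeping the partial derivatives inside the class reduces this to one induction over
  the generators.\<close>

lemma smooth_class_derivative:
  fixes f :: "real^'n::finite \<Rightarrow> real"
  assumes "smooth_class f"
  obtains D where "\<And>i. smooth_class (D i)"
    "\<And>x. (f has_derivative (\<lambda>v. \<Sum>i\<in>UNIV. D i x * v $ i)) (at x)"
proof -
  from assms have "\<exists>D. (\<forall>i. smooth_class (D i)) \<and>
    (\<forall>x. (f has_derivative (\<lambda>v. \<Sum>i\<in>UNIV. D i x * v $ i)) (at x))"
  proof induction
    case (coordinate h i)
    then obtain h' where h': "smooth1 h'" "\<And>x. (h has_real_derivative h' x) (at x)"
      using smooth1_derivative by blast
    define D where "D j = (\<lambda>x::real^'n. if j = i then h' (x $ i) else (\<lambda>_. 0) (x $ i))" for j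
    have "smooth_class (D j)" for j
      using smooth_class.coordinate[OF h'(1)] smooth_class.coordinate[OF smooth1.const[of 0]]
      by (cases "j = i") (auto simp: D_def)
    moreover have "((\<lambda>x. h (x $ i)) has_derivative (\<lambda>v. \<Sum>j\<in>UNIV. D j x * v $ j)) (at x)" for x
    proof -
      have "((\<lambda>x::real^'n. x $ i) has_derivative (\<lambda>v. v $ i)) (at x)"
        by (rule bounded_linear.has_derivative[OF bounded_linear_vec_nth has_derivative_ident])
      from has_derivative_compose[OF this h'(2)[unfolded has_field_derivative_def]]
      show ?thesis
        by (simp add: D_def if_distrib[of "\<lambda>z. z * _"] cong: if_cong)
    qed
    ultimately show ?case by blast
  next
    case (radial h)
    then obtain h' where h': "smooth1 h'" "\<And>x. (h has_real_derivative h' x) (at x)"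
      using smooth1_derivative by blast
    have "smooth_class (\<lambda>x::real^'n. h' (x \<bullet> x) * (2 * x $ i))" for i
      by (intro smooth_class.mult smooth_class.radial h'
          smooth_class.coordinate[OF smooth1_linear])
    then show ?case using has_derivative_radial[OF h'(2)]
      by (intro exI[of _ "\<lambda>i x. h' (x \<bullet> x) * (2 * x $ i)"]) blast
  next
    case (add f g)
    then obtain D E where "\<And>i. smooth_class (D i)" "\<And>i. smooth_class (E i)"
      "\<And>x. (f has_derivative (\<lambda>v. \<Sum>i\<in>UNIV. D i x * v $ i)) (at x)"
      "\<And>x. (g has_derivative (\<lambda>v. \<Sum>i\<in>UNIV. E i x * v $ i)) (at x)"
      by blast
    then show ?case
      by (intro exI[of _ "\<lambda>i x. D i x + E i x"])
        (auto intro!: smooth_class.add derivative_eq_intros simp: sum.distrib ring_distribs)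
  next
    case (mult f g)
    then obtain D E where "\<And>i. smooth_class (D i)" "\<And>i. smooth_class (E i)"
      "\<And>x. (f has_derivative (\<lambda>v. \<Sum>i\<in>UNIV. D i x * v $ i)) (at x)"
      "\<And>x. (g has_derivative (\<lambda>v. \<Sum>i\<in>UNIV. E i x * v $ i)) (at x)"
      by blast
    then show ?case using mult.hyps
      by (intro exI[of _ "\<lambda>i x. f x * E i x + D i x * g x"])
        (auto intro!: smooth_class.add smooth_class.mult derivative_eq_intros
          simp: sum.distrib ring_distribs sum_distrib_left sum_distrib_right mult_ac)
  qed
  then show thesis using that by blast
qed

lemma smooth_class_imp_smooth:
  assumes "smooth_class f"
  shows "smooth f"
proof -
  have "smooth_class (foldr partial_deriv is f)" for "is"
  proof (induction "is")
    case (Cons i "is")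
    then obtain D where "\<And>i. smooth_class (D i)"
      "\<And>x. (foldr partial_deriv is f has_derivative (\<lambda>v. \<Sum>i\<in>UNIV. D i x * v $ i)) (at x)"
      using smooth_class_derivative by blast
    then show ?case using partial_deriv_eq[of "foldr partial_deriv is f" D i] by simp
  qed (simp add: assms)
  then show ?thesis
    unfolding smooth_def by (metis smooth_class_derivative differentiable_def)
qed

lemma smooth_class_prod:
  assumes "\<And>i. smooth1 (h i)"
  shows "smooth_class (\<lambda>x::real^'n::finite. \<Prod>i\<in>A. h i (x $ i))"
proof (induction A rule: infinite_finite_induct)
  case (insert i A)
  then show ?case using smooth_class.mult[OF smooth_class.coordinate[OF assms]] by simp
qed (auto intro: smooth_class.coordinate[OF smooth1.const, of 1])

text \<open>In the variable s = |x|^2 the radial Laplacian 4 s h'' + 2 n h' has no coefficient that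
  is singular at the origin.\<close>

lemma laplacian_radial:
  fixes x :: "real^'n::finite"
  assumes "smooth1 h'" "\<And>s. (h has_real_derivative h' s) (at s)"
    "\<And>s. (h' has_real_derivative h'' s) (at s)"
  shows "laplacian (\<lambda>x. h (x \<bullet> x)) x =
    4 * (x \<bullet> x) * h'' (x \<bullet> x) + 2 * of_nat CARD('n) * h' (x \<bullet> x)"
proof -
  have 1: "partial_deriv i (\<lambda>x. h (x \<bullet> x)) = (\<lambda>x. h' (x \<bullet> x) * (2 * x $ i))" for i :: 'n
    by (rule partial_deriv_eq[of _ "\<lambda>i x. h' (x \<bullet> x) * (2 * x $ i)"])
      (rule has_derivative_radial[OF assms(2)])
  have "partial_deriv i (\<lambda>x. h' (x \<bullet> x) * (2 * x $ i)) x
      = h'' (x \<bullet> x) * (2 * x $ i) * (2 * x $ i) + h' (x \<bullet> x) * 2" for i :: 'n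
  proof -
    have c: "((\<lambda>x::real^'n. x $ i) has_derivative (\<lambda>v. v $ i)) (at x)" for x
      by (rule bounded_linear.has_derivative[OF bounded_linear_vec_nth has_derivative_ident])
    have "((\<lambda>x. h' (x \<bullet> x) * (2 * x $ i)) has_derivative
      (\<lambda>v. \<Sum>j\<in>UNIV. (h'' (x \<bullet> x) * (2 * x $ j) * (2 * x $ i) +
          (if j = i then h' (x \<bullet> x) * 2 else 0)) * v $ j)) (at x)" for x
      by (auto intro!: derivative_eq_intros has_derivative_radial[OF assms(3)] c
          simp: sum.distrib ring_distribs sum_distrib_left sum_distrib_right
            if_distrib[of "\<lambda>z. _ * z"] mult_ac fun_eq_iff cong: if_cong)
    from partial_deriv_eq[OF this, of i] show ?thesis by simp
  qed
  then show ?thesis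
    unfolding laplacian_def 1
    by (simp add: sum.distrib inner_vec_def sum_distrib_left sum_distrib_right mult_ac)
qed

text \<open>The factor \<open>Suc k\<close> steepens both edges while the function stays zero
  outside the open interval and at most 1, so the sequence converges boundedly to the indicator of
  the interval.\<close>

definition bump :: "real \<Rightarrow> real \<Rightarrow> nat \<Rightarrow> real \<Rightarrow> real" where
  "bump a b k s = flat 1 (real (Suc k) * (s - a)) * flat 1 (real (Suc k) * (b - s))"

lemma smooth1_bump: "smooth1 (bump a b k)"
proof -
  have "bump a b k = (\<lambda>s. flat 1 (real (Suc k) * s + - (real (Suc k) * a)) *
    flat 1 (- real (Suc k) * s + real (Suc k) * b))"
    by (auto simp: bump_def fun_eq_iff algebra_simps)
  then show ?thesis by (metis smooth1.flat smooth1.mult)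
qed

lemma flat_1_bounds: "0 \<le> flat 1 x" "flat 1 x \<le> 1"
  by (auto simp: flat_def)

lemma bump_nonneg: "0 \<le> bump a b k s" and bump_le_1: "bump a b k s \<le> 1"
  using flat_1_bounds by (auto simp: bump_def intro!: mult_le_one)

lemma bump_eq_0: "s \<le> a \<or> b \<le> s \<Longrightarrow> bump a b k s = 0"
  by (auto simp: bump_def flat_def zero_less_mult_iff)

lemma bump_pos: "a < s \<Longrightarrow> s < b \<Longrightarrow> 0 < bump a b k s"
  by (auto simp: bump_def flat_def)

lemma bump_tendsto: "(\<lambda>k. bump a b k s) \<longlonglongrightarrow> indicator {a<..<b} s"
proof (cases "a < s \<and> s < b")
  case True
  have *: "(\<lambda>k. flat 1 (real (Suc k) * c)) \<longlonglongrightarrow> 1" if "c > 0" for c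
  proof -
    have "(\<lambda>k. exp (- (inverse (real (Suc k)) * (1 / c)))) \<longlonglongrightarrow> exp (- (0 * (1 / c)))"
      by (intro tendsto_intros LIMSEQ_inverse_real_of_nat)
    moreover have "flat 1 (real (Suc k) * c) = exp (- (inverse (real (Suc k)) * (1 / c)))" for k
      using that by (simp add: flat_def inverse_eq_divide)
    ultimately show ?thesis by simp
  qed
  show ?thesis
    using tendsto_mult[OF *[of "s - a"] *[of "b - s"]] True by (simp add: bump_def)
next
  case False
  then have "bump a b k s = 0" for k using bump_eq_0[of s a b] by force
  then show ?thesis using False by auto
qed

section \<open>Null functions and uniqueness of the weak Laplacian\<close>

lemma borel_imp_lebesgue_measurable:
  "f \<in> borel_measurable borel \<Longrightarrow> f \<in> measurable lebesgue borel"
  by (rule measurable_completion) simp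

text \<open>Inner regularity replaces measurability of the profile \<open>h\<close>: a set of the form \<open>f -` S\<close> that
  contains a compact \<open>K\<close> also contains the closed set \<open>f -` (f ` K)\<close>.\<close>

lemma AE_nonpos_if_box_integrals_zero:
  fixes f :: "'a::euclidean_space \<Rightarrow> 'b::euclidean_space" and h :: "'b \<Rightarrow> real"
  assumes f: "continuous_on UNIV f" and int: "integrable lebesgue (\<lambda>x. h (f x))"
    and zero: "\<And>a b. (LINT x|lebesgue. indicator (box a b) (f x) * h (f x)) = 0"
  shows "AE x in lebesgue. h (f x) \<le> 0"
proof -
  define w where "w x = h (f x)" for x
  have w[measurable]: "w \<in> borel_measurable lebesgue" "integrable lebesgue w"
    using int unfolding w_def by auto
  have fb[measurable]: "f \<in> borel_measurable borel"
    using f by (rule borel_measurable_continuous_onI)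
  then have fm[measurable]: "f \<in> borel_measurable lebesgue"
    by (rule borel_imp_lebesgue_measurable)
  \<comment> \<open>Image measures under f of the positive and the negative part of w; the
    hypothesis on boxes says that they agree on a generating pi-system.\<close>
  define P where "P = distr (density lebesgue (\<lambda>x. ennreal (w x))) borel f"
  define N where "N = distr (density lebesgue (\<lambda>x. ennreal (- w x))) borel f"
  have P: "emeasure P B = (\<integral>\<^sup>+x. ennreal (indicator B (f x) * w x) \<partial>lebesgue)" if "B \<in> sets borel" for B
  proof -
    have "f -` B \<in> sets lebesgue" using measurable_sets[OF fm that] by simp
    then show ?thesis
      using that unfolding P_def
      by (auto simp: emeasure_distr emeasure_density intro!: nn_integral_cong split: split_indicator)
  qed
  have N: "emeasure N B = (\<integral>\<^sup>+x. ennreal (- (indicator B (f x) * w x)) \<partial>lebesgue)" if "B \<in> sets borel" for B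
  proof -
    have "f -` B \<in> sets lebesgue" using measurable_sets[OF fm that] by simp
    then show ?thesis
      using that unfolding N_def
      by (auto simp: emeasure_distr emeasure_density intro!: nn_integral_cong split: split_indicator)
  qed
  have wi: "integrable lebesgue (\<lambda>x. indicator B (f x) * w x)" if "B \<in> sets borel" for B
    by (rule Bochner_Integration.integrable_bound[OF w(2)]) (use that in \<open>auto split: split_indicator\<close>)
  have fin: "emeasure P B \<noteq> \<infinity>" "emeasure N B \<noteq> \<infinity>" if "B \<in> sets borel" for B
    using wi[OF that] unfolding P[OF that] N[OF that] real_integrable_def by auto
  have eq: "emeasure P (box a b) = emeasure N (box a b)" for a b
  proof -
    have "enn2real (emeasure P (box a b)) = enn2real (emeasure N (box a b))"
      using zero[of a b] unfolding P[OF box_borel] N[OF box_borel]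
      by (simp add: real_lebesgue_integral_def[OF wi[OF box_borel], of a b] w_def[symmetric])
    then show ?thesis using fin[OF box_borel, of a b]
      by (metis ennreal_enn2real infinity_ennreal_def less_top)
  qed
  have "P = N"
  proof (rule measure_eqI_generator_eq)
    let ?E = "range (\<lambda>(a, b). box a b::'b set)"
    show "Int_stable ?E"
      by (auto simp: Int_stable_def box_Int_box)
    show "?E \<subseteq> Pow UNIV" "sets P = sigma_sets UNIV ?E" "sets N = sigma_sets UNIV ?E"
      by (simp_all add: borel_eq_box P_def N_def)
    let ?A = "\<lambda>n::nat. box (- (real n *\<^sub>R One)) (real n *\<^sub>R One) :: 'b set"
    show "range ?A \<subseteq> ?E" "(\<Union>i. ?A i) = UNIV"
      unfolding UN_box_eq_UNIV by auto
    show "emeasure P (?A i) \<noteq> \<infinity>" for i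
      using fin by auto
    show "emeasure P X = emeasure N X" if "X \<in> ?E" for X
      using that eq by auto
  qed
  have null: "K \<in> null_sets lebesgue" if K: "compact K" "K \<subseteq> {x. w x > 0}" for K
  proof -
    define B where "B = f ` K"
    have B: "B \<in> sets borel"
      unfolding B_def using compact_continuous_image[OF continuous_on_subset[OF f] K(1)]
      by (auto intro!: borel_compact)
    have pos: "w x > 0" if "f x \<in> B" for x
    proof -
      obtain y where "y \<in> K" "f x = f y" using \<open>f x \<in> B\<close> unfolding B_def by blast
      then show ?thesis using K(2) unfolding w_def by (metis mem_Collect_eq subsetD)
    qed
    have "emeasure P B = emeasure N B" using \<open>P = N\<close> by simp
    also have "\<dots> = 0"
    proof -
      have "ennreal (- (indicator B (f x) * w x)) = 0" for x
        using pos[of x] by (cases "f x \<in> B") (simp_all add: ennreal_neg)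
      then show ?thesis unfolding N[OF B] by simp
    qed
    finally have "(\<integral>\<^sup>+x. ennreal (indicator B (f x) * w x) \<partial>lebesgue) = 0"
      unfolding P[OF B] .
    moreover have "(\<lambda>x. ennreal (indicator B (f x) * w x)) \<in> borel_measurable lebesgue"
      using wi[OF B] by simp
    ultimately have "AE x in lebesgue. ennreal (indicator B (f x) * w x) = 0"
      by (simp add: nn_integral_0_iff_AE)
    then have "AE x in lebesgue. x \<notin> K"
    proof eventually_elim
      case (elim x)
      then show ?case using pos[of x] unfolding B_def by (cases "x \<in> K") (auto simp: ennreal_eq_0_iff)
    qed
    then show ?thesis
      using K(1) by (subst (asm) AE_iff_null_sets[symmetric]) (auto simp: lmeasurable_compact fmeasurableD)
  qed
  have "{x. w x > 0} \<in> sets lebesgue"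
    using borel_measurable_less[of "\<lambda>_. 0" lebesgue w] by simp
  \<comment> \<open>Up to a null set, the set of positivity is a countable union of compact sets,
    and each of these is null.\<close>
  then obtain C T where CT: "fsigma C" "T \<in> null_sets lebesgue" "C \<union> T = {x. w x > 0}" "disjnt C T"
    by (rule lebesgue_set_almost_fsigma)
  obtain F :: "nat \<Rightarrow> 'a set" where "range F \<subseteq> Collect compact" and F: "C = \<Union> (range F)"
    using CT(1) unfolding fsigma_Union_compact by (elim exE conjE)
  then have cF: "compact (F n)" for n by (simp add: image_subset_iff)
  have "F n \<in> null_sets lebesgue" for n
    by (rule null[OF cF]) (use F CT(3) in auto)
  then have "C \<in> null_sets lebesgue" unfolding F by (rule null_sets_UN)
  with CT(2) have "{x. w x > 0} \<in> null_sets lebesgue"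
    unfolding CT(3)[symmetric] by (simp add: null_sets.Un)
  from AE_not_in[OF this] show ?thesis
    by (auto simp: w_def not_less)
qed

lemma AE_zero_if_box_integrals_zero:
  fixes f :: "'a::euclidean_space \<Rightarrow> 'b::euclidean_space" and h :: "'b \<Rightarrow> real"
  assumes "continuous_on UNIV f" "integrable lebesgue (\<lambda>x. h (f x))"
    and "\<And>a b. (LINT x|lebesgue. indicator (box a b) (f x) * h (f x)) = 0"
  shows "AE x in lebesgue. h (f x) = 0"
proof -
  have "AE x in lebesgue. h (f x) \<le> 0"
    by (rule AE_nonpos_if_box_integrals_zero[OF assms])
  moreover have "AE x in lebesgue. - h (f x) \<le> 0"
    by (rule AE_nonpos_if_box_integrals_zero[where h = "\<lambda>y. - h y"]) (use assms in auto)
  ultimately show ?thesis by eventually_elim simp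
qed

section \<open>Orthogonality to test functions\<close>

definition box_bump :: "real^'n::finite \<Rightarrow> real^'n \<Rightarrow> nat \<Rightarrow> real^'n \<Rightarrow> real" where
  "box_bump a b k x = (\<Prod>i\<in>UNIV. bump (a $ i) (b $ i) k (x $ i))"

lemma box_bump_bounds: "0 \<le> box_bump a b k x" "box_bump a b k x \<le> 1"
  unfolding box_bump_def using bump_nonneg bump_le_1 by (auto intro!: prod_nonneg prod_le_1)

lemma box_bump_tendsto: "(\<lambda>k. box_bump a b k x) \<longlonglongrightarrow> indicator (box a b) x"
proof -
  have "(\<lambda>k. box_bump a b k x) \<longlonglongrightarrow> (\<Prod>i\<in>UNIV. indicator {a $ i<..<b $ i} (x $ i))"
    unfolding box_bump_def by (intro tendsto_prod bump_tendsto)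
  moreover have "(\<Prod>i\<in>UNIV. indicator {a $ i<..<b $ i} (x $ i)) = (indicator (box a b) x :: real)"
    by (auto simp: indicator_def mem_box_cart prod_eq_1_iff split: if_splits) 
  ultimately show ?thesis by simp
qed

lemma box_bump_eq_0:
  assumes "x \<notin> box a b" shows "box_bump a b k x = 0"
proof -
  obtain i where "x $ i \<le> a $ i \<or> b $ i \<le> x $ i"
    using assms by (auto simp: mem_box_cart not_less)
  then have "bump (a $ i) (b $ i) k (x $ i) = 0" by (rule bump_eq_0)
  then show ?thesis
    unfolding box_bump_def by auto
qed

lemma smooth_class_box_bump: "smooth_class (box_bump a b k)"
  unfolding box_bump_def[abs_def] by (intro smooth_class_prod smooth1_bump)

lemma smooth_class_measurable:
  assumes "smooth_class f" shows "f \<in> borel_measurable borel"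
proof -
  have "f differentiable (at x)" for x
    using smooth_class_imp_smooth[OF assms] unfolding smooth_def by (metis foldr.simps(1) id_apply)
  then show ?thesis
    by (intro borel_measurable_continuous_onI continuous_at_imp_continuous_on)
      (auto intro: differentiable_imp_continuous_within)
qed

lemma test_function_if_bounded_support:
  assumes "smooth_class f" "bounded S" "\<And>x. x \<notin> S \<Longrightarrow> f x = 0"
  shows "test_function f"
  unfolding test_function_def
  using smooth_class_imp_smooth[OF assms(1)] bounded_subset[OF assms(2), of "{x. f x \<noteq> 0}"] assms(3)
  by (auto simp: compact_eq_bounded_closed intro: bounded_closure)

lemma test_function_box_bump: "test_function (box_bump a b k)"
  by (rule test_function_if_bounded_support[OF smooth_class_box_bump bounded_box])
    (rule box_bump_eq_0)

text \<open>Dominated convergence along the cut-offs \<open>box_bump\<close> turns test functions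
  into indicators of boxes. Since g is only locally integrable, the box criterion is applied to its
  truncations to an exhausting sequence of boxes.\<close>

lemma AE_zero_if_orthogonal_to_test_functions:
  fixes g :: "real^'n::finite \<Rightarrow> real"
  assumes g: "locally_integrable g"
    and orth: "\<And>\<phi>. test_function \<phi> \<Longrightarrow> (LINT x|lebesgue. g x * \<phi> x) = 0"
  shows "AE x in lebesgue. g x = 0"
proof -
  have set_int: "integrable lebesgue (\<lambda>x. indicator (cbox a b) x * g x)" for a b
    using g compact_cbox unfolding locally_integrable_def set_integrable_def by auto
  have boxint: "integrable lebesgue (\<lambda>x. indicator (box a b) x * g x)" for a b
  proof -
    have "indicator (box a b) x *\<^sub>R (indicator (cbox a b) x * g x) = indicator (box a b) x * g x" for x
      using box_subset_cbox[of a b] by (auto split: split_indicator)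
    moreover have "integrable lebesgue (\<lambda>x. indicator (box a b) x *\<^sub>R (indicator (cbox a b) x * g x))"
      by (rule integrable_mult_indicator[OF _ set_int]) simp
    ultimately show ?thesis by presburger
  qed
  have box0: "(LINT x|lebesgue. indicator (box a b) x * g x) = 0" for a b
  proof -
    have "(\<lambda>k. LINT x|lebesgue. indicator (box a b) x * g x * box_bump a b k x)
        \<longlonglongrightarrow> (LINT x|lebesgue. indicator (box a b) x * g x * indicator (box a b) x)"
    proof (rule integral_dominated_convergence[where w = "\<lambda>x. norm (indicator (box a b) x * g x)"])
      have bm: "box_bump a b k \<in> borel_measurable lebesgue" for k
        by (intro borel_imp_lebesgue_measurable smooth_class_measurable smooth_class_box_bump)
      show "(\<lambda>x. indicator (box a b) x * g x * box_bump a b k x) \<in> borel_measurable lebesgue" for k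
        by (rule borel_measurable_times[OF borel_measurable_integrable[OF boxint] bm])
      show "AE x in lebesgue. norm (indicator (box a b) x * g x * box_bump a b k x)
          \<le> norm (indicator (box a b) x * g x)" for k
        using box_bump_bounds[of a b k]
        by (intro AE_I2) (auto simp: abs_mult mult_left_le split: split_indicator)
      have "(\<lambda>x. indicator (box a b) x :: real) \<in> borel_measurable lebesgue"
        by (intro borel_imp_lebesgue_measurable) simp
      then show "(\<lambda>x. indicator (box a b) x * g x * indicator (box a b) x) \<in> borel_measurable lebesgue"
        by (rule borel_measurable_times[OF borel_measurable_integrable[OF boxint]])
      show "AE x in lebesgue. (\<lambda>k. indicator (box a b) x * g x * box_bump a b k x)
          \<longlonglongrightarrow> indicator (box a b) x * g x * indicator (box a b) x"
        by (intro AE_I2 tendsto_mult tendsto_const box_bump_tendsto)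
    qed (intro integrable_norm boxint)
    moreover have "(LINT x|lebesgue. indicator (box a b) x * g x * box_bump a b k x) = 0" for k
    proof -
      have "indicator (box a b) x * g x * box_bump a b k x = g x * box_bump a b k x" for x
        using box_bump_eq_0[of x a b k] by (auto split: split_indicator)
      then show ?thesis by (simp only: orth[OF test_function_box_bump])
    qed
    ultimately have "(LINT x|lebesgue. indicator (box a b) x * g x * indicator (box a b) x) = 0"
      by (simp add: LIMSEQ_const_iff)
    moreover have "indicator (box a b) x * g x * indicator (box a b) x = indicator (box a b) x * g x" for x
      by (auto split: split_indicator)
    ultimately show ?thesis by (simp only:)
  qed
  let ?A = "\<lambda>n::nat. box (- (real n *\<^sub>R One)) (real n *\<^sub>R One) :: (real^'n) set"
  have "AE x in lebesgue. indicator (?A n) x * g x = 0" for n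
  proof (rule AE_zero_if_box_integrals_zero[where f = "\<lambda>x. x"])
    fix a b :: "real^'n"
    obtain c d where cd: "box a b \<inter> ?A n = box c d"
      by (rule that[OF box_Int_box])
    have "indicator (box a b) x * (indicator (?A n) x * g x) = indicator (box c d) x * g x" for x
      unfolding cd[symmetric] by (auto split: split_indicator)
    then show "(LINT x|lebesgue. indicator (box a b) x * (indicator (?A n) x * g x)) = 0"
      by (simp only: box0)
  qed (rule continuous_on_id boxint)+
  then have "AE x in lebesgue. \<forall>n. indicator (?A n) x * g x = 0"
    by (subst AE_all_countable) (rule allI)
  then show ?thesis
  proof eventually_elim
    case (elim x)
    have "x \<in> (\<Union>n. ?A n)" unfolding UN_box_eq_UNIV by simp
    then obtain n where "x \<in> ?A n" by (rule UN_E)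
    then show ?case using elim[rule_format, of n] by simp
  qed
qed

lemma integrable_times_compact_support:
  fixes g :: "real^'n::finite \<Rightarrow> real"
  assumes "locally_integrable g" "compact K" and c: "continuous_on UNIV \<phi>"
    and out: "\<And>x. x \<notin> K \<Longrightarrow> \<phi> x = (0::real)"
  shows "integrable lebesgue (\<lambda>x. g x * \<phi> x)"
proof -
  have "bounded (\<phi> ` K)"
    using compact_continuous_image[OF continuous_on_subset[OF c] assms(2)] compact_imp_bounded by blast
  then obtain B where B: "\<And>x. x \<in> K \<Longrightarrow> \<bar>\<phi> x\<bar> \<le> B"
    by (auto simp: bounded_iff)
  have i0: "integrable lebesgue (\<lambda>x. indicator K x * g x)"
    using assms(1,2) by (auto simp: locally_integrable_def set_integrable_def)
  then have i: "integrable lebesgue (\<lambda>x. B * (indicator K x * g x))" by simp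
  have bm: "\<phi> \<in> borel_measurable lebesgue"
    by (intro borel_imp_lebesgue_measurable borel_measurable_continuous_onI c)
  have eq: "g x * \<phi> x = (indicator K x * g x) * \<phi> x" for x
    using out[of x] by (auto split: split_indicator)
  show ?thesis unfolding eq
  proof (rule Bochner_Integration.integrable_bound[OF i])
    show "AE x in lebesgue. norm (indicator K x * g x * \<phi> x) \<le> norm (B * (indicator K x * g x))"
    proof (intro AE_I2)
      fix x show "norm (indicator K x * g x * \<phi> x) \<le> norm (B * (indicator K x * g x))"
        using mult_right_mono[OF B[of x], of "\<bar>g x\<bar>"]
        by (auto simp: abs_mult mult.commute split: split_indicator intro: order_trans[OF _ mult_right_mono[OF abs_ge_self]])
    qed
  qed (rule borel_measurable_times[OF borel_measurable_integrable[OF i0] bm])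
qed

lemma test_function_integrable:
  assumes "locally_integrable g" "test_function \<phi>"
  shows "integrable lebesgue (\<lambda>x. g x * \<phi> x)"
proof (rule integrable_times_compact_support[OF assms(1)])
  show "compact (closure {x. \<phi> x \<noteq> 0})" using assms(2) by (simp add: test_function_def)
  have "\<phi> differentiable (at x)" for x
    using assms(2) unfolding test_function_def smooth_def by (metis foldr.simps(1) id_apply)
  then show "continuous_on UNIV \<phi>"
    by (intro continuous_at_imp_continuous_on) (auto intro: differentiable_imp_continuous_within)
  show "\<phi> x = 0" if "x \<notin> closure {x. \<phi> x \<noteq> 0}" for x
    using that closure_subset[of "{x. \<phi> x \<noteq> 0}"] by auto
qed

lemma locally_integrable_lincomb:
  assumes "locally_integrable f" "locally_integrable g"
  shows "locally_integrable (\<lambda>x. a * f x + b * g x)"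
  using assms unfolding locally_integrable_def by (auto intro!: set_integral_add set_integrable_mult_right)

text \<open>\<open>weak_laplacian\<close> is a choice among representatives, so this is what later
  gives its linearity almost everywhere.\<close>

lemma has_weak_laplacian_unique:
  assumes "has_weak_laplacian u f" "has_weak_laplacian u g"
  shows "AE x in lebesgue. f x = g x"
proof -
  have li: "locally_integrable f" "locally_integrable g"
    using assms by (auto simp: has_weak_laplacian_def)
  have "AE x in lebesgue. 1 * f x + (-1) * g x = 0"
  proof (rule AE_zero_if_orthogonal_to_test_functions[OF locally_integrable_lincomb[OF li]])
    fix \<phi> :: "real^'a \<Rightarrow> real" assume \<phi>: "test_function \<phi>"
    have "(LINT x|lebesgue. f x * \<phi> x) = (LINT x|lebesgue. g x * \<phi> x)"
      using assms \<phi> by (simp add: has_weak_laplacian_def)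
    then show "(LINT x|lebesgue. (1 * f x + (-1) * g x) * \<phi> x) = 0"
      using test_function_integrable[OF li(1) \<phi>] test_function_integrable[OF li(2) \<phi>]
      by (simp add: left_diff_distrib)
  qed
  then show ?thesis by eventually_elim simp
qed

section \<open>Polar coordinates and the radial Newton potential\<close>

lemma sigma_finite_lebesgue: "sigma_finite_measure (lebesgue :: 'a::euclidean_space measure)"
proof
  have "(\<Union>n. cball 0 (real n)) = (UNIV :: 'a set)"
    using real_arch_simple by (auto simp: dist_norm)
  then show "\<exists>A. countable A \<and> A \<subseteq> sets lebesgue \<and> \<Union>A = space (lebesgue :: 'a measure) \<and>
      (\<forall>a\<in>A. emeasure lebesgue a \<noteq> \<infinity>)"
    by (intro exI[of _ "range (\<lambda>n. cball 0 (real n))"])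
      (auto simp: emeasure_completion emeasure_cball)
qed

interpretation lebesgue_pair: pair_sigma_finite
    "lebesgue :: 'a::euclidean_space measure" "lebesgue :: 'b::euclidean_space measure"
  by (intro pair_sigma_finite.intro sigma_finite_lebesgue)

section \<open>Integration of radial functions in polar coordinates\<close>

definition shell_density :: "'a::euclidean_space itself \<Rightarrow> real \<Rightarrow> real" where
  "shell_density _ t = (if 0 < t then DIM('a) * unit_ball_vol DIM('a) * t ^ (DIM('a) - 1) else 0)"

lemma shell_density_nonneg: "0 \<le> shell_density TYPE('a::euclidean_space) t"
  by (simp add: shell_density_def)

lemma shell_density_measurable [measurable]:
  "shell_density TYPE('a::euclidean_space) \<in> borel_measurable borel"
  unfolding shell_density_def[abs_def] by measurable

text \<open>Both measures give the half-line up to a the volume of the ball of radius a, and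
  half-lines form a generating pi-system. The density is the area of the sphere of radius t, the
  derivative of that volume.\<close>

lemma distr_norm:
  "distr lborel borel (norm :: 'a::euclidean_space \<Rightarrow> real)
    = density lborel (\<lambda>t. ennreal (shell_density TYPE('a) t))" (is "?M = ?N")
proof -
  let ?V = "unit_ball_vol (real DIM('a))"
  have M: "emeasure ?M {..a} = ennreal (if a < 0 then 0 else ?V * a ^ DIM('a))" for a
  proof -
    have "norm -` {..a} = (if a < 0 then {} else cball (0::'a) a)"
      by (auto simp: dist_norm dest: order_trans[OF norm_ge_zero])
    then show ?thesis
      by (subst emeasure_distr) (auto simp: emeasure_cball)
  qed
  have N: "emeasure ?N {..a} = ennreal (if a < 0 then 0 else ?V * a ^ DIM('a))" for a
  proof -
    have "emeasure ?N {..a} = (\<integral>\<^sup>+t. ennreal (shell_density TYPE('a) t) * indicator {..a} t \<partial>lborel)"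
      by (simp add: emeasure_density)
    also have "\<dots> = ennreal (if a < 0 then 0 else ?V * a ^ DIM('a))"
    proof (cases "a < 0")
      case True
      then have eq: "ennreal (shell_density TYPE('a) t) * indicator {..a} t = 0" for t
        by (auto simp: shell_density_def split: split_indicator)
      have "(\<integral>\<^sup>+t. ennreal (shell_density TYPE('a) t) * indicator {..a} t \<partial>lborel) = (\<integral>\<^sup>+(t::real). 0 \<partial>lborel)"
        by (rule nn_integral_cong, rule eq)
      then show ?thesis using True by simp
    next
      case False
      have "(\<integral>\<^sup>+t. ennreal (shell_density TYPE('a) t) * indicator {..a} t \<partial>lborel)
        = (\<integral>\<^sup>+t. ennreal (DIM('a) * ?V * t ^ (DIM('a) - 1)) * indicator {0..a} t \<partial>lborel)"
        by (intro nn_integral_cong_AE, use AE_lborel_singleton[of 0] in eventually_elim)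
          (auto simp: shell_density_def split: split_indicator)
      also have "\<dots> = ennreal (?V * a ^ DIM('a) - ?V * 0 ^ DIM('a))"
        using False
        by (intro nn_integral_FTC_Icc) (auto intro!: derivative_eq_intros)
      finally show ?thesis using False by (simp add: zero_power)
    qed
    finally show ?thesis .
  qed
  show ?thesis
  proof (rule measure_eqI_generator_eq)
    let ?E = "range (\<lambda>a::real. {..a})"
    show "Int_stable ?E" by (auto simp: Int_stable_def)
    show "?E \<subseteq> Pow UNIV" "sets ?M = sigma_sets UNIV ?E" "sets ?N = sigma_sets UNIV ?E"
      by (simp_all add: borel_eq_atMost)
    show "range (\<lambda>n::nat. {..real n}) \<subseteq> ?E" "(\<Union>n::nat. {..real n}) = UNIV"
      using real_arch_simple by auto
    show "emeasure ?M {..real i} \<noteq> \<infinity>" for i by (simp add: M)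
    show "emeasure ?M X = emeasure ?N X" if "X \<in> ?E" for X
      using that M N by auto
  qed
qed

lemma nn_integral_norm:
  assumes [measurable]: "f \<in> borel_measurable borel"
  shows "(\<integral>\<^sup>+x. f (norm (x::'a::euclidean_space)) \<partial>lebesgue)
    = (\<integral>\<^sup>+t. ennreal (shell_density TYPE('a) t) * f t \<partial>lborel)"
proof -
  have "(\<integral>\<^sup>+x. f (norm (x::'a)) \<partial>lebesgue) = (\<integral>\<^sup>+t. f t \<partial>distr lborel borel (norm :: 'a \<Rightarrow> real))"
    by (simp add: nn_integral_completion nn_integral_distr)
  also have "\<dots> = (\<integral>\<^sup>+t. ennreal (shell_density TYPE('a) t) * f t \<partial>lborel)"
    unfolding distr_norm by (rule nn_integral_density) auto
  finally show ?thesis .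
qed

lemma has_bochner_integral_norm:
  fixes f :: "real \<Rightarrow> real"
  assumes [measurable]: "f \<in> borel_measurable borel"
    and "has_bochner_integral lborel (\<lambda>t. shell_density TYPE('a) t * f t) I"
  shows "has_bochner_integral lebesgue (\<lambda>x. f (norm (x::'a::euclidean_space))) I"
proof -
  have "integrable (distr lborel borel (norm :: 'a \<Rightarrow> real)) f"
    unfolding distr_norm using assms shell_density_nonneg
    by (subst integrable_density) (auto simp: has_bochner_integral_iff)
  then have "integrable lborel (\<lambda>x. f (norm (x::'a)))"
    by (subst (asm) integrable_distr_eq) auto
  moreover have "(LINT x|lborel. f (norm (x::'a))) = integral\<^sup>L (distr lborel borel (norm :: 'a \<Rightarrow> real)) f"
    by (subst integral_distr) auto
  moreover have "\<dots> = I"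
    unfolding distr_norm using assms shell_density_nonneg
    by (subst integral_density) (auto simp: has_bochner_integral_iff)
  ultimately show ?thesis
    by (simp add: has_bochner_integral_iff integrable_completion integral_completion)
qed

lemma shell_density_4: "0 < t \<Longrightarrow> shell_density TYPE(real^4) t = 2 * pi\<^sup>2 * t ^ 3"
  by (simp add: shell_density_def unit_ball_vol_4)

lemma has_bochner_integral_norm_4:
  fixes f :: "real \<Rightarrow> real"
  assumes "f \<in> borel_measurable borel" "0 \<le> T" "\<And>t. T < t \<Longrightarrow> f t = 0"
    and "has_bochner_integral lborel (\<lambda>t. indicator {0..T} t * (t ^ 3 * f t)) I"
  shows "has_bochner_integral lebesgue (\<lambda>x. f (norm (x::real^4))) (2 * pi\<^sup>2 * I)"
proof (rule has_bochner_integral_norm[OF assms(1)])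
  have "has_bochner_integral lborel (\<lambda>t. 2 * pi\<^sup>2 * (indicator {0..T} t * (t ^ 3 * f t))) (2 * pi\<^sup>2 * I)"
    using assms(4) by (intro has_bochner_integral_mult_right) 
  moreover have "2 * pi\<^sup>2 * (indicator {0..T} t * (t ^ 3 * f t)) = shell_density TYPE(real^4) t * f t" for t
  proof (cases "0 < t")
    case True
    then show ?thesis using assms(3)[of t]
      by (auto simp: shell_density_4 not_less split: split_indicator)
  next
    case False
    then show ?thesis by (auto simp: shell_density_def split: split_indicator)
  qed
  ultimately show "has_bochner_integral lborel (\<lambda>t. shell_density TYPE(real^4) t * f t) (2 * pi\<^sup>2 * I)"
    by (simp only:)
qed

text \<open>The antiderivatives on the two pieces are \<open>2 t\<^sup>4 h'(t\<^sup>2) / \<rho>\<^sup>2\<close> and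
  \<open>2 (t\<^sup>2 h'(t\<^sup>2) + h(t\<^sup>2))\<close>.\<close>

lemma newton_kernel_laplacian:
  fixes h h' h'' :: "real \<Rightarrow> real"
  assumes h: "\<And>s. (h has_real_derivative h' s) (at s)" "\<And>s. (h' has_real_derivative h'' s) (at s)"
    and cont: "continuous_on UNIV h''"
    and R: "0 \<le> R" "\<And>s. R\<^sup>2 < s \<Longrightarrow> h s = 0" "\<And>s. R\<^sup>2 < s \<Longrightarrow> h' s = 0" "\<And>s. R\<^sup>2 < s \<Longrightarrow> h'' s = 0"
    and \<rho>: "0 < \<rho>"
  shows "has_bochner_integral lebesgue
    (\<lambda>x::real^4. (4 * (norm x)\<^sup>2 * h'' ((norm x)\<^sup>2) + 8 * h' ((norm x)\<^sup>2)) / (max (norm x) \<rho>)\<^sup>2)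
    (- 4 * pi\<^sup>2 * h (\<rho>\<^sup>2))"
proof -
  define \<psi> where "\<psi> s = 4 * s * h'' s + 8 * h' s" for s
  define T where "T = max R \<rho> + 1"
  have T: "\<rho> < T" "R < T" "0 \<le> T" using R(1) by (auto simp: T_def)
  have ch': "continuous_on UNIV h'"
    using h(2) by (intro continuous_at_imp_continuous_on) (auto intro: DERIV_isCont)
  have c\<psi>: "continuous_on A (\<lambda>t. \<psi> (t\<^sup>2))" for A
    unfolding \<psi>_def
    by (intro continuous_intros continuous_on_compose2[OF cont] continuous_on_compose2[OF ch']) auto
  have T0: "R\<^sup>2 < t\<^sup>2" if "R < t" for t
    using that R(1) by (intro power_strict_mono) auto
  have d1: "((\<lambda>t. h (t\<^sup>2)) has_real_derivative h' (t\<^sup>2) * (2 * t)) (at t)"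
    and d2: "((\<lambda>t. h' (t\<^sup>2)) has_real_derivative h'' (t\<^sup>2) * (2 * t)) (at t)" for t
    by (auto intro!: DERIV_chain2[OF h(1)] DERIV_chain2[OF h(2)] derivative_eq_intros)
  have 1: "has_bochner_integral lborel (\<lambda>t. indicator {0..\<rho>} t *\<^sub>R (t ^ 3 * (\<psi> (t\<^sup>2) / \<rho>\<^sup>2)))
      (2 / \<rho>\<^sup>2 * (\<rho> ^ 4 * h' (\<rho>\<^sup>2)) - 2 / \<rho>\<^sup>2 * (0 ^ 4 * h' (0\<^sup>2)))"
  proof (rule has_bochner_integral_FTC_Icc)
    show "((\<lambda>t. 2 / \<rho>\<^sup>2 * (t ^ 4 * h' (t\<^sup>2))) has_vector_derivative t ^ 3 * (\<psi> (t\<^sup>2) / \<rho>\<^sup>2))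
      (at t within {0..\<rho>})" for t
      unfolding has_real_derivative_iff_has_vector_derivative[symmetric]
      by (rule has_field_derivative_at_within, rule DERIV_cong, (rule derivative_eq_intros d2 refl)+)
        (use \<rho> in \<open>simp add: \<psi>_def field_simps power_numeral_reduce\<close>)
    show "continuous_on {0..\<rho>} (\<lambda>t. t ^ 3 * (\<psi> (t\<^sup>2) / \<rho>\<^sup>2))"
      using \<rho> by (intro continuous_intros c\<psi>) auto
  qed (use \<rho> in auto)
  have 2: "has_bochner_integral lborel (\<lambda>t. indicator {\<rho>..T} t *\<^sub>R (t * \<psi> (t\<^sup>2)))
      (2 * (T\<^sup>2 * h' (T\<^sup>2) + h (T\<^sup>2)) - 2 * (\<rho>\<^sup>2 * h' (\<rho>\<^sup>2) + h (\<rho>\<^sup>2)))"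
  proof (rule has_bochner_integral_FTC_Icc)
    show "((\<lambda>t. 2 * (t\<^sup>2 * h' (t\<^sup>2) + h (t\<^sup>2))) has_vector_derivative t * \<psi> (t\<^sup>2))
      (at t within {\<rho>..T})" for t
      unfolding has_real_derivative_iff_has_vector_derivative[symmetric]
      by (rule has_field_derivative_at_within, rule DERIV_cong, (rule derivative_eq_intros d1 d2 refl)+)
        (simp add: \<psi>_def field_simps power_numeral_reduce)
    show "continuous_on {\<rho>..T} (\<lambda>t. t * \<psi> (t\<^sup>2))"
      by (intro continuous_intros c\<psi>)
  qed (use T in auto)
  \<comment> \<open>The boundary terms 2 \<rho>^2 h'(\<rho>^2) of the two pieces cancel and those at
    0 and T vanish. The sphere area 2 pi^2 later multiplies the remaining -2 h(\<rho>^2).\<close>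
  have sum: "has_bochner_integral lborel
      (\<lambda>t. indicator {0..\<rho>} t *\<^sub>R (t ^ 3 * (\<psi> (t\<^sup>2) / \<rho>\<^sup>2)) + indicator {\<rho>..T} t *\<^sub>R (t * \<psi> (t\<^sup>2)))
      (- 2 * h (\<rho>\<^sup>2))"
    using has_bochner_integral_add[OF 1 2] \<rho> T R T0[OF T(2)]
    by (simp add: power_numeral_reduce)
  have "has_bochner_integral lebesgue (\<lambda>x::real^4. \<psi> ((norm x)\<^sup>2) / (max (norm x) \<rho>)\<^sup>2) (2 * pi\<^sup>2 * (- 2 * h (\<rho>\<^sup>2)))"
  proof (rule has_bochner_integral_norm_4[where f = "\<lambda>t. \<psi> (t\<^sup>2) / (max t \<rho>)\<^sup>2", OF _ T(3)])
    have m: "(\<lambda>t. \<psi> (t\<^sup>2)) \<in> borel_measurable borel"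
      by (intro borel_measurable_continuous_onI c\<psi>)
    then show "(\<lambda>t. \<psi> (t\<^sup>2) / (max t \<rho>)\<^sup>2) \<in> borel_measurable borel" by measurable
    show "\<psi> (t\<^sup>2) / (max t \<rho>)\<^sup>2 = 0" if "T < t" for t
      using R T0[of t] that T by (simp add: \<psi>_def)
    show "has_bochner_integral lborel (\<lambda>t. indicator {0..T} t * (t ^ 3 * (\<psi> (t\<^sup>2) / (max t \<rho>)\<^sup>2))) (- 2 * h (\<rho>\<^sup>2))"
    proof (rule has_bochner_integral_cong_AE[THEN iffD1, OF _ _ _ sum])
      show "AE t in lborel. indicator {0..\<rho>} t *\<^sub>R (t ^ 3 * (\<psi> (t\<^sup>2) / \<rho>\<^sup>2)) + indicator {\<rho>..T} t *\<^sub>R (t * \<psi> (t\<^sup>2))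
          = indicator {0..T} t * (t ^ 3 * (\<psi> (t\<^sup>2) / (max t \<rho>)\<^sup>2))"
        using AE_lborel_singleton[of \<rho>]
        by eventually_elim (use \<rho> T in \<open>auto simp: max_def power_numeral_reduce split: split_indicator\<close>)
    qed (use m in \<open>auto intro!: borel_measurable_has_bochner_integral[OF sum]\<close>)
  qed
  then show ?thesis by (simp add: \<psi>_def mult.assoc)
qed

section \<open>The radial Newton potential and its weak equation\<close>

lemma continuous_antiderivative:
  fixes f :: "real \<Rightarrow> real"
  assumes "continuous_on UNIV f"
  obtains F where "\<And>x. (F has_real_derivative f x) (at x)" "F c = 0"
proof -
  have "isCont f x" for x using assms by (simp add: continuous_on_eq_continuous_at)
  then obtain F where F: "\<And>x. (F has_vector_derivative f x) (at x)"
    using einterval_antiderivative[of "-\<infinity>" \<infinity> f] by auto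
  have "((\<lambda>x. F x - F c) has_real_derivative f x) (at x)" for x
    using F[of x] by (auto intro!: derivative_eq_intros simp: has_real_derivative_iff_has_vector_derivative)
  then show thesis using that[of "\<lambda>x. F x - F c"] by simp
qed

lemma smooth1_continuous: "smooth1 f \<Longrightarrow> continuous_on A f"
  by (rule continuous_at_imp_continuous_on) (auto elim: smooth1_derivative intro: DERIV_isCont)

lemma constant_if_derivative_zero:
  fixes F :: "real \<Rightarrow> real"
  assumes "\<And>x. (F has_real_derivative f x) (at x)" "\<And>x. a < x \<Longrightarrow> x < b \<Longrightarrow> f x = 0" "a \<le> b"
  shows "F a = F b"
proof (cases "a = b")
  case False
  with assms(3) have "a < b" by simp
  moreover have "continuous_on {a..b} F"
    using assms(1) by (intro continuous_at_imp_continuous_on) (auto intro: DERIV_isCont)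
  moreover have "DERIV F x :> 0" if "a < x" "x < b" for x
    using assms(1)[of x] assms(2)[OF that] by simp
  ultimately show ?thesis using DERIV_isconst_end[of a b F] by simp
qed simp

text \<open>The constant 4 pi^2, twice the area of the unit sphere, normalises the fundamental
  solution -1/(4 pi^2 |x|^2) of the Laplacian on R^4. The kernel max(r, |y|)^(-2) is the mean of |x
  - y|^(-2) over the sphere |x| = r, so the potential depends on the radius alone even if g is not
  radial.\<close>

definition newton :: "(real^4 \<Rightarrow> real) \<Rightarrow> real \<Rightarrow> real" where
  "newton g r = - (LINT y|lebesgue. g y / (max r (norm y))\<^sup>2) / (4 * pi\<^sup>2)"

text \<open>Integrability of the potential is assumed at r = 1 only and transferred from there to
  all r > 0. The loss 1/r^2 is harmless at the origin, being integrable against r^3 dr.\<close>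

lemma kernel_le:
  fixes r n :: real
  assumes "0 < r" "0 \<le> n"
  shows "1 / (max r n)\<^sup>2 \<le> (1 + 1 / r\<^sup>2) * (1 / (max 1 n)\<^sup>2)"
proof (cases "1 \<le> n")
  case True
  have "1 / (max r n)\<^sup>2 \<le> 1 / n\<^sup>2"
    using True by (intro divide_left_mono power_mono) auto
  also have "\<dots> \<le> (1 + 1 / r\<^sup>2) * (1 / n\<^sup>2)"
    using True by (simp add: divide_right_mono)
  finally show ?thesis using True by (simp add: max_def)
next
  case False
  have "1 / (max r n)\<^sup>2 \<le> 1 / r\<^sup>2"
    using assms by (intro divide_left_mono power_mono) auto
  then show ?thesis using False by (simp add: max_def)
qed

lemma norm_measurable_lebesgue [measurable]:
  "(norm :: 'a::euclidean_space \<Rightarrow> real) \<in> borel_measurable lebesgue"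
  by (intro borel_imp_lebesgue_measurable) simp

context
  fixes g :: "real^4 \<Rightarrow> real"
  assumes g_meas [measurable]: "g \<in> borel_measurable lebesgue"
    and g_int: "integrable lebesgue (\<lambda>y. g y / (max 1 (norm y))\<^sup>2)"
begin

lemma kernel_bound:
  assumes "0 < r"
  shows "norm (g y / (max r (norm y))\<^sup>2) \<le> norm ((1 + 1 / r\<^sup>2) * (g y / (max 1 (norm y))\<^sup>2))"
proof -
  have "\<bar>g y\<bar> * (1 / (max r (norm y))\<^sup>2) \<le> \<bar>g y\<bar> * ((1 + 1 / r\<^sup>2) * (1 / (max 1 (norm y))\<^sup>2))"
    using assms by (intro mult_left_mono kernel_le) auto
  then show ?thesis by (simp add: abs_mult mult_ac)
qed

lemma newton_integrable:
  assumes "0 < r"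
  shows "integrable lebesgue (\<lambda>y. g y / (max r (norm y))\<^sup>2)"
  by (rule Bochner_Integration.integrable_bound[OF integrable_mult_right[OF g_int, of "1 + 1 / r\<^sup>2"]])
    (use kernel_bound[OF assms] in auto)

lemma newton_abs_le:
  assumes "0 < r"
  shows "(LINT y|lebesgue. \<bar>g y / (max r (norm y))\<^sup>2\<bar>)
    \<le> (1 + 1 / r\<^sup>2) * (LINT y|lebesgue. \<bar>g y / (max 1 (norm y))\<^sup>2\<bar>)"
proof -
  have "(LINT y|lebesgue. \<bar>g y / (max r (norm y))\<^sup>2\<bar>)
    \<le> (LINT y|lebesgue. (1 + 1 / r\<^sup>2) * \<bar>g y / (max 1 (norm y))\<^sup>2\<bar>)"
  proof (rule integral_mono)
    show "\<bar>g y / (max r (norm y))\<^sup>2\<bar> \<le> (1 + 1 / r\<^sup>2) * \<bar>g y / (max 1 (norm y))\<^sup>2\<bar>" for y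
      using kernel_bound[OF assms, of y] by (simp add: abs_mult)
  qed (intro integrable_mult_right integrable_abs newton_integrable[OF assms] g_int)+
  then show ?thesis by (simp only: integral_mult_right_zero)
qed

lemma newton_measurable: "newton g \<in> borel_measurable borel"
proof -
  have "(\<lambda>(r, y). g y / (max r (norm y))\<^sup>2) \<in> borel_measurable (borel \<Otimes>\<^sub>M lebesgue)"
    by measurable
  from sigma_finite_measure.borel_measurable_lebesgue_integral[OF sigma_finite_lebesgue this]
  show ?thesis unfolding newton_def[abs_def] by measurable
qed

text \<open>Fubini moves the Laplacian of the radial test function onto the kernel, where
  \<open>newton_kernel_laplacian\<close> with \<rho> = |y| evaluates the inner integral as -4 pi^2
  h(|y|^2). Thus the potential solves the equation weakly against radial test functions.\<close>

lemma newton_laplacian: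
  fixes h h' h'' :: "real \<Rightarrow> real"
  assumes h: "\<And>s. (h has_real_derivative h' s) (at s)" "\<And>s. (h' has_real_derivative h'' s) (at s)"
    and cont: "continuous_on UNIV h''"
    and R: "0 \<le> R" "\<And>s. R\<^sup>2 < s \<Longrightarrow> h s = 0" "\<And>s. R\<^sup>2 < s \<Longrightarrow> h' s = 0" "\<And>s. R\<^sup>2 < s \<Longrightarrow> h'' s = 0"
  defines "\<psi> \<equiv> \<lambda>x::real^4. 4 * (norm x)\<^sup>2 * h'' ((norm x)\<^sup>2) + 8 * h' ((norm x)\<^sup>2)"
  shows "has_bochner_integral lebesgue (\<lambda>x. newton g (norm x) * \<psi> x)
    (LINT y|lebesgue. g y * h ((norm y)\<^sup>2))"
proof -
  have ch': "continuous_on UNIV h'"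
    using h(2) by (intro continuous_at_imp_continuous_on) (auto intro: DERIV_isCont)
  define \<Psi> where "\<Psi> t = 4 * t\<^sup>2 * h'' (t\<^sup>2) + 8 * h' (t\<^sup>2)" for t
  have c\<Psi>: "continuous_on A \<Psi>" for A
    unfolding \<Psi>_def
    by (intro continuous_intros continuous_on_compose2[OF cont] continuous_on_compose2[OF ch']) auto
  have m\<Psi>[measurable]: "\<Psi> \<in> borel_measurable borel"
    by (intro borel_measurable_continuous_onI c\<Psi>)
  have \<psi>_eq: "\<psi> x = \<Psi> (norm x)" for x by (simp add: \<psi>_def \<Psi>_def)
  have [measurable]: "\<psi> \<in> borel_measurable lebesgue"
    unfolding \<psi>_eq[abs_def] by measurable
  have \<Psi>0: "\<Psi> t = 0" if "R < t" for t
  proof -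
    have "R\<^sup>2 < t\<^sup>2" using that R(1) by (intro power_strict_mono) auto
    then show ?thesis using R by (simp add: \<Psi>_def)
  qed
  \<comment> \<open>Together with \<open>newton_abs_le\<close> this dominates the double integral;
    in polar coordinates the factor 1 + 1/t^2 becomes t^3 + t, continuous at the origin.\<close>
  have a: "integrable lebesgue (\<lambda>x. \<bar>\<psi> x\<bar> * (1 + 1 / (norm x)\<^sup>2))"
  proof -
    have "set_integrable lborel {0..R} (\<lambda>t. \<bar>\<Psi> t\<bar> * (t ^ 3 + t))"
      by (intro borel_integrable_atLeastAtMost' continuous_intros c\<Psi>)
    moreover have "indicator {0..R} t *\<^sub>R (\<bar>\<Psi> t\<bar> * (t ^ 3 + t)) = indicator {0..R} t * (t ^ 3 * (\<bar>\<Psi> t\<bar> * (1 + 1 / t\<^sup>2)))" for t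
      by (cases "t = 0") (auto simp: field_simps power2_eq_square power3_eq_cube split: split_indicator)
    ultimately have "integrable lborel (\<lambda>t. indicator {0..R} t * (t ^ 3 * (\<bar>\<Psi> t\<bar> * (1 + 1 / t\<^sup>2))))"
      unfolding set_integrable_def by (simp only:)
    from has_bochner_integral_norm_4[OF _ R(1) _ has_bochner_integral_integrable[OF this]]
    show ?thesis
      unfolding \<psi>_eq using \<Psi>0 by (auto simp: has_bochner_integral_iff)
  qed
  define f where "f = (\<lambda>x y. \<psi> x * (g y / (max (norm x) (norm y))\<^sup>2))"
  define C where "C = (LINT y|lebesgue. \<bar>g y / (max 1 (norm y))\<^sup>2\<bar>)"
  have AE_nonzero: "AE x in lebesgue. x \<noteq> (0::real^4)"
    by (rule AE_completion[OF AE_lborel_singleton])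
  have int: "integrable (lebesgue \<Otimes>\<^sub>M lebesgue) (case_prod f)"
  proof (rule lebesgue_pair.Fubini_integrable)
    show f_meas[measurable]: "case_prod f \<in> borel_measurable (lebesgue \<Otimes>\<^sub>M lebesgue)"
      unfolding f_def by measurable
    have inner: "(\<integral>y. norm (case (x, y) of (x, y) \<Rightarrow> f x y) \<partial>lebesgue)
        = \<bar>\<psi> x\<bar> * (LINT y|lebesgue. \<bar>g y / (max (norm x) (norm y))\<^sup>2\<bar>)" for x
      by (simp only: f_def prod.case real_norm_def abs_mult[of "\<psi> x"] integral_mult_right_zero)
    show "integrable lebesgue (\<lambda>x. \<integral>y. norm (case (x, y) of (x, y) \<Rightarrow> f x y) \<partial>lebesgue)"
    proof (rule Bochner_Integration.integrable_bound[OF integrable_mult_left[OF a, of C]])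
      show "(\<lambda>x. \<integral>y. norm (case (x, y) of (x, y) \<Rightarrow> f x y) \<partial>lebesgue) \<in> borel_measurable lebesgue"
        by (rule sigma_finite_measure.borel_measurable_lebesgue_integral[OF sigma_finite_lebesgue])
          (use f_meas in measurable)
      show "AE x in lebesgue. norm (\<integral>y. norm (case (x, y) of (x, y) \<Rightarrow> f x y) \<partial>lebesgue)
          \<le> norm (\<bar>\<psi> x\<bar> * (1 + 1 / (norm x)\<^sup>2) * C)"
        using AE_nonzero
      proof eventually_elim
        case (elim x)
        have C0: "0 \<le> C" unfolding C_def by simp
        have "\<bar>\<psi> x\<bar> * (LINT y|lebesgue. \<bar>g y / (max (norm x) (norm y))\<^sup>2\<bar>) \<le> \<bar>\<psi> x\<bar> * ((1 + 1 / (norm x)\<^sup>2) * C)"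
          using elim unfolding C_def by (intro mult_left_mono newton_abs_le) auto
        then show ?case
          unfolding inner using C0 by (simp add: abs_mult mult.assoc)
      qed
    qed
    show "AE x in lebesgue. integrable lebesgue (\<lambda>y. case (x, y) of (x, y) \<Rightarrow> f x y)"
      using AE_nonzero
    proof eventually_elim
      case (elim x)
      have "integrable lebesgue (\<lambda>y. \<psi> x * (g y / (max (norm x) (norm y))\<^sup>2))"
        using elim by (intro integrable_mult_right newton_integrable) simp
      then show ?case by (simp only: f_def prod.case)
    qed
  qed
  have fx: "(LINT y|lebesgue. f x y) = - 4 * pi\<^sup>2 * (newton g (norm x) * \<psi> x)" for x
    by (simp only: f_def integral_mult_right_zero) (simp add: newton_def)
  have fy: "AE y in lebesgue. (LINT x|lebesgue. f x y) = - 4 * pi\<^sup>2 * (g y * h ((norm y)\<^sup>2))"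
    using AE_nonzero
  proof eventually_elim
    case (elim y)
    have "(LINT x|lebesgue. \<psi> x / (max (norm x) (norm y))\<^sup>2) = - 4 * pi\<^sup>2 * h ((norm y)\<^sup>2)"
      using newton_kernel_laplacian[OF h cont R, of "norm y"] elim
      by (auto simp: has_bochner_integral_iff \<psi>_def)
    moreover have "f x y = g y * (\<psi> x / (max (norm x) (norm y))\<^sup>2)" for x by (simp add: f_def)
    ultimately have "(LINT x|lebesgue. f x y) = g y * (- 4 * pi\<^sup>2 * h ((norm y)\<^sup>2))"
      by (simp only: integral_mult_right_zero)
    then show ?case by simp
  qed
  have "integrable lebesgue (\<lambda>x. LINT y|lebesgue. f x y)"
    using lebesgue_pair.integrable_fst'[OF int] by simp
  then have "integrable lebesgue (\<lambda>x. (- 1 / (4 * pi\<^sup>2)) * (- 4 * pi\<^sup>2 * (newton g (norm x) * \<psi> x)))"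
    unfolding fx by (rule integrable_mult_right)
  then have "integrable lebesgue (\<lambda>x. newton g (norm x) * \<psi> x)" by simp
  moreover have "- 4 * pi\<^sup>2 * (LINT x|lebesgue. newton g (norm x) * \<psi> x)
    = - 4 * pi\<^sup>2 * (LINT y|lebesgue. g y * h ((norm y)\<^sup>2))"
  proof -
    have "(LINT x|lebesgue. LINT y|lebesgue. f x y) = (LINT y|lebesgue. LINT x|lebesgue. f x y)"
      by (rule lebesgue_pair.Fubini_integral[OF int, symmetric])
    also have "\<dots> = (LINT y|lebesgue. - 4 * pi\<^sup>2 * (g y * h ((norm y)\<^sup>2)))"
    proof (rule integral_cong_AE[OF _ _ fy])
      show "(\<lambda>y. LINT x|lebesgue. f x y) \<in> borel_measurable lebesgue"
        using lebesgue_pair.integrable_snd[OF int] by simp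
      have [measurable]: "h \<in> borel_measurable borel"
        using h(1) by (intro borel_measurable_continuous_onI continuous_at_imp_continuous_on)
          (auto intro: DERIV_isCont)
      show "(\<lambda>y. - 4 * pi\<^sup>2 * (g y * h ((norm y)\<^sup>2))) \<in> borel_measurable lebesgue"
        by measurable
    qed
    finally show ?thesis unfolding fx by simp
  qed
  ultimately show ?thesis by (simp add: has_bochner_integral_iff)
qed

end

section \<open>Identification of radial functions with potentials\<close>

lemma locally_integrable_measurable:
  fixes g :: "real^'n::finite \<Rightarrow> real"
  assumes "locally_integrable g"
  shows "g \<in> borel_measurable lebesgue"
proof (rule borel_measurable_LIMSEQ_real)
  show "(\<lambda>x. indicator (cball 0 (real n)) x * g x) \<in> borel_measurable lebesgue" for n
    using assms[unfolded locally_integrable_def set_integrable_def, rule_format, of "cball 0 (real n)"]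
    by (auto intro: borel_measurable_integrable)
  fix x :: "real^'n"
  obtain N where N: "norm x \<le> real N" using real_arch_simple by blast
  have "\<forall>\<^sub>F n in sequentially. indicator (cball 0 (real n)) x * g x = g x"
    using eventually_ge_at_top[of N] by eventually_elim (use N in auto)
  then show "(\<lambda>n. indicator (cball 0 (real n)) x * g x) \<longlonglongrightarrow> g x"
    by (rule tendsto_eventually)
qed

lemma inner_self_measurable [measurable]:
  "(\<lambda>x::'a::euclidean_space. x \<bullet> x) \<in> borel_measurable lebesgue"
  by (intro borel_imp_lebesgue_measurable) measurable

lemma compact_annulus: "compact {x::'a::euclidean_space. a \<le> x \<bullet> x \<and> x \<bullet> x \<le> b}" (is "compact ?A")
proof -
  have "closed ?A"
    by (intro closed_Collect_conj closed_Collect_le continuous_intros)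
  moreover have "?A \<subseteq> cball 0 (sqrt b)"
    by (auto simp: norm_eq_sqrt_inner)
  ultimately show ?thesis
    using bounded_subset bounded_cball by (auto simp: compact_eq_bounded_closed)
qed

lemma inner_self_norm: "x \<bullet> x = (norm x)\<^sup>2"
  by (simp add: power2_norm_eq_inner)

context
  fixes u g :: "real^4 \<Rightarrow> real"
  assumes wl: "has_weak_laplacian u g"
    and g_int: "integrable lebesgue (\<lambda>y. g y / (max 1 (norm y))\<^sup>2)"
begin

lemma weak_laplacian_locally_integrable: "locally_integrable u" "locally_integrable g"
  using wl by (auto simp: has_weak_laplacian_def)

lemma weak_laplacian_pair_measurable [measurable]: "u \<in> borel_measurable lebesgue" "g \<in> borel_measurable lebesgue"
  using weak_laplacian_locally_integrable by (auto intro: locally_integrable_measurable)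

lemma newton_norm_measurable [measurable]: "(\<lambda>x::real^4. newton g (norm x)) \<in> borel_measurable lebesgue"
  by (rule measurable_compose[OF norm_measurable_lebesgue newton_measurable[OF weak_laplacian_pair_measurable(2) g_int]])

text \<open>The bound from \<open>newton_abs_le\<close> degenerates at the origin, so u minus the
  potential is first studied on annuli, where |x|^2 is at least a.\<close>

lemma annulus_integrable:
  fixes a b :: real
  assumes "0 < a"
  defines "A \<equiv> {x::real^4. a \<le> x \<bullet> x \<and> x \<bullet> x \<le> b}"
  shows "integrable lebesgue (\<lambda>x. indicator A x * (u x - newton g (norm x)))"
proof -
  have A: "compact A" unfolding A_def by (rule compact_annulus)
  define C where "C = (1 + 1 / a) * (LINT y|lebesgue. \<bar>g y / (max 1 (norm y))\<^sup>2\<bar>)"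
  have "integrable lebesgue (\<lambda>x. indicator A x * u x)"
    using weak_laplacian_locally_integrable(1) A by (auto simp: locally_integrable_def set_integrable_def)
  moreover have "integrable lebesgue (\<lambda>x. indicator A x * newton g (norm x))"
  proof (rule Bochner_Integration.integrable_bound)
    show "integrable lebesgue (\<lambda>x. C * indicator A x)"
      using lmeasurable_compact[OF A] by (intro integrable_mult_right) (auto simp: fmeasurable_def integrable_indicator_iff)
    have "A \<in> sets lebesgue" using lmeasurable_compact[OF A] by (rule fmeasurableD)
    then show "(\<lambda>x. indicator A x * newton g (norm x)) \<in> borel_measurable lebesgue"
      by measurable
    show "AE x in lebesgue. norm (indicator A x * newton g (norm x)) \<le> norm (C * indicator A x)"
    proof (intro AE_I2)
      fix x :: "real^4"
      show "norm (indicator A x * newton g (norm x)) \<le> norm (C * indicator A x)"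
      proof (cases "x \<in> A")
        case True
        then have r: "0 < norm x" "a \<le> (norm x)\<^sup>2"
          using assms(1) by (auto simp: A_def power2_norm_eq_inner)
        let ?I = "LINT y|lebesgue. \<bar>g y / (max 1 (norm y))\<^sup>2\<bar>"
        have "\<bar>LINT y|lebesgue. g y / (max (norm x) (norm y))\<^sup>2\<bar>
            \<le> (LINT y|lebesgue. \<bar>g y / (max (norm x) (norm y))\<^sup>2\<bar>)"
          by (rule integral_abs_bound)
        also have "\<dots> \<le> (1 + 1 / (norm x)\<^sup>2) * ?I"
          by (rule newton_abs_le[OF weak_laplacian_pair_measurable(2) g_int r(1)])
        also have "\<dots> \<le> C"
          unfolding C_def using r assms(1) by (intro mult_right_mono add_left_mono divide_left_mono) auto
        finally have le: "\<bar>LINT y|lebesgue. g y / (max (norm x) (norm y))\<^sup>2\<bar> \<le> C" .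
        have "1 \<le> 4 * pi\<^sup>2"
          using pi_ge_two power_mono[of 2 pi 2] by simp
        then have "\<bar>newton g (norm x)\<bar> \<le> \<bar>LINT y|lebesgue. g y / (max (norm x) (norm y))\<^sup>2\<bar>"
          unfolding newton_def by (simp add: abs_mult divide_le_eq mult_le_cancel_left1)
        with le show ?thesis using True by simp
      qed simp
    qed
  qed
  ultimately have "integrable lebesgue (\<lambda>x. indicator A x * u x - indicator A x * newton g (norm x))"
    by (rule Bochner_Integration.integrable_diff)
  then show ?thesis by (simp add: right_diff_distrib)
qed

text \<open>With \<open>h' = k / s\<^sup>2\<close> the function \<open>h (|x|\<^sup>2)\<close> has Laplacian \<open>4 k' (|x|\<^sup>2) / |x|\<^sup>2\<close>.\<close>

lemma orthogonal_to_derivatives: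
  assumes k': "smooth1 k'" "\<And>s. (k has_real_derivative k' s) (at s)"
    and supp: "0 < a" "a \<le> b" "\<And>s. s \<le> a \<or> b \<le> s \<Longrightarrow> k s = 0" "\<And>s. s \<le> a \<or> b \<le> s \<Longrightarrow> k' s = 0"
  shows "(LINT x|lebesgue. (u x - newton g (norm x)) * (k' (x \<bullet> x) / (x \<bullet> x))) = 0"
    and "(LINT x|lebesgue. k' ((x::real^4) \<bullet> x) / (x \<bullet> x)) = 0"
proof -
  define m where "m = (\<lambda>s. k s / s / s)"
  have "smooth1 k" using k' by (rule smooth1.antideriv)
  then have m: "smooth1 m"
    unfolding m_def using supp by (intro smooth1.divide[of _ a]) auto
  obtain m' where m': "smooth1 m'" "\<And>s. (m has_real_derivative m' s) (at s)"
    using smooth1_derivative[OF m] by blast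
  have m'_eq: "m' s = k' s / s / s - 2 * k s / s / s / s" if "s \<noteq> 0" for s
  proof (rule DERIV_unique[OF m'(2)])
    show "(m has_real_derivative k' s / s / s - 2 * k s / s / s / s) (at s)"
      unfolding m_def using that
      by (auto intro!: derivative_eq_intros k'(2) simp: field_simps)
  qed
  \<comment> \<open>h vanishes beyond b but may be a nonzero constant below a. The test function
    h(|x|^2) therefore reaches across the origin, which is what excludes a multiple of |x|^(-2) from
    u minus the potential.\<close>
  obtain h where h: "\<And>s. (h has_real_derivative m s) (at s)" "h b = 0"
    using continuous_antiderivative[OF smooth1_continuous[OF m], of b] by blast
  have h0: "h s = 0" if "b \<le> s" for s
    using constant_if_derivative_zero[OF h(1), of b s] that supp h(2) by (auto simp: m_def)
  have eq: "4 * s * m' s + 8 * m s = 4 * (k' s / s)" for s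
  proof (cases "s = 0")
    case True
    then show ?thesis using supp by (simp add: m_def)
  next
    case False
    then show ?thesis by (simp add: m'_eq m_def field_simps)
  qed
  define R where "R = sqrt b"
  have R: "0 \<le> R" "R\<^sup>2 = b" using supp by (auto simp: R_def)
  have out: "h s = 0" "m s = 0" "m' s = 0" if "R\<^sup>2 < s" for s
    using that h0[of s] supp m'_eq[of s] by (auto simp: R m_def)
  have cm': "continuous_on UNIV m'" by (rule smooth1_continuous[OF m'(1)])
  define \<psi> where "\<psi> = (\<lambda>x::real^4. 4 * (norm x)\<^sup>2 * m' ((norm x)\<^sup>2) + 8 * m ((norm x)\<^sup>2))"
  have \<psi>: "\<psi> x = 4 * (k' (x \<bullet> x) / (x \<bullet> x))" for x
    by (simp add: \<psi>_def eq inner_self_norm)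
  have N: "has_bochner_integral lebesgue (\<lambda>x. newton g (norm x) * \<psi> x) (LINT y|lebesgue. g y * h ((norm y)\<^sup>2))"
    unfolding \<psi>_def by (rule newton_laplacian[OF weak_laplacian_pair_measurable(2) g_int h(1) m'(2) cm' R(1) out])
  define \<phi> where "\<phi> = (\<lambda>x::real^4. h (x \<bullet> x))"
  have "smooth1 h" using m h(1) by (rule smooth1.antideriv)
  have zero_out: "R\<^sup>2 < x \<bullet> x" if "x \<notin> cball 0 R" for x :: "real^4"
    using that R(1) by (auto simp: inner_self_norm intro!: power_strict_mono)
  have "test_function \<phi>"
    unfolding \<phi>_def
    by (rule test_function_if_bounded_support[OF smooth_class.radial[OF \<open>smooth1 h\<close>] bounded_cball[of 0 R]])
      (use zero_out out in auto)
  have lap: "laplacian \<phi> x = \<psi> x" for x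
    unfolding \<phi>_def using laplacian_radial[OF m h(1) m'(2), of x]
    by (simp add: \<psi>_def inner_self_norm)
  have "test_function \<psi>"
  proof (rule test_function_if_bounded_support[OF _ bounded_cball[of 0 R]])
    have "smooth1 (\<lambda>s. 4 * s * m' s + 8 * m s)"
      by (intro smooth1.add smooth1.mult smooth1.const m m' smooth1_linear)
    from smooth_class.radial[OF this] show "smooth_class \<psi>"
      by (simp add: \<psi>_def inner_self_norm)
    show "\<psi> x = 0" if "x \<notin> cball 0 R" for x
      using zero_out[OF that] out by (simp add: \<psi>_def inner_self_norm)
  qed
  then have "integrable lebesgue (\<lambda>x. u x * \<psi> x)"
    by (rule test_function_integrable[OF weak_laplacian_locally_integrable(1)])
  moreover have "(LINT x|lebesgue. u x * \<psi> x) = (LINT y|lebesgue. g y * h ((norm y)\<^sup>2))"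
    using wl \<open>test_function \<phi>\<close> lap by (auto simp: has_weak_laplacian_def \<phi>_def inner_self_norm)
  ultimately have "(LINT x|lebesgue. (u x - newton g (norm x)) * \<psi> x) = 0"
    using N by (simp add: left_diff_distrib has_bochner_integral_iff)
  moreover have "(u x - newton g (norm x)) * \<psi> x = 4 * ((u x - newton g (norm x)) * (k' (x \<bullet> x) / (x \<bullet> x)))" for x
    by (simp add: \<psi>)
  ultimately have "4 * (LINT x|lebesgue. (u x - newton g (norm x)) * (k' (x \<bullet> x) / (x \<bullet> x))) = 0"
    by (simp only: integral_mult_right_zero)
  then show "(LINT x|lebesgue. (u x - newton g (norm x)) * (k' (x \<bullet> x) / (x \<bullet> x))) = 0"
    by simp
  \<comment> \<open>For the second claim the kernel identity is used at the radius R + 1, outside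
    the support: there max(|x|, R + 1) is constant on the support and h((R + 1)^2) = 0.\<close>
  have "has_bochner_integral lebesgue (\<lambda>x. \<psi> x / (max (norm x) (R + 1))\<^sup>2) (- 4 * pi\<^sup>2 * h ((R + 1)\<^sup>2))"
    unfolding \<psi>_def
    by (rule newton_kernel_laplacian[OF h(1) m'(2) cm' R(1) out]) (use R(1) in auto)
  moreover have "\<psi> x / (max (norm x) (R + 1))\<^sup>2 = (k' (x \<bullet> x) / (x \<bullet> x)) * (4 / (R + 1)\<^sup>2)" for x
  proof (cases "x \<in> cball 0 R")
    case True
    then have "max (norm x) (R + 1) = R + 1" by simp
    then show ?thesis by (simp add: \<psi>)
  next
    case False
    have "\<psi> x = 0" using zero_out[OF False] out by (simp add: \<psi>_def inner_self_norm)
    moreover from this have "k' (x \<bullet> x) / (x \<bullet> x) = 0" using \<psi>[of x] by simp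
    ultimately show ?thesis by (simp only: mult_zero_left div_0)
  qed
  moreover have "h ((R + 1)\<^sup>2) = 0"
  proof (rule h0)
    have "R\<^sup>2 \<le> (R + 1)\<^sup>2" using R(1) by (intro power_mono) auto
    then show "b \<le> (R + 1)\<^sup>2" using R(2) by simp
  qed
  ultimately have "has_bochner_integral lebesgue (\<lambda>x::real^4. (k' (x \<bullet> x) / (x \<bullet> x)) * (4 / (R + 1)\<^sup>2)) 0"
    by (simp only: mult_zero_right)
  then have "(LINT x::real^4|lebesgue. k' (x \<bullet> x) / (x \<bullet> x)) * (4 / (R + 1)\<^sup>2) = 0"
    unfolding integral_mult_left_zero[symmetric] by (simp only: has_bochner_integral_iff)
  then show "(LINT x|lebesgue. k' ((x::real^4) \<bullet> x) / (x \<bullet> x)) = 0"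
    using R(1) by simp
qed

text \<open>The quotient by |x|^2 compensates the density: for radial functions Lebesgue measure on
  R^4 is pi^2 s ds in s = |x|^2, so integration against \<open>shell_bump\<close> is integration of
  the profile against \<open>bump\<close> with respect to ds, up to the factor pi^2.\<close>

definition shell_bump :: "real \<Rightarrow> real \<Rightarrow> nat \<Rightarrow> real^4 \<Rightarrow> real" where
  "shell_bump a b k x = bump a b k (x \<bullet> x) / (x \<bullet> x)"

lemma shell_bump_integrable:
  assumes "0 < a"
  shows "integrable lebesgue (\<lambda>x. (u x - newton g (norm x)) * shell_bump a b k x)" (is ?u)
    and "integrable lebesgue (shell_bump a b k)" (is ?one)
proof -
  let ?A = "{x::real^4. a \<le> x \<bullet> x \<and> x \<bullet> x \<le> b}"
  have "smooth1 (\<lambda>s. bump a b k s / s)"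
    by (rule smooth1.divide[OF smooth1_bump assms]) (auto simp: bump_eq_0)
  from smooth_class.radial[OF this] have sc: "smooth_class (shell_bump a b k)"
    by (simp add: shell_bump_def[abs_def])
  then have bm[measurable]: "shell_bump a b k \<in> borel_measurable lebesgue"
    by (intro borel_imp_lebesgue_measurable smooth_class_measurable)
  have out: "shell_bump a b k x = 0" if "x \<notin> ?A" for x
    using that bump_eq_0[of "x \<bullet> x" a b k] by (auto simp: shell_bump_def)
  have le: "\<bar>shell_bump a b k x\<bar> \<le> indicator ?A x / a" for x
  proof (cases "x \<in> ?A")
    case True
    have "bump a b k (x \<bullet> x) / (x \<bullet> x) \<le> 1 / a"
      using True assms bump_le_1[of a b k "x \<bullet> x"] bump_nonneg[of a b k "x \<bullet> x"] by (intro frac_le) auto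
    then show ?thesis using True bump_nonneg[of a b k "x \<bullet> x"] by (simp add: shell_bump_def)
  next
    case False
    then show ?thesis using out[OF False] by simp
  qed
  show ?u
  proof (rule Bochner_Integration.integrable_bound[OF integrable_mult_right[OF annulus_integrable[OF assms, of b], of "1 / a"]])
    show "AE x in lebesgue. norm ((u x - newton g (norm x)) * shell_bump a b k x)
      \<le> norm (1 / a * (indicator ?A x * (u x - newton g (norm x))))"
    proof (intro AE_I2)
      fix x
      show "norm ((u x - newton g (norm x)) * shell_bump a b k x)
        \<le> norm (1 / a * (indicator ?A x * (u x - newton g (norm x))))"
        using mult_left_mono[OF le[of x], of "\<bar>u x - newton g (norm x)\<bar>"] assms
        by (simp add: abs_mult mult_ac)
    qed
  qed measurable
  have "test_function (shell_bump a b k)"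
  proof (rule test_function_if_bounded_support[OF sc bounded_cball[of 0 "sqrt b"]])
    show "shell_bump a b k x = 0" if "x \<notin> cball 0 (sqrt b)" for x
      using that by (intro out) (auto simp: norm_eq_sqrt_inner)
  qed
  moreover have "locally_integrable (\<lambda>_::real^4. 1)"
    unfolding locally_integrable_def set_integrable_def
    using lmeasurable_compact by (auto simp: fmeasurable_def integrable_indicator_iff)
  ultimately show ?one
    using test_function_integrable[of "\<lambda>_. 1" "shell_bump a b k"] by simp
qed


lemma bump_primitive:
  assumes "a < b"
  obtains B J where "\<And>s. (B has_real_derivative bump a b k s) (at s)"
    "\<And>s. s \<le> a \<Longrightarrow> B s = 0" "\<And>s. b \<le> s \<Longrightarrow> B s = J" "0 < J"
proof -
  obtain B where B: "\<And>s. (B has_real_derivative bump a b k s) (at s)" "B a = 0"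
    using continuous_antiderivative[OF smooth1_continuous[OF smooth1_bump], of a] by blast
  have b0: "B s = 0" if "s \<le> a" for s
    using constant_if_derivative_zero[OF B(1), of s a] that B(2) bump_eq_0 by force
  have b1: "B s = B b" if "b \<le> s" for s
    using constant_if_derivative_zero[OF B(1), of b s] that bump_eq_0 by force
  have "B a < B b"
  proof (rule DERIV_pos_imp_increasing_open[OF assms])
    show "\<exists>y. (B has_real_derivative y) (at s) \<and> 0 < y" if "a < s" "s < b" for s
      using B(1) bump_pos[OF that] by blast
    show "continuous_on {a..b} B"
      using B(1) by (intro continuous_at_imp_continuous_on) (auto intro: DERIV_isCont)
  qed
  then have "0 < B b" unfolding B(2) .
  then show thesis
    by (intro that[of B "B b"] B(1) b0 b1)
qed

text \<open>Makes the bump on (1, 2) usable as the fixed weight whose mean defines the constant c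
  below.\<close>

lemma shell_bump_integral_pos: "0 < (LINT x|lebesgue. shell_bump 1 2 k x)"
proof -
  have nn: "0 \<le> shell_bump 1 2 k x" for x
    by (simp add: shell_bump_def bump_nonneg)
  have "(LINT x|lebesgue. shell_bump 1 2 k x) \<noteq> 0"
  proof
    assume "(LINT x|lebesgue. shell_bump 1 2 k x) = 0"
    then have "AE x in lebesgue. shell_bump 1 2 k x = 0"
      using integral_nonneg_eq_0_iff_AE[OF shell_bump_integrable(2)[of 1 2 k]] nn by simp
    then have neg: "negligible {x. shell_bump 1 2 k x \<noteq> 0}"
      by (simp add: negligible_iff_null_sets completion.AE_iff_null_sets)
    define S where "S = {x::real^4. 1 < x \<bullet> x \<and> x \<bullet> x < 2}"
    have "open S"
      unfolding S_def by (intro open_Collect_conj open_Collect_less continuous_intros)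
    \<comment> \<open>The squared norm is 25/16, between 1 and 2.\<close>
    moreover have "axis 1 (5 / 4) \<in> S"
      by (simp add: S_def inner_axis_axis)
    moreover have "S \<subseteq> {x. shell_bump 1 2 k x \<noteq> 0}"
      using bump_pos[of 1 _ 2 k] by (force simp: S_def shell_bump_def)
    ultimately show False
      using open_not_negligible[of S] negligible_subset[OF neg] by blast
  qed
  moreover have "0 \<le> (LINT x|lebesgue. shell_bump 1 2 k x)"
    using nn by simp
  ultimately show ?thesis by simp
qed

text \<open>The du Bois-Reymond argument in the variable s = |x|^2: orthogonality to derivatives of
  compactly supported functions forces a constant. Here c is the mean of u minus the potential
  against one fixed bump.\<close>

lemma shell_bump_orthogonal:
  obtains c where "\<And>a b k. 0 < a \<Longrightarrow> a < b \<Longrightarrow>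
    (LINT x|lebesgue. (u x - newton g (norm x) - c) * shell_bump a b k x) = 0"
proof -
  let ?v = "\<lambda>x. u x - newton g (norm x)"
  let ?V = "\<lambda>a b k. LINT x|lebesgue. ?v x * shell_bump a b k x"
  let ?W = "\<lambda>a b k. LINT x|lebesgue. shell_bump a b k x"
  define c where "c = ?V 1 2 0 / ?W 1 2 0"
  have "(LINT x|lebesgue. (?v x - c) * shell_bump a b k x) = 0" if ab: "0 < a" "a < b" for a b k
  proof -
    obtain B1 J1 where B1: "\<And>s. (B1 has_real_derivative bump a b k s) (at s)"
        "\<And>s. s \<le> a \<Longrightarrow> B1 s = 0" "\<And>s. b \<le> s \<Longrightarrow> B1 s = J1" "0 < J1"
      using bump_primitive[OF ab(2)] by metis
    obtain B2 J2 where B2: "\<And>s. (B2 has_real_derivative bump 1 2 0 s) (at s)"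
        "\<And>s. s \<le> 1 \<Longrightarrow> B2 s = 0" "\<And>s. 2 \<le> s \<Longrightarrow> B2 s = J2" "0 < J2"
      by (rule bump_primitive[of 1 2 0]) auto
    \<comment> \<open>Beyond both supports B1 = J1 and B2 = J2, so this combination vanishes there
      and its derivative is an admissible test.\<close>
    define l where "l s = J2 * B1 s + (- J1) * B2 s" for s
    define l' where "l' s = J2 * bump a b k s + (- J1) * bump 1 2 0 s" for s
    have 1: "smooth1 l'"
      unfolding l'_def by (intro smooth1.add smooth1.mult smooth1.const smooth1_bump)
    have 2: "(l has_real_derivative l' s) (at s)" for s
      unfolding l_def l'_def by (auto intro!: derivative_eq_intros B1 B2)
    have pos: "0 < min a 1" "min a 1 \<le> max b 2" using ab by auto
    have 3: "l s = 0" "l' s = 0" if "s \<le> min a 1 \<or> max b 2 \<le> s" for s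
      using that B1(2,3)[of s] B2(2,3)[of s] bump_eq_0[of s a b k] bump_eq_0[of s 1 2 0]
      by (auto simp: l_def l'_def)
    have eq: "l' (x \<bullet> x) / (x \<bullet> x) = J2 * shell_bump a b k x - J1 * shell_bump 1 2 0 x" for x :: "real^4"
      by (simp add: l'_def shell_bump_def diff_divide_distrib)
    have "(LINT x|lebesgue. ?v x * (J2 * shell_bump a b k x - J1 * shell_bump 1 2 0 x)) = 0"
      using orthogonal_to_derivatives(1)[OF 1 2 pos 3] by (simp only: eq)
    moreover have "?v x * (J2 * shell_bump a b k x - J1 * shell_bump 1 2 0 x)
        = J2 * (?v x * shell_bump a b k x) - J1 * (?v x * shell_bump 1 2 0 x)" for x
      by (simp add: algebra_simps)
    ultimately have V: "J2 * ?V a b k - J1 * ?V 1 2 0 = 0"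
      using shell_bump_integrable(1)[OF ab(1), of b k] shell_bump_integrable(1)[of 1 2 0]
      by (simp only: Bochner_Integration.integral_diff integrable_mult_right integral_mult_right_zero zero_less_one)
    have W: "J2 * ?W a b k - J1 * ?W 1 2 0 = 0"
      using orthogonal_to_derivatives(2)[OF 1 2 pos 3]
        shell_bump_integrable(2)[OF ab(1), of b k] shell_bump_integrable(2)[of 1 2 0]
      by (simp only: eq Bochner_Integration.integral_diff integrable_mult_right integral_mult_right_zero zero_less_one)
    have "J2 * (?V a b k - c * ?W a b k) = J1 * ?V 1 2 0 - c * (J1 * ?W 1 2 0)"
      using V W by (simp add: algebra_simps)
    also have "\<dots> = 0"
      using shell_bump_integral_pos[of 0] by (simp add: c_def field_simps)
    finally have "?V a b k - c * ?W a b k = 0" using B2(4) by simp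
    moreover have "(?v x - c) * shell_bump a b k x = ?v x * shell_bump a b k x - c * shell_bump a b k x" for x
      by (simp add: algebra_simps)
    ultimately show ?thesis
      using shell_bump_integrable[OF ab(1), of b k]
      by (simp only: Bochner_Integration.integral_diff integrable_mult_right integral_mult_right_zero)
  qed
  then show thesis by (rule that)
qed

lemma annulus_weighted_integrable:
  assumes "0 < a"
  shows "integrable lebesgue
    (\<lambda>x. indicator {a<..<b} (x \<bullet> x) * ((u x - newton g (norm x) - c) / (x \<bullet> x)))"
proof -
  let ?A = "{x::real^4. a \<le> x \<bullet> x \<and> x \<bullet> x \<le> b}"
  let ?v = "\<lambda>x. u x - newton g (norm x)"
  have "integrable lebesgue (\<lambda>x. indicator ?A x :: real)"
    using lmeasurable_compact[OF compact_annulus[of a b]] by (auto simp: integrable_indicator_iff fmeasurable_def)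
  then have i: "integrable lebesgue (\<lambda>x. 1 / a * (indicator ?A x * ?v x - c * indicator ?A x))"
    by (intro integrable_mult_right Bochner_Integration.integrable_diff annulus_integrable assms)
  show ?thesis
  proof (rule Bochner_Integration.integrable_bound[OF i])
    show "AE x in lebesgue. norm (indicator {a<..<b} (x \<bullet> x) * ((?v x - c) / (x \<bullet> x)))
      \<le> norm (1 / a * (indicator ?A x * ?v x - c * indicator ?A x))"
    proof (intro AE_I2)
      fix x :: "real^4"
      show "norm (indicator {a<..<b} (x \<bullet> x) * ((?v x - c) / (x \<bullet> x)))
        \<le> norm (1 / a * (indicator ?A x * ?v x - c * indicator ?A x))"
      proof (cases "x \<bullet> x \<in> {a<..<b}")
        case True
        then have "\<bar>?v x - c\<bar> / (x \<bullet> x) \<le> \<bar>?v x - c\<bar> / a"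
          using assms by (intro divide_left_mono mult_pos_pos) auto
        then show ?thesis using True assms by (simp add: abs_mult)
      qed simp
    qed
  qed measurable
qed

text \<open>The cut-offs converge boundedly to the indicator, and the quotient by |x|^2 is harmless
  on an annulus, so dominated convergence applies.\<close>

lemma annulus_orthogonal:
  assumes c: "\<And>a b k. 0 < a \<Longrightarrow> a < b \<Longrightarrow>
      (LINT x|lebesgue. (u x - newton g (norm x) - c) * shell_bump a b k x) = 0"
    and "0 < a"
  shows "(LINT x|lebesgue. indicator {a<..<b} (x \<bullet> x) * ((u x - newton g (norm x) - c) / (x \<bullet> x))) = 0"
proof (cases "a < b")
  case True
  let ?w = "\<lambda>x. (u x - newton g (norm x) - c) / (x \<bullet> x)"
  have "(\<lambda>k. LINT x|lebesgue. bump a b k (x \<bullet> x) * ?w x) \<longlonglongrightarrow> (LINT x|lebesgue. indicator {a<..<b} (x \<bullet> x) * ?w x)"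
  proof (rule integral_dominated_convergence[where w = "\<lambda>x. norm (indicator {a<..<b} (x \<bullet> x) * ?w x)"])
    show "(\<lambda>x. indicator {a<..<b} (x \<bullet> x) * ?w x) \<in> borel_measurable lebesgue"
      using annulus_weighted_integrable[OF assms(2)] by (rule borel_measurable_integrable)
    have [measurable]: "bump a b k \<in> borel_measurable borel" for k
      by (intro borel_measurable_continuous_onI smooth1_continuous smooth1_bump)
    show "(\<lambda>x. bump a b k (x \<bullet> x) * ?w x) \<in> borel_measurable lebesgue" for k
      by measurable
    show "AE x in lebesgue. norm (bump a b k (x \<bullet> x) * ?w x) \<le> norm (indicator {a<..<b} (x \<bullet> x) * ?w x)" for k
    proof (intro AE_I2)
      fix x :: "real^4"
      have "\<bar>bump a b k (x \<bullet> x)\<bar> \<le> indicator {a<..<b} (x \<bullet> x)"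
        using bump_nonneg[of a b k "x \<bullet> x"] bump_le_1[of a b k "x \<bullet> x"] bump_eq_0[of "x \<bullet> x" a b k]
        by (auto split: split_indicator)
      then have "\<bar>bump a b k (x \<bullet> x)\<bar> * \<bar>?w x\<bar> \<le> indicator {a<..<b} (x \<bullet> x) * \<bar>?w x\<bar>"
        by (rule mult_right_mono) simp
      then show "norm (bump a b k (x \<bullet> x) * ?w x) \<le> norm (indicator {a<..<b} (x \<bullet> x) * ?w x)"
        unfolding real_norm_def abs_mult by simp
    qed
    show "integrable lebesgue (\<lambda>x. norm (indicator {a<..<b} (x \<bullet> x) * ?w x))"
      by (intro integrable_norm annulus_weighted_integrable assms)
    show "AE x in lebesgue. (\<lambda>k. bump a b k (x \<bullet> x) * ?w x) \<longlonglongrightarrow> indicator {a<..<b} (x \<bullet> x) * ?w x"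
      by (intro AE_I2 tendsto_mult tendsto_const bump_tendsto)
  qed
  moreover have "bump a b k (x \<bullet> x) * ?w x = (u x - newton g (norm x) - c) * shell_bump a b k x" for k x
    by (simp add: shell_bump_def)
  ultimately have "(\<lambda>k. 0) \<longlonglongrightarrow> (LINT x|lebesgue. indicator {a<..<b} (x \<bullet> x) * ?w x)"
    by (simp only: c[OF assms(2) True])
  then show ?thesis by (simp only: LIMSEQ_const_iff)
qed simp

text \<open>Vanishing integrals over annuli control spherical means only; radial symmetry turns this
  into vanishing almost everywhere. The profile F may be non-measurable, so
  \<open>AE_zero_if_box_integrals_zero\<close> is applied with \<open>f = x \<bullet> x\<close>,
  where measurability of the composite is enough.\<close>

lemma radial_representation:
  assumes "radial_ae u"
  obtains c where "AE x in lebesgue. u x = newton g (norm x) + c"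
proof -
  obtain c where c: "\<And>a b k. 0 < a \<Longrightarrow> a < b \<Longrightarrow>
      (LINT x|lebesgue. (u x - newton g (norm x) - c) * shell_bump a b k x) = 0"
    using shell_bump_orthogonal by blast
  obtain F where F: "AE x in lebesgue. u x = F (norm x)"
    using assms by (auto simp: radial_ae_def)
  let ?w = "\<lambda>x. (u x - newton g (norm x) - c) / (x \<bullet> x)"
  have "AE x in lebesgue. indicator {1 / real (Suc n)<..<real n} (x \<bullet> x) * ?w x = 0" for n
  proof -
    let ?a = "1 / real (Suc n)" and ?b = "real n"
    define h where "h s = indicator {?a<..<?b} s * ((F (sqrt s) - newton g (sqrt s) - c) / s)" for s
    have eq: "AE x in lebesgue. indicator {?a<..<?b} (x \<bullet> x) * ?w x = h (x \<bullet> x)"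
      using F by eventually_elim (simp add: h_def norm_eq_sqrt_inner)
    have hm: "(\<lambda>x::real^4. h (x \<bullet> x)) \<in> borel_measurable lebesgue"
      by (rule borel_measurable_AE[OF borel_measurable_integrable[OF annulus_weighted_integrable] eq]) simp
    have "AE x in lebesgue. h ((x::real^4) \<bullet> x) = 0"
    proof (rule AE_zero_if_box_integrals_zero[where f = "\<lambda>x::real^4. x \<bullet> x" and h = h])
      show "continuous_on UNIV (\<lambda>x::real^4. x \<bullet> x)" by (intro continuous_intros)
      show "integrable lebesgue (\<lambda>x::real^4. h (x \<bullet> x))"
        by (rule integrable_cong_AE_imp[OF annulus_weighted_integrable hm eq]) simp
      fix p q :: real
      have "(LINT x::real^4|lebesgue. indicator (box p q) (x \<bullet> x) * h (x \<bullet> x))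
          = (LINT x|lebesgue. indicator {max p ?a<..<min q ?b} (x \<bullet> x) * ?w x)"
      proof (rule integral_cong_AE)
        have [measurable]: "(\<lambda>x::real^4. indicator (box p q) (x \<bullet> x) :: real) \<in> borel_measurable lebesgue"
          by (intro borel_imp_lebesgue_measurable) measurable
        show "(\<lambda>x::real^4. indicator (box p q) (x \<bullet> x) * h (x \<bullet> x)) \<in> borel_measurable lebesgue"
          using hm by measurable
        show "AE x in lebesgue. indicator (box p q) (x \<bullet> x) * h (x \<bullet> x)
            = indicator {max p ?a<..<min q ?b} (x \<bullet> x) * ?w x"
          using eq
        proof eventually_elim
          case (elim x)
          show ?case unfolding elim[symmetric] by (auto simp: box_real split: split_indicator)
        qed
      qed (intro borel_measurable_integrable annulus_weighted_integrable, simp add: less_max_iff_disj)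
      also have "\<dots> = 0"
        by (rule annulus_orthogonal[OF c]) (simp_all add: less_max_iff_disj)
      finally show "(LINT x::real^4|lebesgue. indicator (box p q) (x \<bullet> x) * h (x \<bullet> x)) = 0" .
    qed
    with eq show ?thesis by eventually_elim (simp only:)
  qed
  then have "AE x in lebesgue. \<forall>n. indicator {1 / real (Suc n)<..<real n} (x \<bullet> x) * ?w x = 0"
    by (subst AE_all_countable) (rule allI)
  moreover have "AE x in lebesgue. x \<noteq> (0::real^4)"
    by (rule AE_completion[OF AE_lborel_singleton])
  ultimately have "AE x in lebesgue. u x = newton g (norm x) + c"
  proof eventually_elim
    case (elim x)
    have pos: "0 < x \<bullet> x" using elim(2) by simp
    obtain n1 where n1: "1 / real (Suc n1) < x \<bullet> x"
      using reals_Archimedean[OF pos] by (auto simp: inverse_eq_divide)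
    obtain n2 where n2: "x \<bullet> x < real n2" using reals_Archimedean2 by blast
    define n where "n = max n1 n2"
    have "1 / real (Suc n) \<le> 1 / real (Suc n1)" by (intro divide_left_mono) (auto simp: n_def)
    then have "x \<bullet> x \<in> {1 / real (Suc n)<..<real n}" using n1 n2 by (auto simp: n_def)
    then show ?case using elim(1)[rule_format, of n] pos by (simp add: indicator_def)
  qed
  then show thesis by (rule that)
qed

end

section \<open>The Hilbert space structure\<close>

lemma quadratic_nonneg_imp_discriminant:
  fixes A B C :: real
  assumes "\<And>t. 0 \<le> A * t\<^sup>2 + 2 * B * t + C" "0 \<le> A"
  shows "B\<^sup>2 \<le> A * C"
proof (cases "A = 0")
  case True
  have "B = 0"
  proof (rule ccontr)
    assume "B \<noteq> 0"
    then show False using assms(1)[of "- (C + 1) / (2 * B)"] True by simp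
  qed
  then show ?thesis using True by simp
next
  case False
  then have "0 < A" using assms(2) by simp
  have "A * (- B / A)\<^sup>2 + 2 * B * (- B / A) + C = C - B\<^sup>2 / A"
    using False by (simp add: field_simps power2_eq_square)
  then have "B\<^sup>2 / A \<le> C" using assms(1)[of "- B / A"] by simp
  then show ?thesis using \<open>0 < A\<close> by (simp add: divide_le_eq mult.commute)
qed

lemma weighted_product_integrable:
  fixes w f g :: "'a \<Rightarrow> real"
  assumes [measurable]: "w \<in> borel_measurable M" "f \<in> borel_measurable M" "g \<in> borel_measurable M"
    and w: "\<And>x. 0 \<le> w x"
    and int: "integrable M (\<lambda>x. w x * (f x)\<^sup>2)" "integrable M (\<lambda>x. w x * (g x)\<^sup>2)"
  shows "integrable M (\<lambda>x. w x * (f x * g x))"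
proof (rule Bochner_Integration.integrable_bound[OF Bochner_Integration.integrable_add[OF int]])
  show "AE x in M. norm (w x * (f x * g x)) \<le> norm (w x * (f x)\<^sup>2 + w x * (g x)\<^sup>2)"
  proof (intro AE_I2)
    fix x
    have "\<bar>f x * g x\<bar> \<le> (f x)\<^sup>2 + (g x)\<^sup>2"
    proof -
      have "2 * (\<bar>f x\<bar> * \<bar>g x\<bar>) \<le> (f x)\<^sup>2 + (g x)\<^sup>2"
        using zero_le_power2[of "\<bar>f x\<bar> - \<bar>g x\<bar>"] by (simp add: power2_diff)
      moreover have "0 \<le> \<bar>f x\<bar> * \<bar>g x\<bar>" by simp
      ultimately show ?thesis unfolding abs_mult by linarith
    qed
    from mult_left_mono[OF this w[of x]]
    show "norm (w x * (f x * g x)) \<le> norm (w x * (f x)\<^sup>2 + w x * (g x)\<^sup>2)"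
      using w[of x] by (simp add: abs_mult distrib_left)
  qed
qed measurable

lemma weighted_square_sum:
  fixes w f g :: "'a \<Rightarrow> real"
  assumes meas: "w \<in> borel_measurable M" "f \<in> borel_measurable M" "g \<in> borel_measurable M"
    and w: "\<And>x. 0 \<le> w x"
    and int: "integrable M (\<lambda>x. w x * (f x)\<^sup>2)" "integrable M (\<lambda>x. w x * (g x)\<^sup>2)"
  shows "has_bochner_integral M (\<lambda>x. w x * (t * f x + g x)\<^sup>2)
    ((LINT x|M. w x * (f x)\<^sup>2) * t\<^sup>2 + 2 * (LINT x|M. w x * (f x * g x)) * t + (LINT x|M. w x * (g x)\<^sup>2))"
proof -
  note fg = weighted_product_integrable[OF meas w int]
  have "has_bochner_integral M
    (\<lambda>x. (w x * (f x)\<^sup>2) * t\<^sup>2 + 2 * (w x * (f x * g x)) * t + w x * (g x)\<^sup>2)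
    ((LINT x|M. w x * (f x)\<^sup>2) * t\<^sup>2 + 2 * (LINT x|M. w x * (f x * g x)) * t + (LINT x|M. w x * (g x)\<^sup>2))"
    by (intro has_bochner_integral_add has_bochner_integral_mult_left has_bochner_integral_mult_right
        has_bochner_integral_integrable int fg)
  moreover have "w x * (t * f x + g x)\<^sup>2
      = (w x * (f x)\<^sup>2) * t\<^sup>2 + 2 * (w x * (f x * g x)) * t + w x * (g x)\<^sup>2" for x
    by (simp add: power2_eq_square algebra_simps)
  ultimately show ?thesis by (simp only:)
qed

text \<open>The integral of w (t f + g)^2 is a nonnegative quadratic polynomial in t, so its
  discriminant is not positive.\<close>

lemma weighted_Cauchy_Schwarz:
  fixes w f g :: "'a \<Rightarrow> real"
  assumes meas: "w \<in> borel_measurable M" "f \<in> borel_measurable M" "g \<in> borel_measurable M"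
    and w: "\<And>x. 0 \<le> w x"
    and int: "integrable M (\<lambda>x. w x * (f x)\<^sup>2)" "integrable M (\<lambda>x. w x * (g x)\<^sup>2)"
  shows "\<bar>LINT x|M. w x * (f x * g x)\<bar>
    \<le> sqrt (LINT x|M. w x * (f x)\<^sup>2) * sqrt (LINT x|M. w x * (g x)\<^sup>2)"
proof -
  let ?A = "LINT x|M. w x * (f x)\<^sup>2" and ?B = "LINT x|M. w x * (f x * g x)" and ?C = "LINT x|M. w x * (g x)\<^sup>2"
  have "0 \<le> ?A * t\<^sup>2 + 2 * ?B * t + ?C" for t
  proof -
    have "0 \<le> (LINT x|M. w x * (t * f x + g x)\<^sup>2)"
      using w by (intro integral_nonneg_AE AE_I2) simp
    then show ?thesis
      using weighted_square_sum[OF meas w int, of t] by (simp only: has_bochner_integral_iff)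
  qed
  moreover have "0 \<le> ?A" using w by (intro integral_nonneg_AE AE_I2) simp
  ultimately have "?B\<^sup>2 \<le> ?A * ?C" by (rule quadratic_nonneg_imp_discriminant)
  then have "sqrt (?B\<^sup>2) \<le> sqrt (?A * ?C)" by (rule real_sqrt_le_mono)
  then show ?thesis by (simp add: real_sqrt_mult)
qed

section \<open>The weight\<close>

definition radial_weight :: "real \<Rightarrow> (real \<Rightarrow> real) \<Rightarrow> real \<Rightarrow> real" where
  "radial_weight \<beta> chi t = (if t < 1 then ln (exp 1 / t) powr \<beta> else chi t)"

lemma weight_eq: "weight \<beta> chi x = radial_weight \<beta> chi (norm x)"
  by (simp add: weight_def radial_weight_def)

lemma chi_pos: "admissible_chi chi \<Longrightarrow> 1 \<le> t \<Longrightarrow> 0 < chi t"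
  by (simp add: admissible_chi_def)

lemma chi_measurable:
  assumes "admissible_chi chi"
  shows "(\<lambda>t. indicator {1..} t * chi t) \<in> borel_measurable borel"
proof -
  have "continuous_on {1..} chi" using assms by (simp add: admissible_chi_def)
  from borel_measurable_continuous_on_indicator[OF _ this] show ?thesis by simp
qed

lemma radial_weight_measurable [measurable]:
  assumes "admissible_chi chi"
  shows "radial_weight \<beta> chi \<in> borel_measurable borel"
proof -
  have [measurable]: "(\<lambda>t. indicator {1..} t * chi t) \<in> borel_measurable borel"
    by (rule chi_measurable[OF assms])
  have "radial_weight \<beta> chi = (\<lambda>t. if t < 1 then ln (exp 1 / t) powr \<beta> else indicator {1..} t * chi t)"
    by (auto simp: radial_weight_def fun_eq_iff)
  then show ?thesis by simp
qed

lemma weight_measurable [measurable]: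
  assumes "admissible_chi chi"
  shows "weight \<beta> chi \<in> borel_measurable lebesgue"
  unfolding weight_eq[abs_def]
  by (rule measurable_compose[OF norm_measurable_lebesgue radial_weight_measurable[OF assms]])

lemma radial_weight_pos:
  assumes "admissible_chi chi" "0 < t"
  shows "0 < radial_weight \<beta> chi t"
proof (cases "t < 1")
  case True
  have "1 < exp 1 / t"
    using True assms(2) one_less_exp_iff[of 1] by (simp add: less_divide_eq del: one_less_exp_iff)
  then have "0 < ln (exp 1 / t)" by (rule ln_gt_zero)
  then show ?thesis using True by (simp add: radial_weight_def)
qed (use chi_pos[OF assms(1)] in \<open>simp add: radial_weight_def\<close>)

lemma weight_nonneg:
  assumes "admissible_chi chi"
  shows "0 \<le> weight \<beta> chi x"
proof (cases "x = 0")
  case False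
  then show ?thesis using radial_weight_pos[OF assms, of "norm x"] by (simp add: weight_eq less_imp_le)
qed (simp add: weight_def)

text \<open>A zero of f may carry a nonzero derivative, hence the closure on the right; near a point
  outside the closure f is identically zero.\<close>

lemma partial_deriv_support: "{x. partial_deriv i f x \<noteq> 0} \<subseteq> closure {x. f x \<noteq> 0}"
proof
  fix x assume x: "x \<in> {x. partial_deriv i f x \<noteq> 0}"
  show "x \<in> closure {x. f x \<noteq> 0}"
  proof (rule ccontr)
    assume "x \<notin> closure {x. f x \<noteq> 0}"
    then have "x \<in> - closure {x. f x \<noteq> 0}" by simp
    moreover have "open (- closure {x. f x \<noteq> 0})" by (intro open_Compl closed_closure)
    moreover have "0 = f y" if "y \<in> - closure {x. f x \<noteq> 0}" for y
      using that closure_subset[of "{x. f x \<noteq> 0}"] by auto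
    ultimately have "(f has_derivative (\<lambda>_. 0)) (at x)"
      by (intro has_derivative_transform_within_open[OF has_derivative_const])
    then have "frechet_derivative f (at x) = (\<lambda>_. 0)"
      using frechet_derivative_at by metis
    then show False using x by (simp add: partial_deriv_def)
  qed
qed

lemma laplacian_integrable:
  fixes u :: "real^'n::finite \<Rightarrow> real"
  assumes u: "locally_integrable u" and \<phi>: "test_function \<phi>"
  shows "integrable lebesgue (\<lambda>x. u x * laplacian \<phi> x)"
proof (rule integrable_times_compact_support[OF u])
  show "compact (closure {x. \<phi> x \<noteq> 0})" using \<phi> by (simp add: test_function_def)
  have "partial_deriv i (partial_deriv i \<phi>) differentiable (at x)" for i x
  proof -
    have "foldr partial_deriv [i, i] \<phi> differentiable (at x)"
      using \<phi> unfolding test_function_def smooth_def by blast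
    then show ?thesis by simp
  qed
  then have "continuous_on UNIV (partial_deriv i (partial_deriv i \<phi>))" for i
    by (intro continuous_at_imp_continuous_on) (auto intro: differentiable_imp_continuous_within)
  then show "continuous_on UNIV (laplacian \<phi>)"
    unfolding laplacian_def[abs_def] by (intro continuous_on_sum) auto
  show "laplacian \<phi> x = 0" if "x \<notin> closure {x. \<phi> x \<noteq> 0}" for x
  proof -
    have "partial_deriv i (partial_deriv i \<phi>) x = 0" for i
    proof (rule ccontr)
      assume "partial_deriv i (partial_deriv i \<phi>) x \<noteq> 0"
      then have "x \<in> closure {x. partial_deriv i \<phi> x \<noteq> 0}"
        using partial_deriv_support[of i "partial_deriv i \<phi>"] by auto
      also have "\<dots> \<subseteq> closure {x. \<phi> x \<noteq> 0}"
        using partial_deriv_support[of i \<phi>] by (simp add: closure_minimal)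
      finally show False using that by simp
    qed
    then show ?thesis by (simp add: laplacian_def)
  qed
qed

lemma has_weak_laplacian_lincomb:
  assumes u: "has_weak_laplacian u f" and v: "has_weak_laplacian v g"
  shows "has_weak_laplacian (\<lambda>x. a * u x + b * v x) (\<lambda>x. a * f x + b * g x)"
  unfolding has_weak_laplacian_def
proof (intro conjI allI impI)
  have li: "locally_integrable u" "locally_integrable f" "locally_integrable v" "locally_integrable g"
    using u v by (auto simp: has_weak_laplacian_def)
  then show "locally_integrable (\<lambda>x. a * u x + b * v x)" "locally_integrable (\<lambda>x. a * f x + b * g x)"
    by (auto intro: locally_integrable_lincomb)
  fix \<phi> :: "real^'a \<Rightarrow> real" assume \<phi>: "test_function \<phi>"
  have "(LINT x|lebesgue. (a * u x + b * v x) * laplacian \<phi> x)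
    = (LINT x|lebesgue. a * (u x * laplacian \<phi> x) + b * (v x * laplacian \<phi> x))"
    by (simp add: algebra_simps)
  also have "\<dots> = a * (LINT x|lebesgue. u x * laplacian \<phi> x) + b * (LINT x|lebesgue. v x * laplacian \<phi> x)"
    by (simp only: Bochner_Integration.integral_add integrable_mult_right laplacian_integrable[OF li(1) \<phi>]
        laplacian_integrable[OF li(3) \<phi>] integral_mult_right_zero)
  also have "\<dots> = a * (LINT x|lebesgue. f x * \<phi> x) + b * (LINT x|lebesgue. g x * \<phi> x)"
    using u v \<phi> by (simp add: has_weak_laplacian_def)
  also have "\<dots> = (LINT x|lebesgue. a * (f x * \<phi> x) + b * (g x * \<phi> x))"
    by (simp only: Bochner_Integration.integral_add integrable_mult_right test_function_integrable[OF li(2) \<phi>]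
        test_function_integrable[OF li(4) \<phi>] integral_mult_right_zero)
  also have "\<dots> = (LINT x|lebesgue. (a * f x + b * g x) * \<phi> x)"
    by (simp add: algebra_simps)
  finally show "(LINT x|lebesgue. (a * u x + b * v x) * laplacian \<phi> x)
    = (LINT x|lebesgue. (a * f x + b * g x) * \<phi> x)" .
qed

section \<open>Weak Laplacians of elements of the space and their pairing\<close>

lemma X_space_weak_laplacian:
  assumes "v \<in> X_space \<beta> chi"
  shows "has_weak_laplacian v (weak_laplacian v)"
    and "integrable lebesgue (\<lambda>x. weight \<beta> chi x * (weak_laplacian v x)\<^sup>2)"
    and "weak_laplacian v \<in> borel_measurable lebesgue"
proof -
  have "\<exists>g. has_weak_laplacian v g" using assms by (simp add: X_space_def)
  then show 1: "has_weak_laplacian v (weak_laplacian v)"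
    unfolding weak_laplacian_def by (rule someI_ex)
  then show "weak_laplacian v \<in> borel_measurable lebesgue"
    by (intro locally_integrable_measurable) (auto simp: has_weak_laplacian_def)
  show "integrable lebesgue (\<lambda>x. weight \<beta> chi x * (weak_laplacian v x)\<^sup>2)"
    using assms by (simp add: X_space_def)
qed

lemma weak_laplacian_lincomb:
  assumes "u \<in> X_space \<beta> chi" "v \<in> X_space \<beta> chi"
  shows "AE x in lebesgue. weak_laplacian (\<lambda>x. a * u x + b * v x) x
    = a * weak_laplacian u x + b * weak_laplacian v x"
proof (rule has_weak_laplacian_unique)
  show *: "has_weak_laplacian (\<lambda>x. a * u x + b * v x) (\<lambda>x. a * weak_laplacian u x + b * weak_laplacian v x)"
    using assms by (intro has_weak_laplacian_lincomb X_space_weak_laplacian)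
  show "has_weak_laplacian (\<lambda>x. a * u x + b * v x) (weak_laplacian (\<lambda>x. a * u x + b * v x))"
    unfolding weak_laplacian_def by (rule someI_ex[of "has_weak_laplacian (\<lambda>x. a * u x + b * v x)"]) (rule exI, rule *)
qed

lemma X_norm_square:
  assumes "admissible_chi chi"
  shows "(X_norm \<beta> chi u)\<^sup>2 = (LINT x|lebesgue. weight \<beta> chi x * (weak_laplacian u x)\<^sup>2)"
proof -
  have "0 \<le> (LINT x|lebesgue. weight \<beta> chi x * (weak_laplacian u x)\<^sup>2)"
    using weight_nonneg[OF assms] by (intro integral_nonneg_AE AE_I2) simp
  then show ?thesis by (simp add: X_norm_def)
qed

context
  fixes \<beta> :: real and chi :: "real \<Rightarrow> real"
  assumes adm: "admissible_chi chi"
begin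

text \<open>\<open>weakly_converges\<close> quantifies over abstract bounded functionals; this
  places the pairing with a fixed u among them. Linearity rests on the almost-everywhere linearity
  of \<open>weak_laplacian\<close>, boundedness on Cauchy-Schwarz.\<close>

lemma inner_functional_in_X_dual:
  assumes u: "u \<in> X_space \<beta> chi"
  shows "(\<lambda>v. LINT x|lebesgue. weight \<beta> chi x * (weak_laplacian v x * weak_laplacian u x)) \<in> X_dual \<beta> chi"
proof -
  let ?w = "weight \<beta> chi"
  define F where "F v = (LINT x|lebesgue. ?w x * (weak_laplacian v x * weak_laplacian u x))" for v
  have int: "integrable lebesgue (\<lambda>x. ?w x * (weak_laplacian v x * weak_laplacian u x))"
    if "v \<in> X_space \<beta> chi" for v
    by (rule weighted_product_integrable[OF weight_measurable[OF adm] X_space_weak_laplacian(3)[OF that]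
        X_space_weak_laplacian(3)[OF u] weight_nonneg[OF adm] X_space_weak_laplacian(2)[OF that] X_space_weak_laplacian(2)[OF u]])
  have lin: "F (\<lambda>x. a * v1 x + b * v2 x) = a * F v1 + b * F v2"
    if "v1 \<in> X_space \<beta> chi" "v2 \<in> X_space \<beta> chi" for a b v1 v2
  proof -
    let ?i = "\<lambda>v x. ?w x * (weak_laplacian v x * weak_laplacian u x)"
    have i: "integrable lebesgue (\<lambda>x. a * ?i v1 x + b * ?i v2 x)"
      by (intro Bochner_Integration.integrable_add integrable_mult_right int that)
    have eq: "AE x in lebesgue. a * ?i v1 x + b * ?i v2 x = ?i (\<lambda>x. a * v1 x + b * v2 x) x"
      using weak_laplacian_lincomb[OF that, of a b] by eventually_elim (simp add: algebra_simps)
    have "F (\<lambda>x. a * v1 x + b * v2 x) = (LINT x|lebesgue. a * ?i v1 x + b * ?i v2 x)"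
      unfolding F_def
      by (rule integral_cong_AE[symmetric, OF borel_measurable_integrable[OF i]
            borel_measurable_AE[OF borel_measurable_integrable[OF i] eq] eq])
    also have "\<dots> = a * F v1 + b * F v2"
      unfolding F_def
      by (simp only: Bochner_Integration.integral_add integrable_mult_right int[OF that(1)] int[OF that(2)]
          integral_mult_right_zero)
    finally show ?thesis .
  qed
  have "F (\<lambda>x. v1 x + v2 x) = F v1 + F v2" if "v1 \<in> X_space \<beta> chi" "v2 \<in> X_space \<beta> chi" for v1 v2
    using lin[OF that, of 1 1] by simp
  moreover have "F (\<lambda>x. c * v x) = c * F v" if "v \<in> X_space \<beta> chi" for c v
    using lin[OF that that, of c 0] by simp
  moreover have "\<bar>F v\<bar> \<le> X_norm \<beta> chi u * X_norm \<beta> chi v" if "v \<in> X_space \<beta> chi" for v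
    using weighted_Cauchy_Schwarz[OF weight_measurable[OF adm] X_space_weak_laplacian(3)[OF that]
        X_space_weak_laplacian(3)[OF u] weight_nonneg[OF adm] X_space_weak_laplacian(2)[OF that] X_space_weak_laplacian(2)[OF u]]
    by (simp add: F_def X_norm_def mult.commute)
  ultimately have "F \<in> X_dual \<beta> chi" unfolding X_dual_def by blast
  then show ?thesis by (simp add: F_def[abs_def])
qed

text \<open>Expand the square: the norms of the sequence are 1 and the mixed term tends to ||u||^2,
  which leaves 1 - 2 ||u||^2 + ||u||^2. The difference of the chosen representatives is the form in
  which this energy later enters \<open>newton_bound\<close>.\<close>

lemma weak_limit_energy:
  assumes un: "\<And>n. un n \<in> X_space \<beta> chi" "\<And>n. X_norm \<beta> chi (un n) = 1"
    and u: "u \<in> X_space \<beta> chi" and wc: "weakly_converges \<beta> chi un u"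
  shows "(\<lambda>n. LINT x|lebesgue. weight \<beta> chi x * (weak_laplacian (un n) x - weak_laplacian u x)\<^sup>2)
    \<longlonglongrightarrow> 1 - (X_norm \<beta> chi u)\<^sup>2"
proof -
  let ?w = "weight \<beta> chi"
  define F where "F v = (LINT x|lebesgue. ?w x * (weak_laplacian v x * weak_laplacian u x))" for v
  have "F \<in> X_dual \<beta> chi" unfolding F_def[abs_def] by (rule inner_functional_in_X_dual[OF u])
  then have lim: "(\<lambda>n. F (un n)) \<longlonglongrightarrow> F u" using wc by (simp add: weakly_converges_def)
  have Fu: "F u = (X_norm \<beta> chi u)\<^sup>2"
    by (simp add: F_def X_norm_square[OF adm] flip: power2_eq_square)
  have "(LINT x|lebesgue. ?w x * (weak_laplacian (un n) x - weak_laplacian u x)\<^sup>2)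
      = 1 - 2 * F (un n) + (X_norm \<beta> chi u)\<^sup>2" for n
  proof -
    have "(LINT x|lebesgue. ?w x * ((-1) * weak_laplacian u x + weak_laplacian (un n) x)\<^sup>2)
      = (X_norm \<beta> chi u)\<^sup>2 * (-1)\<^sup>2 + 2 * F (un n) * (-1) + (X_norm \<beta> chi (un n))\<^sup>2"
      using weighted_square_sum[OF weight_measurable[OF adm] X_space_weak_laplacian(3)[OF u]
          X_space_weak_laplacian(3)[OF un(1)[of n]] weight_nonneg[OF adm] X_space_weak_laplacian(2)[OF u]
          X_space_weak_laplacian(2)[OF un(1)[of n]], of "-1"]
      by (simp only: has_bochner_integral_iff X_norm_square[OF adm] F_def mult.commute[of "weak_laplacian u _"])
    then show ?thesis by (simp add: un(2))
  qed
  moreover have "(\<lambda>n. 1 - 2 * F (un n) + (X_norm \<beta> chi u)\<^sup>2) \<longlonglongrightarrow> 1 - 2 * F u + (X_norm \<beta> chi u)\<^sup>2"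
    by (intro tendsto_intros lim)
  ultimately show ?thesis by (simp add: Fu)
qed

end

section \<open>Estimates for the Newton potential\<close>

lemma integrable_and_integral_le:
  fixes f :: "'a \<Rightarrow> real"
  assumes "f \<in> borel_measurable M" "AE x in M. 0 \<le> f x" "(\<integral>\<^sup>+x. ennreal (f x) \<partial>M) \<le> ennreal B" "0 \<le> B"
  shows "integrable M f" "integral\<^sup>L M f \<le> B"
proof -
  show i: "integrable M f"
    using assms(3) le_less_trans[OF _ ennreal_less_top] by (intro integrableI_nonneg[OF assms(1,2)]) simp
  have "ennreal (integral\<^sup>L M f) = (\<integral>\<^sup>+x. ennreal (f x) \<partial>M)"
    by (rule nn_integral_eq_integral[OF i assms(2), symmetric])
  with assms(3) have "ennreal (integral\<^sup>L M f) \<le> ennreal B" by simp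
  then show "integral\<^sup>L M f \<le> B" using assms(4) by (simp add: ennreal_le_iff)
qed

text \<open>The guard \<open>1 \<le> y\<close> keeps \<open>chi\<close> away from arguments where it
  is unconstrained. A guarded integrand over the whole line is jointly measurable in r and y, which
  gives measurability in r.\<close>

definition chi_tail :: "(real \<Rightarrow> real) \<Rightarrow> real \<Rightarrow> real" where
  "chi_tail chi r = (LBINT y. if 1 \<le> y \<and> r \<le> y then 1 / (chi y * y) else 0)"

definition chi_head :: "(real \<Rightarrow> real) \<Rightarrow> real \<Rightarrow> real" where
  "chi_head chi r = (LBINT y. if 1 \<le> y \<and> y \<le> r then y / chi y else 0)"

text \<open>An upper bound for the integral of \<open>1 / (\<omega>(y) max(r, |y|)\<^sup>4)\<close>; its leading term for
  \<open>r < 1\<close> carries the sharp constant.\<close>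

definition kernel_bound_fun :: "real \<Rightarrow> (real \<Rightarrow> real) \<Rightarrow> real \<Rightarrow> real" where
  "kernel_bound_fun \<beta> chi r =
    (if r < 1 then 2 * pi\<^sup>2 / (1 - \<beta>) * ln (exp 1 / r) powr (1 - \<beta>) + (pi\<^sup>2 / 2 + 2 * pi\<^sup>2 * chi_tail chi 1)
     else pi\<^sup>2 / 2 / r ^ 4 + 2 * pi\<^sup>2 / r\<^sup>2 * chi_head chi r + 2 * pi\<^sup>2 * chi_tail chi r)"

lemma nn_integral_three_terms_le:
  fixes f e1 e2 e3 :: "real \<Rightarrow> real"
  assumes [measurable]: "e1 \<in> borel_measurable borel" "e2 \<in> borel_measurable borel" "e3 \<in> borel_measurable borel"
    and nn: "\<And>t. 0 \<le> e1 t" "\<And>t. 0 \<le> e2 t" "\<And>t. 0 \<le> e3 t" "0 \<le> c2" "0 \<le> c3" "0 \<le> E1" "0 \<le> E2" "0 \<le> E3"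
    and le: "\<And>t. f t \<le> e1 t + (c2 * e2 t + c3 * e3 t)"
    and E: "(\<integral>\<^sup>+t. ennreal (e1 t) \<partial>lborel) = ennreal E1" "(\<integral>\<^sup>+t. ennreal (e2 t) \<partial>lborel) = ennreal E2"
      "(\<integral>\<^sup>+t. ennreal (e3 t) \<partial>lborel) = ennreal E3"
  shows "(\<integral>\<^sup>+t. ennreal (f t) \<partial>lborel) \<le> ennreal (E1 + (c2 * E2 + c3 * E3))"
proof -
  have split: "ennreal (a + (c2 * b + c3 * c)) = ennreal a + (ennreal c2 * ennreal b + ennreal c3 * ennreal c)"
    if "0 \<le> a" "0 \<le> b" "0 \<le> c" for a b c
    using that nn by (simp add: ennreal_plus ennreal_mult)
  have "(\<integral>\<^sup>+t. ennreal (f t) \<partial>lborel) \<le> (\<integral>\<^sup>+t. ennreal (e1 t + (c2 * e2 t + c3 * e3 t)) \<partial>lborel)"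
    by (intro nn_integral_mono ennreal_leI le)
  also have "\<dots> = (\<integral>\<^sup>+t. ennreal (e1 t) + (ennreal c2 * ennreal (e2 t) + ennreal c3 * ennreal (e3 t)) \<partial>lborel)"
    by (simp only: split[OF nn(1-3)])
  also have "\<dots> = ennreal E1 + (ennreal c2 * ennreal E2 + ennreal c3 * ennreal E3)"
    by (simp add: nn_integral_add nn_integral_cmult E)
  also have "\<dots> = ennreal (E1 + (c2 * E2 + c3 * E3))"
    by (rule split[OF nn(6-8), symmetric])
  finally show ?thesis .
qed

lemma ln_e_over_ge_1:
  fixes t :: real
  assumes "0 < t" "t \<le> 1" shows "1 \<le> ln (exp 1 / t)"
  using assms ln_le_zero_iff[of t] by (simp add: ln_div)

lemma nn_integral_t3:
  assumes "0 \<le> c" "0 \<le> a"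
  shows "(\<integral>\<^sup>+t. ennreal (c * t ^ 3 * indicator {0..a} t) \<partial>lborel) = ennreal (c * a ^ 4 / 4)"
proof -
  have "(\<integral>\<^sup>+t. ennreal (c * t ^ 3 * indicator {0..a} t) \<partial>lborel)
      = (\<integral>\<^sup>+t. ennreal (c * \<bar>t\<bar> ^ 3) * indicator {0..a} t \<partial>lborel)"
    by (intro nn_integral_cong) (auto split: split_indicator)
  also have "\<dots> = ennreal (c * a ^ 4 / 4 - c * 0 ^ 4 / 4)"
    using assms by (intro nn_integral_FTC_Icc) (auto intro!: derivative_eq_intros)
  finally show ?thesis by simp
qed

context
  fixes \<beta> :: real and chi :: "real \<Rightarrow> real"
  assumes \<beta>: "0 < \<beta>" "\<beta> < 1" and adm: "admissible_chi chi"
begin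

lemma chi_if_measurable [measurable]:
  "(\<lambda>(r, y). if 1 \<le> y \<and> r \<le> y then 1 / (chi y * y) else 0) \<in> borel_measurable (borel \<Otimes>\<^sub>M borel)" (is ?t)
  "(\<lambda>(r, y). if 1 \<le> y \<and> y \<le> r then y / chi y else 0) \<in> borel_measurable (borel \<Otimes>\<^sub>M borel)" (is ?h)
proof -
  let ?c = "\<lambda>t. indicator {1..} t * chi t"
  have [measurable]: "?c \<in> borel_measurable borel" by (rule chi_measurable[OF adm])
  have "(\<lambda>(r, y). if 1 \<le> y \<and> r \<le> y then 1 / (chi y * y) else 0)
      = (\<lambda>(r, y). if 1 \<le> y \<and> r \<le> y then 1 / (?c y * y) else (0::real))"
    "(\<lambda>(r, y). if 1 \<le> y \<and> y \<le> r then y / chi y else 0)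
      = (\<lambda>(r, y). if 1 \<le> y \<and> y \<le> r then y / ?c y else (0::real))"
    by (auto simp: fun_eq_iff)
  moreover have "(\<lambda>(r, y). if 1 \<le> y \<and> r \<le> y then 1 / (?c y * y) else (0::real)) \<in> borel_measurable (borel \<Otimes>\<^sub>M borel)"
    "(\<lambda>(r, y). if 1 \<le> y \<and> y \<le> r then y / ?c y else (0::real)) \<in> borel_measurable (borel \<Otimes>\<^sub>M borel)"
    by measurable
  ultimately show ?t ?h by (simp_all only:)
qed

lemma chi_if_section_measurable [measurable]:
  "(\<lambda>y. if 1 \<le> y \<and> r \<le> y then 1 / (chi y * y) else 0) \<in> borel_measurable borel"
  "(\<lambda>y. if 1 \<le> y \<and> y \<le> r then y / chi y else 0) \<in> borel_measurable borel"
  using measurable_compose[OF measurable_Pair1'[of r borel borel] chi_if_measurable(1)]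
    measurable_compose[OF measurable_Pair1'[of r borel borel] chi_if_measurable(2)]
  by simp_all

lemma chi_tail_measurable [measurable]: "chi_tail chi \<in> borel_measurable borel"
  unfolding chi_tail_def[abs_def]
  by (rule lborel.borel_measurable_lebesgue_integral) (use chi_if_measurable(1) in simp)

lemma chi_head_measurable [measurable]: "chi_head chi \<in> borel_measurable borel"
  unfolding chi_head_def[abs_def]
  by (rule lborel.borel_measurable_lebesgue_integral) (use chi_if_measurable(2) in simp)

lemma chi_tail_integrable: "integrable lborel (\<lambda>y. if 1 \<le> y \<and> r \<le> y then 1 / (chi y * y) else 0)"
proof (rule Bochner_Integration.integrable_bound)
  show "integrable lborel (\<lambda>y. indicator {1..} y *\<^sub>R (inverse (chi y) * inverse y))"
    using adm by (simp add: admissible_chi_def set_integrable_def)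
  show "AE y in lborel. norm (if 1 \<le> y \<and> r \<le> y then 1 / (chi y * y) else 0)
      \<le> norm (indicator {1..} y *\<^sub>R (inverse (chi y) * inverse y))"
    by (intro AE_I2) (auto simp: field_simps)
qed simp

lemma chi_head_integrable:
  "integrable lborel (\<lambda>y. if 1 \<le> y \<and> y \<le> r then y / chi y else 0)"
  "integrable lborel (\<lambda>y. indicator {1..} y * (y / chi y))"
proof -
  have i: "integrable lborel (\<lambda>y. indicator {1..} y *\<^sub>R (inverse (chi y) * y))"
    using adm by (simp add: admissible_chi_def set_integrable_def)
  then show "integrable lborel (\<lambda>y. indicator {1..} y * (y / chi y))"
    by (simp add: field_simps)
  show "integrable lborel (\<lambda>y. if 1 \<le> y \<and> y \<le> r then y / chi y else 0)"
    by (rule Bochner_Integration.integrable_bound[OF i]) (auto simp: field_simps)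
qed

lemma chi_if_nonneg:
  "0 \<le> (if 1 \<le> y \<and> r \<le> y then 1 / (chi y * y) else 0)"
  "0 \<le> (if 1 \<le> y \<and> y \<le> r then y / chi y else 0)"
  using chi_pos[OF adm, of y] by (auto intro: divide_nonneg_nonneg)

lemma chi_tail_nonneg: "0 \<le> chi_tail chi r" and chi_head_nonneg: "0 \<le> chi_head chi r"
  unfolding chi_tail_def chi_head_def using chi_if_nonneg by (auto intro!: integral_nonneg_AE AE_I2)

lemma chi_tail_le: "chi_tail chi r \<le> chi_tail chi 1"
  unfolding chi_tail_def
proof (rule integral_mono[OF chi_tail_integrable chi_tail_integrable])
  show "(if 1 \<le> y \<and> r \<le> y then 1 / (chi y * y) else 0) \<le> (if 1 \<le> y \<and> 1 \<le> y then 1 / (chi y * y) else 0)" for y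
    using chi_if_nonneg(1)[of y 1] by auto
qed

lemma chi_head_le: "chi_head chi r \<le> (LBINT y. indicator {1..} y * (y / chi y))"
  unfolding chi_head_def
proof (rule integral_mono[OF chi_head_integrable])
  show "(if 1 \<le> y \<and> y \<le> r then y / chi y else 0) \<le> indicator {1..} y * (y / chi y)" for y
    using chi_if_nonneg(2)[of y y] by (auto split: split_indicator)
qed

lemma nn_integral_chi_tail:
  "(\<integral>\<^sup>+y. ennreal (if 1 \<le> y \<and> r \<le> y then 1 / (chi y * y) else 0) \<partial>lborel) = ennreal (chi_tail chi r)"
  unfolding chi_tail_def by (rule nn_integral_eq_integral[OF chi_tail_integrable]) (use chi_if_nonneg in auto)

lemma nn_integral_chi_head:
  "(\<integral>\<^sup>+y. ennreal (if 1 \<le> y \<and> y \<le> r then y / chi y else 0) \<partial>lborel) = ennreal (chi_head chi r)"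
  unfolding chi_head_def by (rule nn_integral_eq_integral[OF chi_head_integrable(1)]) (use chi_if_nonneg in auto)

lemma chi_tail_eq: "1 \<le> r \<Longrightarrow> chi_tail chi r = (LBINT y:{r..}. 1 / (chi y * y))"
  unfolding chi_tail_def set_lebesgue_integral_def
  by (intro Bochner_Integration.integral_cong) (auto split: split_indicator)

lemma chi_head_eq: "chi_head chi r = (LBINT y:{1..r}. y / chi y)"
  unfolding chi_head_def set_lebesgue_integral_def
  by (intro Bochner_Integration.integral_cong) (auto split: split_indicator)

lemma kernel_bound_fun_measurable [measurable]: "kernel_bound_fun \<beta> chi \<in> borel_measurable borel"
  unfolding kernel_bound_fun_def[abs_def] by measurable

lemma kernel_bound_fun_nonneg:
  shows "0 \<le> kernel_bound_fun \<beta> chi r"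
  using \<beta> chi_tail_nonneg chi_head_nonneg
  by (auto simp: kernel_bound_fun_def intro!: add_nonneg_nonneg mult_nonneg_nonneg divide_nonneg_nonneg)

lemma radial_weight_ge_1: "0 < t \<Longrightarrow> t < 1 \<Longrightarrow> 1 \<le> radial_weight \<beta> chi t"
  using ln_e_over_ge_1[of t] \<beta> by (simp add: radial_weight_def ge_one_powr_ge_zero)

text \<open>The antiderivative is -(1 - ln t)^(1-\<beta>) / (1-\<beta>); it produces the factor
  1/(1-\<beta>) of the sharp constant.\<close>

lemma nn_integral_log_power:
  assumes r: "0 < r" "r < 1"
  shows "(\<integral>\<^sup>+t. ennreal (indicator {r..1} t * (1 / (t * ln (exp 1 / t) powr \<beta>))) \<partial>lborel)
    = ennreal ((ln (exp 1 / r) powr (1 - \<beta>) - 1) / (1 - \<beta>))"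
proof -
  have "(\<integral>\<^sup>+t. ennreal (indicator {r..1} t * (1 / (t * ln (exp 1 / t) powr \<beta>))) \<partial>lborel)
    = (\<integral>\<^sup>+t. ennreal (1 / (t * ln (exp 1 / t) powr \<beta>)) * indicator {r..1} t \<partial>lborel)"
    by (intro nn_integral_cong) (auto split: split_indicator)
  also have "\<dots> = ennreal (- ((1 - ln 1) powr (1 - \<beta>)) / (1 - \<beta>) - (- ((1 - ln r) powr (1 - \<beta>)) / (1 - \<beta>)))"
  proof (rule nn_integral_FTC_Icc)
    show "((\<lambda>t. - ((1 - ln t) powr (1 - \<beta>)) / (1 - \<beta>)) has_real_derivative 1 / (t * ln (exp 1 / t) powr \<beta>)) (at t)"
      if "t \<in> {r..1}" for t
    proof -
      have t: "0 < t" "1 \<le> 1 - ln t" using that r ln_e_over_ge_1[of t] by (auto simp: ln_div)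
      have "((\<lambda>t. (1 - ln t) powr (1 - \<beta>)) has_real_derivative
          (1 - \<beta>) * (1 - ln t) powr (1 - \<beta> - 1) * (- 1 / t)) (at t)"
      proof (rule DERIV_chain2[where f = "\<lambda>z. z powr (1 - \<beta>)" and g = "\<lambda>t. 1 - ln t"])
        show "((\<lambda>z. z powr (1 - \<beta>)) has_real_derivative (1 - \<beta>) * (1 - ln t) powr (1 - \<beta> - 1)) (at (1 - ln t))"
          by (rule has_real_derivative_powr[OF less_le_trans[OF zero_less_one t(2)]])
      qed (use t(1) in \<open>auto intro!: derivative_eq_intros\<close>)
      from DERIV_cdivide[OF DERIV_minus[OF this], of "1 - \<beta>"]
      have "((\<lambda>t. - ((1 - ln t) powr (1 - \<beta>)) / (1 - \<beta>)) has_real_derivative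
          - ((1 - \<beta>) * (1 - ln t) powr (1 - \<beta> - 1) * (- 1 / t)) / (1 - \<beta>)) (at t)" .
      moreover have "- ((1 - \<beta>) * (1 - ln t) powr (1 - \<beta> - 1) * (- 1 / t)) / (1 - \<beta>) = 1 / (t * ln (exp 1 / t) powr \<beta>)"
      proof -
        have "ln (exp 1 / t) = 1 - ln t" using t(1) by (simp add: ln_div)
        then show ?thesis using \<beta> by (simp add: powr_minus_divide mult.commute)
      qed
      ultimately show ?thesis by simp
    qed
    show "0 \<le> 1 / (t * ln (exp 1 / t) powr \<beta>)" if "t \<in> {r..1}" for t
      using that r by simp
  qed (use r in auto)
  finally show ?thesis using r by (simp add: ln_div diff_divide_distrib)
qed

text \<open>Split the radial integral at r and at 1. The ball of radius min(r, 1), where the weight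
  is at least 1, contributes at most pi^2/2 times min(1, r^(-4)); between r and 1 the logarithmic
  weight gives the growing term; beyond 1 the integrals \<open>chi_head\<close> and
  \<open>chi_tail\<close> appear.\<close>

lemma kernel_square_bound:
  assumes r: "0 < r"
  shows "(\<integral>\<^sup>+y. ennreal (1 / (weight \<beta> chi (y::real^4) * (max r (norm y)) ^ 4)) \<partial>lebesgue)
    \<le> ennreal (kernel_bound_fun \<beta> chi r)"
proof -
  have [measurable]: "radial_weight \<beta> chi \<in> borel_measurable borel"
    by (rule radial_weight_measurable[OF adm])
  define f where "f t = shell_density TYPE(real^4) t * (1 / (radial_weight \<beta> chi t * (max r t) ^ 4))" for t
  have f0: "f t = 0" if "t \<le> 0" for t using that by (simp add: f_def shell_density_def)
  have f1: "f t \<le> 2 * pi\<^sup>2 / r ^ 4 * t ^ 3" if "0 < t" "t < 1" "t \<le> r" for t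
  proof -
    have "2 * pi\<^sup>2 * t ^ 3 * (1 / (radial_weight \<beta> chi t * r ^ 4)) \<le> 2 * pi\<^sup>2 * t ^ 3 * (1 / (1 * r ^ 4))"
      using that r radial_weight_ge_1[of t]
      by (intro mult_left_mono divide_left_mono mult_right_mono mult_pos_pos) auto
    then show ?thesis using that by (simp add: f_def shell_density_4 max_def)
  qed
  have f2: "f t = 2 * pi\<^sup>2 * (1 / (radial_weight \<beta> chi t * t))" if "r < t" for t
    using that r by (simp add: f_def shell_density_4 max_def field_simps power_numeral_reduce)
  have "(\<integral>\<^sup>+y. ennreal (1 / (weight \<beta> chi (y::real^4) * (max r (norm y)) ^ 4)) \<partial>lebesgue)
    = (\<integral>\<^sup>+t. ennreal (shell_density TYPE(real^4) t) * ennreal (1 / (radial_weight \<beta> chi t * (max r t) ^ 4)) \<partial>lborel)"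
    unfolding weight_eq by (rule nn_integral_norm) simp
  also have "\<dots> = (\<integral>\<^sup>+t. ennreal (f t) \<partial>lborel)"
    unfolding f_def by (simp only: ennreal_mult'[OF shell_density_nonneg])
  also have "\<dots> \<le> ennreal (kernel_bound_fun \<beta> chi r)"
  proof (cases "r < 1")
    case True
    define e1 where "e1 t = 2 * pi\<^sup>2 / r ^ 4 * t ^ 3 * indicator {0..r} t" for t
    define e2 where "e2 t = indicator {r..1} t * (1 / (t * ln (exp 1 / t) powr \<beta>))" for t
    define e3 where "e3 t = (if 1 \<le> t \<and> 1 \<le> t then 1 / (chi t * t) else 0)" for t
    have nn: "0 \<le> e1 t" "0 \<le> e2 t" "0 \<le> e3 t" for t
      using r chi_if_nonneg(1)[of t 1] by (auto simp: e1_def e2_def e3_def split: split_indicator)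
    have logn: "0 \<le> (ln (exp 1 / r) powr (1 - \<beta>) - 1) / (1 - \<beta>)"
      using ln_e_over_ge_1[of r] r True \<beta> by (intro divide_nonneg_nonneg) (auto intro: ge_one_powr_ge_zero)
    have "(\<integral>\<^sup>+t. ennreal (f t) \<partial>lborel) \<le> ennreal (2 * pi\<^sup>2 / r ^ 4 * r ^ 4 / 4
        + (2 * pi\<^sup>2 * ((ln (exp 1 / r) powr (1 - \<beta>) - 1) / (1 - \<beta>)) + 2 * pi\<^sup>2 * chi_tail chi 1))"
    proof (rule nn_integral_three_terms_le[where ?e1.0 = e1 and ?e2.0 = e2 and ?e3.0 = e3])
      show "e1 \<in> borel_measurable borel" "e2 \<in> borel_measurable borel"
        unfolding e1_def[abs_def] e2_def[abs_def] by measurable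
      show "e3 \<in> borel_measurable borel"
        unfolding e3_def[abs_def] by (rule chi_if_section_measurable(1))
      show "(\<integral>\<^sup>+t. ennreal (e1 t) \<partial>lborel) = ennreal (2 * pi\<^sup>2 / r ^ 4 * r ^ 4 / 4)"
        unfolding e1_def using r by (intro nn_integral_t3) auto
      show "(\<integral>\<^sup>+t. ennreal (e2 t) \<partial>lborel) = ennreal ((ln (exp 1 / r) powr (1 - \<beta>) - 1) / (1 - \<beta>))"
        unfolding e2_def by (rule nn_integral_log_power[OF r True])
      show "(\<integral>\<^sup>+t. ennreal (e3 t) \<partial>lborel) = ennreal (chi_tail chi 1)"
        unfolding e3_def by (rule nn_integral_chi_tail)
      show "f t \<le> e1 t + (2 * pi\<^sup>2 * e2 t + 2 * pi\<^sup>2 * e3 t)" for t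
      proof -
        consider "t \<le> 0" | "0 < t" "t \<le> r" | "r < t" "t < 1" | "1 \<le> t" by linarith
        then show ?thesis
        proof cases
          case 1
          then show ?thesis using f0[of t] nn[of t] by simp
        next
          case 2
          then have "f t \<le> e1 t" using f1[of t] True by (simp add: e1_def)
          then show ?thesis using nn[of t] by (simp add: add_increasing2)
        next
          case 3
          then have "f t = 2 * pi\<^sup>2 * e2 t" using f2[of t] by (simp add: e2_def radial_weight_def mult.commute)
          then show ?thesis using nn[of t] by simp
        next
          case 4
          then have "f t = 2 * pi\<^sup>2 * e3 t" using f2[of t] True by (simp add: e3_def radial_weight_def)
          then show ?thesis using nn[of t] by simp
        qed
      qed
    qed (use nn logn chi_tail_nonneg in auto)
    also have "\<dots> \<le> ennreal (kernel_bound_fun \<beta> chi r)"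
    proof (rule ennreal_leI)
      \<comment> \<open>The -1 coming from the endpoint t = 1 is dropped, which only enlarges the
        bound.\<close>
      have "2 * pi\<^sup>2 * ((ln (exp 1 / r) powr (1 - \<beta>) - 1) / (1 - \<beta>)) \<le> 2 * pi\<^sup>2 / (1 - \<beta>) * ln (exp 1 / r) powr (1 - \<beta>)"
        using \<beta> by (simp add: divide_right_mono)
      then show "2 * pi\<^sup>2 / r ^ 4 * r ^ 4 / 4
        + (2 * pi\<^sup>2 * ((ln (exp 1 / r) powr (1 - \<beta>) - 1) / (1 - \<beta>)) + 2 * pi\<^sup>2 * chi_tail chi 1) \<le> kernel_bound_fun \<beta> chi r"
        using r True by (simp add: kernel_bound_fun_def)
    qed
    finally show ?thesis .
  next
    case False
    define e1 where "e1 t = 2 * pi\<^sup>2 / r ^ 4 * t ^ 3 * indicator {0..1} t" for t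
    define e2 where "e2 t = (if 1 \<le> t \<and> t \<le> r then t / chi t else 0)" for t
    define e3 where "e3 t = (if 1 \<le> t \<and> r \<le> t then 1 / (chi t * t) else 0)" for t
    have nn: "0 \<le> e1 t" "0 \<le> e2 t" "0 \<le> e3 t" for t
      using r chi_if_nonneg[of t r] chi_if_nonneg(2)[of t r] by (auto simp: e1_def e2_def e3_def split: split_indicator)
    have "(\<integral>\<^sup>+t. ennreal (f t) \<partial>lborel) \<le> ennreal (2 * pi\<^sup>2 / r ^ 4 * 1 ^ 4 / 4
        + (2 * pi\<^sup>2 / r\<^sup>2 * chi_head chi r + 2 * pi\<^sup>2 * chi_tail chi r))"
    proof (rule nn_integral_three_terms_le[where ?e1.0 = e1 and ?e2.0 = e2 and ?e3.0 = e3])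
      show "e1 \<in> borel_measurable borel"
        unfolding e1_def[abs_def] by measurable
      show "e2 \<in> borel_measurable borel" "e3 \<in> borel_measurable borel"
        unfolding e2_def[abs_def] e3_def[abs_def] by (rule chi_if_section_measurable)+
      show "(\<integral>\<^sup>+t. ennreal (e1 t) \<partial>lborel) = ennreal (2 * pi\<^sup>2 / r ^ 4 * 1 ^ 4 / 4)"
        unfolding e1_def using r by (intro nn_integral_t3) auto
      show "(\<integral>\<^sup>+t. ennreal (e2 t) \<partial>lborel) = ennreal (chi_head chi r)"
        unfolding e2_def by (rule nn_integral_chi_head)
      show "(\<integral>\<^sup>+t. ennreal (e3 t) \<partial>lborel) = ennreal (chi_tail chi r)"
        unfolding e3_def by (rule nn_integral_chi_tail)
      show "f t \<le> e1 t + (2 * pi\<^sup>2 / r\<^sup>2 * e2 t + 2 * pi\<^sup>2 * e3 t)" for t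
      proof -
        have nn': "0 \<le> 2 * pi\<^sup>2 / r\<^sup>2 * e2 t" "0 \<le> 2 * pi\<^sup>2 * e3 t" using nn[of t] by auto
        consider "t \<le> 0" | "0 < t" "t < 1" | "1 \<le> t" "t \<le> r" | "1 \<le> t" "r < t" by linarith
        then show ?thesis
        proof cases
          case 1
          then show ?thesis using f0[of t] nn[of t] nn' by simp
        next
          case 2
          then have "f t \<le> e1 t" using f1[of t] False by (simp add: e1_def)
          then show ?thesis using nn' by linarith
        next
          case 3
          \<comment> \<open>Replacing t^2 by r^2 trades the r^(-4) of the kernel for r^(-2) and
            yields exactly the integrand of \<open>chi_head\<close>.\<close>
          have "t ^ 3 / (chi t * r ^ 4) \<le> (t * r\<^sup>2) / (chi t * r ^ 4)"
            using 3 r chi_pos[OF adm 3(1)] mult_left_mono[OF power_mono[of t r 2], of t]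
            by (intro divide_right_mono) (auto simp: power_numeral_reduce)
          also have "\<dots> = t / chi t / r\<^sup>2"
            using r by (simp add: field_simps power_numeral_reduce)
          finally have "2 * pi\<^sup>2 * (t ^ 3 / (chi t * r ^ 4)) \<le> 2 * pi\<^sup>2 * (t / chi t / r\<^sup>2)"
            by (intro mult_left_mono) auto
          moreover have "f t = 2 * pi\<^sup>2 * (t ^ 3 / (chi t * r ^ 4))"
            using 3 by (simp add: f_def shell_density_4 radial_weight_def max_def)
          moreover have "2 * pi\<^sup>2 * (t / chi t / r\<^sup>2) = 2 * pi\<^sup>2 / r\<^sup>2 * e2 t"
            using 3 by (simp add: e2_def)
          ultimately show ?thesis using nn(1)[of t] nn' by linarith
        next
          case 4
          then have "f t = 2 * pi\<^sup>2 * e3 t" using f2[of t] False by (simp add: e3_def radial_weight_def)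
          then show ?thesis using nn(1)[of t] nn' by linarith
        qed
      qed
    qed (use nn r chi_tail_nonneg chi_head_nonneg in auto)
    also have "\<dots> = ennreal (kernel_bound_fun \<beta> chi r)"
      using False by (simp add: kernel_bound_fun_def add.assoc)
    finally show ?thesis .
  qed
  finally show ?thesis .
qed

end

section \<open>Power integrals and subcritical growth\<close>

lemma powr_sum3_le:
  fixes a b c s :: real
  assumes "0 \<le> a" "0 \<le> b" "0 \<le> c" "0 \<le> s"
  shows "(a + b + c) powr s \<le> 3 powr s * (a powr s + b powr s + c powr s)"
proof -
  define m where "m = max a (max b c)"
  have m: "0 \<le> m" "a + b + c \<le> 3 * m" using assms by (auto simp: m_def)
  have "(a + b + c) powr s \<le> (3 * m) powr s"
    using assms m by (intro powr_mono2) auto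
  also have "\<dots> = 3 powr s * m powr s" using m by (simp add: powr_mult)
  also have "m powr s \<le> a powr s + b powr s + c powr s"
    by (auto simp: m_def max_def)
  finally show ?thesis by simp
qed

lemma nn_integral_powr_from_1:
  fixes a :: real
  assumes "a < -1"
  shows "(\<integral>\<^sup>+t. ennreal (indicator {1..} t * t powr a) \<partial>lborel) = ennreal (- 1 / (a + 1))"
proof -
  have "(\<integral>\<^sup>+t. ennreal (indicator {1..} t * t powr a) \<partial>lborel)
      = (\<integral>\<^sup>+t. ennreal (t powr a) * indicator {1..} t \<partial>lborel)"
    by (intro nn_integral_cong) (auto split: split_indicator)
  also have "\<dots> = ennreal (0 - 1 powr (a + 1) / (a + 1))"
  proof (rule nn_integral_FTC_atLeast[where F = "\<lambda>t. t powr (a + 1) / (a + 1)"])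
    show "((\<lambda>t. t powr (a + 1) / (a + 1)) has_real_derivative t powr a) (at t)" if "1 \<le> t" for t
      using that assms by (auto intro!: derivative_eq_intros)
    have "((\<lambda>t. t powr (a + 1)) \<longlongrightarrow> 0) at_top"
      using assms by (intro tendsto_neg_powr filterlim_ident) auto
    from tendsto_divide[OF this tendsto_const[of "a + 1"]]
    show "((\<lambda>t. t powr (a + 1) / (a + 1)) \<longlongrightarrow> 0) at_top" using assms by simp
  qed auto
  finally show ?thesis by simp
qed

lemma nn_integral_powr_from_0:
  fixes a :: real
  assumes "-1 < a"
  shows "(\<integral>\<^sup>+t. ennreal (indicator {0..1} t * t powr a) \<partial>lborel) = ennreal (1 / (a + 1))"
proof -
  have "((\<lambda>t. t powr a) has_integral (1 powr (a + 1) / (a + 1))) {0..1}"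
    using assms by (intro has_integral_powr_from_0) auto
  from nn_integral_has_integral_lebesgue[OF _ this] show ?thesis by simp
qed

text \<open>The argument of the power is asymptotic to \<open>\<kappa> L powr ((1 - \<beta>) / 2)\<close>, so the left-hand side is
  asymptotic to \<open>p \<kappa> powr (2 / (1 - \<beta>)) L\<close>.\<close>

lemma subcritical_growth:
  fixes p \<kappa> K C \<beta> :: real
  assumes \<beta>: "0 < \<beta>" "\<beta> < 1" and p: "0 < p" and nn: "0 \<le> \<kappa>" "0 \<le> K" "0 \<le> C"
    and sub: "p * \<kappa> powr (2 / (1 - \<beta>)) < 1"
  obtains \<theta> D where "0 < \<theta>" "\<theta> < 1" "0 \<le> D"
    "\<And>L. 1 \<le> L \<Longrightarrow> p * (\<kappa> * sqrt (L powr (1 - \<beta>) + K) + C) powr (2 / (1 - \<beta>)) \<le> \<theta> * L + D"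
proof -
  define q where "q = 2 / (1 - \<beta>)"
  have q: "0 < q" "q * (1 - \<beta>) = 2" using \<beta> by (auto simp: q_def field_simps)
  define G where "G L = p * (\<kappa> * sqrt (L powr (1 - \<beta>) + K) + C) powr q" for L
  define H where "H L = p * (\<kappa> * sqrt (1 + K * L powr (- (1 - \<beta>))) + C * L powr (- (1 - \<beta>) / 2)) powr q" for L
  have GH: "G L = H L * L" if "0 < L" for L
  proof -
    have pos: "0 \<le> \<kappa> * sqrt (1 + K * L powr (- (1 - \<beta>))) + C * L powr (- (1 - \<beta>) / 2)"
      using nn by (intro add_nonneg_nonneg mult_nonneg_nonneg) auto
    have s1: "sqrt (L powr (1 - \<beta>) + K) = sqrt (1 + K * L powr (- (1 - \<beta>))) * L powr ((1 - \<beta>) / 2)"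
    proof -
      have "L powr (1 - \<beta>) + K = (1 + K * L powr (- (1 - \<beta>))) * L powr (1 - \<beta>)"
        using that by (simp add: distrib_right mult.assoc powr_add[symmetric])
      moreover have "sqrt (L powr (1 - \<beta>)) = L powr ((1 - \<beta>) / 2)"
        using that by (simp add: powr_half_sqrt[symmetric] powr_powr)
      ultimately show ?thesis by (simp add: real_sqrt_mult)
    qed
    have s2: "C = C * L powr (- (1 - \<beta>) / 2) * L powr ((1 - \<beta>) / 2)"
    proof -
      have "- (1 - \<beta>) / 2 + (1 - \<beta>) / 2 = 0" by (simp add: field_simps)
      then have "L powr (- (1 - \<beta>) / 2) * L powr ((1 - \<beta>) / 2) = L powr 0"
        by (simp only: powr_add[symmetric])
      then show ?thesis using that by (simp only: mult.assoc) simp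
    qed
    have "\<kappa> * sqrt (L powr (1 - \<beta>) + K) + C
      = (\<kappa> * sqrt (1 + K * L powr (- (1 - \<beta>))) + C * L powr (- (1 - \<beta>) / 2)) * L powr ((1 - \<beta>) / 2)"
      unfolding distrib_right s1 using s2 by (simp add: mult.assoc)
    then have "G L = p * ((\<kappa> * sqrt (1 + K * L powr (- (1 - \<beta>))) + C * L powr (- (1 - \<beta>) / 2)) powr q
        * (L powr ((1 - \<beta>) / 2)) powr q)"
      unfolding G_def using pos by (simp add: powr_mult)
    moreover have "(L powr ((1 - \<beta>) / 2)) powr q = L"
      using that q(2) by (simp add: powr_powr mult.commute)
    ultimately show ?thesis by (simp add: H_def)
  qed
  have "((\<lambda>L. H L) \<longlongrightarrow> p * (\<kappa> * sqrt (1 + K * 0) + C * 0) powr q) at_top"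
  proof -
    have "((\<lambda>L::real. L powr (- (1 - \<beta>))) \<longlongrightarrow> 0) at_top" "((\<lambda>L::real. L powr (- (1 - \<beta>) / 2)) \<longlongrightarrow> 0) at_top"
      using \<beta> by (auto intro!: tendsto_neg_powr filterlim_ident)
    then have "((\<lambda>L. \<kappa> * sqrt (1 + K * L powr (- (1 - \<beta>))) + C * L powr (- (1 - \<beta>) / 2))
        \<longlongrightarrow> \<kappa> * sqrt (1 + K * 0) + C * 0) at_top"
      by (intro tendsto_intros)
    then show ?thesis unfolding H_def
      using nn q by (intro tendsto_mult tendsto_const tendsto_powr')
        (auto intro!: always_eventually add_nonneg_nonneg mult_nonneg_nonneg)
  qed
  then have lim: "(H \<longlongrightarrow> p * \<kappa> powr q) at_top" by simp
  \<comment> \<open>The midpoint between 1 and the limit of H, so that H < \<theta> from some L0 on.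
    On the remaining range up to L1 the monotonicity of G supplies the constant D =
    \<open>G L1\<close>.\<close>
  define \<theta> where "\<theta> = (1 + p * \<kappa> powr q) / 2"
  have "0 \<le> p * \<kappa> powr q" using p by simp
  then have \<theta>: "0 < \<theta>" "\<theta> < 1" "p * \<kappa> powr q < \<theta>" using sub by (auto simp: \<theta>_def q_def)
  have "\<forall>\<^sub>F L in at_top. H L < \<theta>" by (rule order_tendstoD(2)[OF lim \<theta>(3)])
  then obtain L0 where L0: "\<And>L. L0 \<le> L \<Longrightarrow> H L < \<theta>"
    by (auto simp: eventually_at_top_linorder)
  define L1 where "L1 = max 1 L0"
  have G_nn: "0 \<le> G L" for L using p by (simp add: G_def)
  have "G L \<le> \<theta> * L + G L1" if "1 \<le> L" for L
  proof (cases "L1 \<le> L")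
    case True
    have "H L * L \<le> \<theta> * L" using True L0[of L] that by (intro mult_right_mono) (auto simp: L1_def)
    moreover have "G L = H L * L" using that by (intro GH) simp
    ultimately show ?thesis using G_nn[of L1] by linarith
  next
    case False
    have "G L \<le> G L1"
      unfolding G_def using False that p nn q \<beta>
      by (intro mult_left_mono powr_mono2 add_right_mono real_sqrt_le_mono add_nonneg_nonneg mult_nonneg_nonneg) auto
    then show ?thesis using \<theta> that by (simp add: add_increasing)
  qed
  then show thesis using that[of \<theta> "G L1"] \<theta> G_nn by (simp add: G_def q_def)
qed

section \<open>Cauchy-Schwarz bounds for the potential\<close>

lemma newton_abs_integral: "\<bar>newton g r\<bar> \<le> (LINT y|lebesgue. \<bar>g y\<bar> / (max r (norm y))\<^sup>2) / (4 * pi\<^sup>2)"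
proof -
  have "\<bar>LINT y|lebesgue. g y / (max r (norm y))\<^sup>2\<bar> \<le> (LINT y|lebesgue. \<bar>g y / (max r (norm y))\<^sup>2\<bar>)"
    by (rule integral_abs_bound)
  then show ?thesis by (simp add: newton_def divide_right_mono)
qed

lemma AE_nonzero: "AE x in lebesgue. x \<noteq> (0::real^4)"
  by (rule AE_completion[OF AE_lborel_singleton])

context
  fixes \<beta> :: real and chi :: "real \<Rightarrow> real"
  assumes \<beta>: "0 < \<beta>" "\<beta> < 1" and adm: "admissible_chi chi"
begin

lemma newton_bound:
  fixes g :: "real^4 \<Rightarrow> real"
  assumes g[measurable]: "g \<in> borel_measurable lebesgue" and int: "integrable lebesgue (\<lambda>x. weight \<beta> chi x * (g x)\<^sup>2)"
    and r: "0 < r"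
  shows "integrable lebesgue (\<lambda>y. g y / (max r (norm y))\<^sup>2)"
    and "(LINT y|lebesgue. \<bar>g y\<bar> / (max r (norm y))\<^sup>2) \<le> sqrt (LINT x|lebesgue. weight \<beta> chi x * (g x)\<^sup>2) * sqrt (kernel_bound_fun \<beta> chi r)"
proof -
  have w[measurable]: "weight \<beta> chi \<in> borel_measurable lebesgue" by (rule weight_measurable[OF adm])
  \<comment> \<open>The dual factor for the weighted inequality: off the origin
    \<open>weight\<close> times k is the kernel, and \<open>weight\<close> times k squared is the
    integrand of \<open>kernel_square_bound\<close>.\<close>
  define k where "k y = 1 / (weight \<beta> chi y * (max r (norm y))\<^sup>2)" for y
  have k[measurable]: "k \<in> borel_measurable lebesgue" unfolding k_def by measurable
  have sq: "weight \<beta> chi y * (k y)\<^sup>2 = 1 / (weight \<beta> chi y * (max r (norm y)) ^ 4)" for y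
    by (cases "weight \<beta> chi y = 0") (simp_all add: k_def field_simps power2_eq_square power4_eq_xxxx)
  have kk: "integrable lebesgue (\<lambda>y. weight \<beta> chi y * (k y)\<^sup>2)" "(LINT y|lebesgue. weight \<beta> chi y * (k y)\<^sup>2) \<le> kernel_bound_fun \<beta> chi r"
    unfolding sq
    by (rule integrable_and_integral_le[OF _ _ kernel_square_bound[OF \<beta> adm r] kernel_bound_fun_nonneg[OF \<beta> adm]];
        use weight_nonneg[OF adm] in \<open>auto intro!: AE_I2 mult_nonneg_nonneg divide_nonneg_nonneg\<close>)+
  have prod: "weight \<beta> chi y * (\<bar>g y\<bar> * k y) = \<bar>g y\<bar> / (max r (norm y))\<^sup>2" if "y \<noteq> 0" for y
    using radial_weight_pos[OF adm, of "norm y" \<beta>] that by (simp add: k_def weight_eq)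
  have ae: "AE y in lebesgue. weight \<beta> chi y * (\<bar>g y\<bar> * k y) = \<bar>g y\<bar> / (max r (norm y))\<^sup>2"
    using AE_nonzero by eventually_elim (rule prod)
  have int': "integrable lebesgue (\<lambda>x. weight \<beta> chi x * (\<bar>g x\<bar>)\<^sup>2)" using int by simp
  have ga: "(\<lambda>x. \<bar>g x\<bar>) \<in> borel_measurable lebesgue" by measurable
  have i: "integrable lebesgue (\<lambda>y. weight \<beta> chi y * (\<bar>g y\<bar> * k y))"
    by (rule weighted_product_integrable[OF w ga k weight_nonneg[OF adm] int' kk(1)])
  have m: "(\<lambda>y. \<bar>g y\<bar> / (max r (norm y))\<^sup>2) \<in> borel_measurable lebesgue" by measurable
  have i': "integrable lebesgue (\<lambda>y. \<bar>g y\<bar> / (max r (norm y))\<^sup>2)"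
    by (rule integrable_cong_AE_imp[OF i m]) (use ae in eventually_elim, simp)
  show "integrable lebesgue (\<lambda>y. g y / (max r (norm y))\<^sup>2)"
    by (rule Bochner_Integration.integrable_bound[OF i']) auto
  have "(LINT y|lebesgue. \<bar>g y\<bar> / (max r (norm y))\<^sup>2) = (LINT y|lebesgue. weight \<beta> chi y * (\<bar>g y\<bar> * k y))"
    by (rule integral_cong_AE[OF m borel_measurable_integrable[OF i]]) (use ae in eventually_elim, simp)
  also have "\<dots> \<le> sqrt (LINT x|lebesgue. weight \<beta> chi x * (\<bar>g x\<bar>)\<^sup>2) * sqrt (LINT y|lebesgue. weight \<beta> chi y * (k y)\<^sup>2)"
    using weighted_Cauchy_Schwarz[OF w ga k weight_nonneg[OF adm] int' kk(1)] by simp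
  also have "\<dots> \<le> sqrt (LINT x|lebesgue. weight \<beta> chi x * (g x)\<^sup>2) * sqrt (kernel_bound_fun \<beta> chi r)"
    using kk(2) weight_nonneg[OF adm]
    by (simp add: mult_left_mono integral_nonneg_AE)
  finally show "(LINT y|lebesgue. \<bar>g y\<bar> / (max r (norm y))\<^sup>2) \<le> sqrt (LINT x|lebesgue. weight \<beta> chi x * (g x)\<^sup>2) * sqrt (kernel_bound_fun \<beta> chi r)" .
qed

text \<open>A fixed potential is of smaller order at the origin than the Cauchy-Schwarz bound suggests: only
  the part of \<open>g\<close> near the origin contributes to the growth.\<close>

lemma newton_small:
  fixes g :: "real^4 \<Rightarrow> real"
  assumes g[measurable]: "g \<in> borel_measurable lebesgue" and int: "integrable lebesgue (\<lambda>x. weight \<beta> chi x * (g x)\<^sup>2)"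
    and \<epsilon>: "0 < \<epsilon>"
  obtains C where "0 \<le> C"
    "\<And>r. 0 < r \<Longrightarrow> (LINT y|lebesgue. \<bar>g y\<bar> / (max r (norm y))\<^sup>2) \<le> \<epsilon> * sqrt (kernel_bound_fun \<beta> chi r) + C"
proof -
  have w[measurable]: "weight \<beta> chi \<in> borel_measurable lebesgue" by (rule weight_measurable[OF adm])
  \<comment> \<open>Restriction of g to shrinking balls; its weighted energy tends to 0 by dominated
    convergence, so some n brings its norm below \<epsilon>.\<close>
  define gn where "gn n x = indicator (ball 0 (inverse (real (Suc n)))) x * g x" for n x
  have gn[measurable]: "gn n \<in> borel_measurable lebesgue" for n
  proof -
    have [measurable]: "ball (0::real^4) (inverse (real (Suc n))) \<in> sets lebesgue"
      by (rule sets_completionI_sets) simp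
    show ?thesis unfolding gn_def[abs_def] by measurable
  qed
  have le: "weight \<beta> chi x * (gn n x)\<^sup>2 \<le> weight \<beta> chi x * (g x)\<^sup>2" for n x
    using weight_nonneg[OF adm, of \<beta> x] by (auto simp: gn_def split: split_indicator)
  have ign: "integrable lebesgue (\<lambda>x. weight \<beta> chi x * (gn n x)\<^sup>2)" for n
    by (rule Bochner_Integration.integrable_bound[OF int])
      (use le weight_nonneg[OF adm] in \<open>auto intro!: AE_I2\<close>)
  have "(\<lambda>n. LINT x|lebesgue. weight \<beta> chi x * (gn n x)\<^sup>2) \<longlonglongrightarrow> (LINT x::real^4|lebesgue. 0)"
  proof (rule integral_dominated_convergence[OF _ _ int])
    show "AE x in lebesgue. (\<lambda>n. weight \<beta> chi x * (gn n x)\<^sup>2) \<longlonglongrightarrow> 0"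
      using AE_nonzero
    proof eventually_elim
      case (elim x)
      obtain N where N: "inverse (real (Suc N)) < norm x"
        using reals_Archimedean[of "norm x"] elim by auto
      have "\<forall>\<^sub>F n in sequentially. weight \<beta> chi x * (gn n x)\<^sup>2 = 0"
        using eventually_ge_at_top[of N]
      proof eventually_elim
        case (elim n)
        have "inverse (real (Suc n)) \<le> inverse (real (Suc N))"
          using elim by (intro le_imp_inverse_le) auto
        then have "x \<notin> ball 0 (inverse (real (Suc n)))"
          using N by (simp only: mem_ball dist_0_norm not_less)
        then show ?case by (simp add: gn_def)
      qed
      then show ?case by (rule tendsto_eventually)
    qed
    show "AE x in lebesgue. norm (weight \<beta> chi x * (gn n x)\<^sup>2) \<le> weight \<beta> chi x * (g x)\<^sup>2" for n
      using le weight_nonneg[OF adm] by (intro AE_I2) simp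
  qed measurable
  then have "(\<lambda>n. LINT x|lebesgue. weight \<beta> chi x * (gn n x)\<^sup>2) \<longlonglongrightarrow> 0" by simp
  from tendsto_real_sqrt[OF this] have "(\<lambda>n. sqrt (LINT x|lebesgue. weight \<beta> chi x * (gn n x)\<^sup>2)) \<longlonglongrightarrow> 0" by simp
  from order_tendstoD(2)[OF this \<epsilon>] obtain n where n: "sqrt (LINT x|lebesgue. weight \<beta> chi x * (gn n x)\<^sup>2) < \<epsilon>"
    by (auto simp: eventually_sequentially)
  define \<delta> where "\<delta> = inverse (real (Suc n))"
  have \<delta>: "0 < \<delta>" by (simp add: \<delta>_def)
  \<comment> \<open>Where |y| >= \<delta>, the kernel at any radius r is at most the kernel at
    \<delta>; the outer part of g thus contributes a constant independent of r.\<close>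
  define C where "C = (LINT y|lebesgue. \<bar>g y\<bar> / (max \<delta> (norm y))\<^sup>2)"
  have abs: "integrable lebesgue (\<lambda>y. \<bar>f y\<bar> / (max r (norm y))\<^sup>2)"
    if "f \<in> borel_measurable lebesgue" "integrable lebesgue (\<lambda>x. weight \<beta> chi x * (f x)\<^sup>2)" "0 < r" for f r
    using integrable_abs[OF newton_bound(1)[OF that]] by simp
  have "(LINT y|lebesgue. \<bar>g y\<bar> / (max r (norm y))\<^sup>2) \<le> \<epsilon> * sqrt (kernel_bound_fun \<beta> chi r) + C" if r: "0 < r" for r
  proof -
    have "(LINT y|lebesgue. \<bar>g y\<bar> / (max r (norm y))\<^sup>2)
      \<le> (LINT y|lebesgue. \<bar>gn n y\<bar> / (max r (norm y))\<^sup>2 + \<bar>g y\<bar> / (max \<delta> (norm y))\<^sup>2)"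
    proof (rule integral_mono)
      fix y
      show "\<bar>g y\<bar> / (max r (norm y))\<^sup>2 \<le> \<bar>gn n y\<bar> / (max r (norm y))\<^sup>2 + \<bar>g y\<bar> / (max \<delta> (norm y))\<^sup>2"
      proof (cases "norm y < \<delta>")
        case True
        then show ?thesis by (simp add: gn_def \<delta>_def)
      next
        case False
        have "\<bar>g y\<bar> / (max r (norm y))\<^sup>2 \<le> \<bar>g y\<bar> / (max \<delta> (norm y))\<^sup>2"
          using False \<delta> r by (intro divide_left_mono power_mono mult_pos_pos) auto
        then show ?thesis by (simp add: add_increasing)
      qed
    qed (intro Bochner_Integration.integrable_add abs g gn int ign r \<delta>)+
    also have "\<dots> = (LINT y|lebesgue. \<bar>gn n y\<bar> / (max r (norm y))\<^sup>2) + C"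
      unfolding C_def by (intro Bochner_Integration.integral_add abs g gn int ign r \<delta>)
    also have "\<dots> \<le> sqrt (LINT x|lebesgue. weight \<beta> chi x * (gn n x)\<^sup>2) * sqrt (kernel_bound_fun \<beta> chi r) + C"
      using newton_bound(2)[OF gn ign r] by simp
    also have "\<dots> \<le> \<epsilon> * sqrt (kernel_bound_fun \<beta> chi r) + C"
      using n kernel_bound_fun_nonneg[OF \<beta> adm, of r] by (intro add_right_mono mult_right_mono) auto
    finally show ?thesis .
  qed
  moreover have "0 \<le> C" unfolding C_def by (intro integral_nonneg_AE AE_I2) simp
  ultimately show thesis using that by blast
qed

end

section \<open>Exponential integrals\<close>

text \<open>Outside the unit ball the exponent X is bounded; the factor X that survives here is what
  makes the integral of exp X - 1 converge at infinity.\<close>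

lemma exp_minus_one_le:
  fixes X :: real
  shows "exp X - 1 \<le> X * exp X"
proof -
  have "(1 - X) * exp X \<le> exp (- X) * exp X"
    using exp_ge_add_one_self[of "- X"] by (intro mult_right_mono) auto
  then show ?thesis by (simp add: exp_minus left_diff_distrib)
qed

text \<open>In polar coordinates the exponent becomes 3 - 4 \<theta>, which exceeds -1 exactly when
  \<theta> < 1; the factor 4 in \<open>alpha_crit\<close> reflects this dimension.\<close>

lemma nn_integral_norm_powr_ball:
  assumes "\<theta> < 1"
  shows "(\<integral>\<^sup>+x. ennreal (indicator {..<1} (norm (x::real^4)) * norm x powr (- 4 * \<theta>)) \<partial>lebesgue) < \<infinity>"
proof -
  have "(\<integral>\<^sup>+x. ennreal (indicator {..<1} (norm (x::real^4)) * norm x powr (- 4 * \<theta>)) \<partial>lebesgue)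
    = (\<integral>\<^sup>+t. ennreal (shell_density TYPE(real^4) t) * ennreal (indicator {..<1} t * t powr (- 4 * \<theta>)) \<partial>lborel)"
    by (rule nn_integral_norm) measurable
  also have "\<dots> \<le> (\<integral>\<^sup>+t. ennreal (2 * pi\<^sup>2) * ennreal (indicator {0..1} t * t powr (3 - 4 * \<theta>)) \<partial>lborel)"
  proof (rule nn_integral_mono)
    fix t :: real
    show "ennreal (shell_density TYPE(real^4) t) * ennreal (indicator {..<1} t * t powr (- 4 * \<theta>))
      \<le> ennreal (2 * pi\<^sup>2) * ennreal (indicator {0..1} t * t powr (3 - 4 * \<theta>))"
    proof (cases "0 < t \<and> t < 1")
      case True
      have "t powr (3 - 4 * \<theta>) = t powr 3 * t powr (- 4 * \<theta>)"
        by (simp add: powr_add[symmetric])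
      also have "t powr 3 = t ^ 3" using True powr_realpow[of t 3] by simp
      finally show ?thesis using True
        by (simp add: shell_density_4 ennreal_mult'[symmetric] mult.assoc)
    qed (auto simp: shell_density_def)
  qed
  also have "\<dots> = ennreal (2 * pi\<^sup>2) * ennreal (1 / (3 - 4 * \<theta> + 1))"
    using assms by (simp add: nn_integral_cmult nn_integral_powr_from_0)
  also have "\<dots> < \<infinity>" by (simp add: ennreal_mult_less_top)
  finally show ?thesis .
qed

context
  fixes \<beta> :: real and chi :: "real \<Rightarrow> real"
  assumes \<beta>: "0 < \<beta>" "\<beta> < 1" and adm: "admissible_chi chi"
    and tail_finite: "(\<integral>\<^sup>+r\<in>{1..}. ennreal (r ^ 3 * (LBINT y:{r..}. 1 / (chi y * y)) powr (1 / (1 - \<beta>))) \<partial>lborel) < \<infinity>"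
    and head_finite: "(\<integral>\<^sup>+r\<in>{1..}. ennreal (r powr (3 - 2 / (1 - \<beta>))
        * (LBINT y:{1..r}. y / chi y) powr (1 / (1 - \<beta>))) \<partial>lborel) < \<infinity>"
begin

text \<open>Raised to the power s = 1/(1-\<beta>) and multiplied by t^3, the three outer terms of
  \<open>kernel_bound_fun\<close> become multiples of t^(3-4s), integrable because s > 1, and of the
  integrands in \<open>head_finite\<close> and \<open>tail_finite\<close>, the growth hypotheses at
  k = 1.\<close>

lemma kernel_bound_outer:
  "(\<integral>\<^sup>+x. ennreal (indicator {1..} (norm (x::real^4)) * kernel_bound_fun \<beta> chi (norm x) powr (1 / (1 - \<beta>))) \<partial>lebesgue) < \<infinity>"
proof -
  define s where "s = 1 / (1 - \<beta>)"
  have s: "1 < s" using \<beta> by (simp add: s_def)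
  note [measurable] = kernel_bound_fun_measurable[OF \<beta> adm] chi_tail_measurable[OF \<beta> adm] chi_head_measurable[OF \<beta> adm]
  define f where "f t = shell_density TYPE(real^4) t * (indicator {1..} t * kernel_bound_fun \<beta> chi t powr s)" for t
  define P where "P = 2 * pi\<^sup>2"
  define M where "M = P * 3 powr s"
  define e1 where "e1 t = M * (pi\<^sup>2 / 2) powr s * (indicator {1..} t * t powr (3 - 4 * s))" for t :: real
  define e2 where "e2 t = indicator {1..} t * (t powr (3 - 2 * s) * chi_head chi t powr s)" for t
  define e3 where "e3 t = indicator {1..} t * (t ^ 3 * chi_tail chi t powr s)" for t
  have M: "0 \<le> M" "0 \<le> P" by (auto simp: M_def P_def)
  have em[measurable]: "e1 \<in> borel_measurable borel" "e2 \<in> borel_measurable borel" "e3 \<in> borel_measurable borel"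
    unfolding e1_def[abs_def] e2_def[abs_def] e3_def[abs_def] by measurable
  have nn: "0 \<le> e1 t" "0 \<le> e2 t" "0 \<le> e3 t" for t
    using M chi_tail_nonneg[OF \<beta> adm] chi_head_nonneg[OF \<beta> adm]
    by (auto simp: e1_def e2_def e3_def split: split_indicator)
  have I1: "(\<integral>\<^sup>+t. ennreal (e1 t) \<partial>lborel) < \<infinity>"
  proof -
    have "(\<integral>\<^sup>+t. ennreal (e1 t) \<partial>lborel)
      = ennreal (M * (pi\<^sup>2 / 2) powr s) * (\<integral>\<^sup>+t. ennreal (indicator {1..} t * t powr (3 - 4 * s)) \<partial>lborel)"
      unfolding e1_def using M by (subst nn_integral_cmult[symmetric]) (auto simp: ennreal_mult')
    also have "\<dots> < \<infinity>"
      using nn_integral_powr_from_1[of "3 - 4 * s"] s by (simp add: ennreal_mult_less_top)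
    finally show ?thesis .
  qed
  have I2: "(\<integral>\<^sup>+t. ennreal (e2 t) \<partial>lborel) < \<infinity>"
  proof -
    have "(\<integral>\<^sup>+t. ennreal (e2 t) \<partial>lborel)
      = (\<integral>\<^sup>+r\<in>{1..}. ennreal (r powr (3 - 2 / (1 - \<beta>)) * (LBINT y:{1..r}. y / chi y) powr (1 / (1 - \<beta>))) \<partial>lborel)"
      by (intro nn_integral_cong) (auto simp: e2_def s_def chi_head_eq[OF \<beta> adm] split: split_indicator)
    then show ?thesis using head_finite by simp
  qed
  have I3: "(\<integral>\<^sup>+t. ennreal (e3 t) \<partial>lborel) < \<infinity>"
  proof -
    have "(\<integral>\<^sup>+t. ennreal (e3 t) \<partial>lborel)
      = (\<integral>\<^sup>+r\<in>{1..}. ennreal (r ^ 3 * (LBINT y:{r..}. 1 / (chi y * y)) powr (1 / (1 - \<beta>))) \<partial>lborel)"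
      by (intro nn_integral_cong) (auto simp: e3_def s_def chi_tail_eq[OF \<beta> adm] split: split_indicator)
    then show ?thesis using tail_finite by simp
  qed
  have fin: "x = ennreal (enn2real x)" if "x < \<infinity>" for x :: ennreal
    using that by simp
  have "(\<integral>\<^sup>+x. ennreal (indicator {1..} (norm (x::real^4)) * kernel_bound_fun \<beta> chi (norm x) powr s) \<partial>lebesgue)
    = (\<integral>\<^sup>+t. ennreal (f t) \<partial>lborel)"
    unfolding f_def ennreal_mult'[OF shell_density_nonneg]
    by (rule nn_integral_norm) measurable
  also have "\<dots> \<le> ennreal (enn2real (\<integral>\<^sup>+t. ennreal (e1 t) \<partial>lborel)
      + (M * P powr s * enn2real (\<integral>\<^sup>+t. ennreal (e2 t) \<partial>lborel) + M * P powr s * enn2real (\<integral>\<^sup>+t. ennreal (e3 t) \<partial>lborel)))"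
  proof (rule nn_integral_three_terms_le)
    show "f t \<le> e1 t + (M * P powr s * e2 t + M * P powr s * e3 t)" for t
    proof (cases "1 \<le> t")
      case True
      define a b c where "a = pi\<^sup>2 / 2 / t ^ 4" and "b = P / t\<^sup>2 * chi_head chi t" and "c = P * chi_tail chi t"
      have abc: "0 \<le> a" "0 \<le> b" "0 \<le> c"
        using True M chi_tail_nonneg[OF \<beta> adm] chi_head_nonneg[OF \<beta> adm] by (auto simp: a_def b_def c_def)
      have t: "0 < t" using True by simp
      have tp: "(t ^ n) powr s = t powr (real n * s)" for n
        by (simp only: powr_realpow[OF t, symmetric] powr_powr)
      have kbt: "kernel_bound_fun \<beta> chi t = a + b + c" using True by (simp add: kernel_bound_fun_def a_def b_def c_def P_def)
      have "f t = P * (t ^ 3 * (a + b + c) powr s)"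
        using True by (simp add: f_def shell_density_4 kbt P_def)
      also have "\<dots> \<le> P * (t ^ 3 * (3 powr s * (a powr s + b powr s + c powr s)))"
        using powr_sum3_le[OF abc] s M t by (intro mult_left_mono) auto
      also have "\<dots> = M * (t ^ 3 * a powr s) + M * (t ^ 3 * b powr s) + M * (t ^ 3 * c powr s)"
        by (simp add: M_def algebra_simps)
      also have "t ^ 3 * a powr s = (pi\<^sup>2 / 2) powr s * t powr (3 - 4 * s)"
      proof -
        have "a powr s = (pi\<^sup>2 / 2) powr s / t powr (4 * s)"
          unfolding a_def using t tp[of 4] by (subst powr_divide) auto
        moreover have "t ^ 3 = t powr 3" using powr_realpow[OF t, of 3] by simp
        ultimately show ?thesis by (simp add: powr_diff)
      qed
      also have "t ^ 3 * b powr s = P powr s * (t powr (3 - 2 * s) * chi_head chi t powr s)"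
      proof -
        have "b powr s = P powr s / t powr (2 * s) * chi_head chi t powr s"
          unfolding b_def using t tp[of 2] M chi_head_nonneg[OF \<beta> adm, of t] by (simp add: powr_mult powr_divide)
        moreover have "t ^ 3 = t powr 3" using powr_realpow[OF t, of 3] by simp
        ultimately show ?thesis by (simp add: powr_diff)
      qed
      also have "t ^ 3 * c powr s = P powr s * (t ^ 3 * chi_tail chi t powr s)"
        unfolding c_def using M chi_tail_nonneg[OF \<beta> adm, of t] by (simp add: powr_mult)
      finally show ?thesis using True by (simp add: e1_def e2_def e3_def mult.assoc)
    qed (simp add: f_def e1_def e2_def e3_def)
  qed (use nn M em fin[OF I1] fin[OF I2] fin[OF I3] in auto)
  also have "\<dots> < \<infinity>" by simp
  finally show ?thesis by (simp add: s_def)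
qed

text \<open>The integrability of y / chi(y) on the whole half-line bounds \<open>chi_head\<close>
  independently of r; the other two terms decrease in r.\<close>

lemma kernel_bound_outer_le:
  obtains B where "0 \<le> B" "\<And>r. 1 \<le> r \<Longrightarrow> kernel_bound_fun \<beta> chi r \<le> B"
proof -
  define H where "H = (LBINT y. indicator {1..} y * (y / chi y))"
  have H: "chi_head chi r \<le> H" for r unfolding H_def by (rule chi_head_le[OF \<beta> adm])
  have "kernel_bound_fun \<beta> chi r \<le> pi\<^sup>2 / 2 + 2 * pi\<^sup>2 * H + 2 * pi\<^sup>2 * chi_tail chi 1" if "1 \<le> r" for r
  proof -
    have "pi\<^sup>2 / 2 / r ^ 4 \<le> pi\<^sup>2 / 2 / 1"
      using that by (intro divide_left_mono) auto
    moreover have "2 * pi\<^sup>2 / r\<^sup>2 * chi_head chi r \<le> 2 * pi\<^sup>2 / 1 * H"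
      using that H[of r] chi_head_nonneg[OF \<beta> adm, of r]
      by (intro mult_mono divide_left_mono) auto
    moreover have "2 * pi\<^sup>2 * chi_tail chi r \<le> 2 * pi\<^sup>2 * chi_tail chi 1"
      using chi_tail_le[OF \<beta> adm, of r] by (intro mult_left_mono) auto
    moreover have "kernel_bound_fun \<beta> chi r
        = pi\<^sup>2 / 2 / r ^ 4 + 2 * pi\<^sup>2 / r\<^sup>2 * chi_head chi r + 2 * pi\<^sup>2 * chi_tail chi r"
      using that by (simp add: kernel_bound_fun_def)
    ultimately show ?thesis by linarith
  qed
  moreover from this[of 1] have "0 \<le> pi\<^sup>2 / 2 + 2 * pi\<^sup>2 * H + 2 * pi\<^sup>2 * chi_tail chi 1"
    using kernel_bound_fun_nonneg[OF \<beta> adm, of 1] by simp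
  ultimately show thesis using that by blast
qed

text \<open>If the additive constant c were nonzero, then outside the unit ball |c|^q would be
  dominated by multiples of |v|^q and of \<open>kernel_bound_fun\<close> to the power 1/(1-\<beta>),
  both integrable there, although that region has infinite measure.\<close>

lemma X_space_newton:
  assumes v: "v \<in> X_space \<beta> chi"
  shows "AE x in lebesgue. v x = newton (weak_laplacian v) (norm x)"
proof -
  define g where "g = weak_laplacian v"
  note X = X_space_weak_laplacian[OF v, folded g_def]
  define q where "q = 2 / (1 - \<beta>)"
  have q: "0 < q" using \<beta> by (simp add: q_def)
  have gi: "integrable lebesgue (\<lambda>y. g y / (max 1 (norm y))\<^sup>2)"
    by (rule newton_bound(1)[OF \<beta> adm X(3,2)]) simp
  have rad: "radial_ae v" and vint: "integrable lebesgue (\<lambda>x. \<bar>v x\<bar> powr q)"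
    using v by (auto simp: X_space_def L_rad_def q_def)
  obtain c where c: "AE x in lebesgue. v x = newton g (norm x) + c"
    by (rule radial_representation[OF X(1) gi rad])
  have "c = 0"
  proof (rule ccontr)
    assume "c \<noteq> 0"
    define A where "A = sqrt (LINT x|lebesgue. weight \<beta> chi x * (g x)\<^sup>2) / (4 * pi\<^sup>2)"
    have A: "0 \<le> A" unfolding A_def using weight_nonneg[OF adm] by (auto intro!: divide_nonneg_nonneg integral_nonneg_AE AE_I2)
    have nb: "\<bar>newton g r\<bar> \<le> A * sqrt (kernel_bound_fun \<beta> chi r)" if "0 < r" for r
      using newton_abs_integral[of g r] newton_bound(2)[OF \<beta> adm X(3,2) that]
      by (simp add: A_def field_simps)
    have "AE x in lebesgue. ennreal (\<bar>c\<bar> powr q) * indicator {x::real^4. 1 \<le> norm x} x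
      \<le> ennreal (2 powr q) * ennreal (\<bar>v x\<bar> powr q) + ennreal (2 powr q * A powr q) * ennreal (indicator {1..} (norm x) * kernel_bound_fun \<beta> chi (norm x) powr (1 / (1 - \<beta>)))"
      using c
    proof eventually_elim
      case (elim x)
      show ?case
      proof (cases "1 \<le> norm x")
        case True
        have kb0: "0 \<le> kernel_bound_fun \<beta> chi (norm x)" by (rule kernel_bound_fun_nonneg[OF \<beta> adm])
        have "\<bar>c\<bar> \<le> 2 * max \<bar>v x\<bar> (A * sqrt (kernel_bound_fun \<beta> chi (norm x)))"
          using elim nb[of "norm x"] True by linarith
        then have "\<bar>c\<bar> powr q \<le> (2 * max \<bar>v x\<bar> (A * sqrt (kernel_bound_fun \<beta> chi (norm x)))) powr q"
          using q by (intro powr_mono2) auto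
        also have "\<dots> = 2 powr q * (max \<bar>v x\<bar> (A * sqrt (kernel_bound_fun \<beta> chi (norm x)))) powr q"
          by (simp add: powr_mult max_def)
        also have "(max \<bar>v x\<bar> (A * sqrt (kernel_bound_fun \<beta> chi (norm x)))) powr q \<le> \<bar>v x\<bar> powr q + (A * sqrt (kernel_bound_fun \<beta> chi (norm x))) powr q"
          by (auto simp: max_def)
        also have "(A * sqrt (kernel_bound_fun \<beta> chi (norm x))) powr q = A powr q * kernel_bound_fun \<beta> chi (norm x) powr (1 / (1 - \<beta>))"
          using A kb0 by (simp add: powr_mult powr_half_sqrt[symmetric] powr_powr q_def)
        finally have "\<bar>c\<bar> powr q \<le> 2 powr q * \<bar>v x\<bar> powr q + 2 powr q * A powr q * kernel_bound_fun \<beta> chi (norm x) powr (1 / (1 - \<beta>))"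
          by (simp add: distrib_left mult.assoc)
        then have "ennreal (\<bar>c\<bar> powr q) \<le> ennreal (2 powr q * \<bar>v x\<bar> powr q + 2 powr q * A powr q * kernel_bound_fun \<beta> chi (norm x) powr (1 / (1 - \<beta>)))"
          by (rule ennreal_leI)
        then show ?thesis using True by (simp add: ennreal_plus ennreal_mult)
      qed simp
    qed
    then have "(\<integral>\<^sup>+x. ennreal (\<bar>c\<bar> powr q) * indicator {x::real^4. 1 \<le> norm x} x \<partial>lebesgue)
      \<le> (\<integral>\<^sup>+x. ennreal (2 powr q) * ennreal (\<bar>v x\<bar> powr q) + ennreal (2 powr q * A powr q) * ennreal (indicator {1..} (norm x) * kernel_bound_fun \<beta> chi (norm x) powr (1 / (1 - \<beta>))) \<partial>lebesgue)"
      by (rule nn_integral_mono_AE)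
    also have "\<dots> = ennreal (2 powr q) * (\<integral>\<^sup>+x. ennreal (\<bar>v x\<bar> powr q) \<partial>lebesgue)
        + ennreal (2 powr q * A powr q) * (\<integral>\<^sup>+x. ennreal (indicator {1..} (norm (x::real^4)) * kernel_bound_fun \<beta> chi (norm x) powr (1 / (1 - \<beta>))) \<partial>lebesgue)"
    proof -
      note [measurable] = kernel_bound_fun_measurable[OF \<beta> adm] borel_measurable_integrable[OF vint]
      show ?thesis by (subst nn_integral_add) (auto simp: nn_integral_cmult)
    qed
    also have "\<dots> < \<infinity>"
      using kernel_bound_outer integrableD(2)[OF vint] vint
      by (auto simp: ennreal_mult_less_top integrable_iff_bounded)
    finally have "(\<integral>\<^sup>+x. ennreal (\<bar>c\<bar> powr q) * indicator {x::real^4. 1 \<le> norm x} x \<partial>lebesgue) < \<infinity>" .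
    moreover have m: "{x::real^4. 1 \<le> norm x} \<in> sets lebesgue"
    proof -
      have "closed {x::real^4. 1 \<le> norm x}" by (intro closed_Collect_le continuous_intros)
      then show ?thesis by (auto intro: sets_completionI_sets borel_closed)
    qed
    ultimately have "ennreal (\<bar>c\<bar> powr q) * emeasure lebesgue {x::real^4. 1 \<le> norm x} < \<infinity>"
      by (simp add: nn_integral_cmult_indicator)
    then have "emeasure lebesgue {x::real^4. 1 \<le> norm x} < \<infinity>"
      using \<open>c \<noteq> 0\<close> by (auto simp: ennreal_mult_less_top)
    moreover have "emeasure lebesgue (ball (0::real^4) 1) < \<infinity>" by (simp add: emeasure_ball)
    ultimately have "emeasure lebesgue {x::real^4. 1 \<le> norm x} + emeasure lebesgue (ball (0::real^4) 1) < \<infinity>"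
      by simp
    moreover have "emeasure lebesgue (UNIV :: (real^4) set)
        \<le> emeasure lebesgue {x::real^4. 1 \<le> norm x} + emeasure lebesgue (ball (0::real^4) 1)"
    proof -
      have "UNIV = {x::real^4. 1 \<le> norm x} \<union> ball 0 1" by (auto simp: not_le)
      then show ?thesis using emeasure_subadditive[OF m, of "ball 0 1"] by simp
    qed
    ultimately have "emeasure lebesgue (UNIV :: (real^4) set) < \<infinity>"
      by (rule le_less_trans[rotated])
    then show False by simp
  qed
  then show ?thesis using c by (simp add: g_def)
qed

lemma exp_integrand_inner:
  assumes p: "0 < p" and nn: "0 \<le> \<kappa>" "0 \<le> C" and sub: "p * \<kappa> powr (2 / (1 - \<beta>)) < 1"
  obtains \<theta> E where "\<theta> < 1" "0 \<le> E"
    "\<And>r v. 0 < r \<Longrightarrow> r < 1 \<Longrightarrow> \<bar>v\<bar> \<le> (\<kappa> * sqrt (kernel_bound_fun \<beta> chi r) + C) / (4 * pi\<^sup>2) \<Longrightarrow>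
      exp (p * alpha_crit \<beta> * \<bar>v\<bar> powr (2 / (1 - \<beta>))) \<le> E * r powr (- 4 * \<theta>)"
proof -
  define q where "q = 2 / (1 - \<beta>)"
  have q: "0 < q" using \<beta> by (simp add: q_def)
  define K where "K = pi\<^sup>2 / 2 + 2 * pi\<^sup>2 * chi_tail chi 1"
  define K1 where "K1 = (1 - \<beta>) * K / (2 * pi\<^sup>2)"
  \<comment> \<open>Chosen so that \<open>alpha_crit \<beta>\<close> |v|^q = 4 (c0 |v|)^q. It also
    normalises the leading term: c0 times the square root of 2 pi^2 / (1-\<beta>), divided by 4
    pi^2, equals 1, so \<kappa> is exactly the coefficient that enters
    \<open>subcritical_growth\<close>.\<close>
  define c0 where "c0 = sqrt (8 * pi\<^sup>2 * (1 - \<beta>))"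
  have c0: "0 \<le> c0" using \<beta> by (simp add: c0_def)
  have K: "0 \<le> K" using chi_tail_nonneg[OF \<beta> adm, of 1] by (simp add: K_def)
  have K1: "0 \<le> K1" using \<beta> K by (simp add: K1_def)
  have C1: "0 \<le> c0 * C / (4 * pi\<^sup>2)" using c0 nn by simp
  obtain \<theta> D where \<theta>: "0 < \<theta>" "\<theta> < 1" "0 \<le> D"
    and gr: "\<And>L. 1 \<le> L \<Longrightarrow> p * (\<kappa> * sqrt (L powr (1 - \<beta>) + K1) + c0 * C / (4 * pi\<^sup>2)) powr (2 / (1 - \<beta>)) \<le> \<theta> * L + D"
    using subcritical_growth[OF \<beta> p nn(1) K1 C1 sub] by blast
  have alpha: "alpha_crit \<beta> * \<bar>v\<bar> powr q = 4 * (c0 * \<bar>v\<bar>) powr q" for v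
  proof -
    have "c0 powr q = (8 * pi\<^sup>2 * (1 - \<beta>)) powr (1 / (1 - \<beta>))"
      unfolding c0_def using \<beta> by (simp add: powr_half_sqrt[symmetric] powr_powr q_def)
    then show ?thesis using c0 by (simp add: alpha_crit_def powr_mult)
  qed
  have "exp (p * alpha_crit \<beta> * \<bar>v\<bar> powr q) \<le> exp (4 * D + 4 * \<theta>) * r powr (- 4 * \<theta>)"
    if r: "0 < r" "r < 1" and v: "\<bar>v\<bar> \<le> (\<kappa> * sqrt (kernel_bound_fun \<beta> chi r) + C) / (4 * pi\<^sup>2)" for r v
  proof -
    define L where "L = ln (exp 1 / r)"
    have L: "1 \<le> L" unfolding L_def using r by (intro ln_e_over_ge_1) auto
    have "c0 * sqrt (kernel_bound_fun \<beta> chi r) / (4 * pi\<^sup>2) = sqrt (L powr (1 - \<beta>) + K1)"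
    proof -
      have kb: "kernel_bound_fun \<beta> chi r = 2 * pi\<^sup>2 / (1 - \<beta>) * L powr (1 - \<beta>) + K"
        using r by (simp add: kernel_bound_fun_def L_def K_def)
      have "8 * pi\<^sup>2 * (1 - \<beta>) * kernel_bound_fun \<beta> chi r = (L powr (1 - \<beta>) + K1) * (4 * pi\<^sup>2)\<^sup>2"
        unfolding kb using \<beta> by (simp add: K1_def field_simps power2_eq_square)
      then have "c0 * sqrt (kernel_bound_fun \<beta> chi r) = sqrt (L powr (1 - \<beta>) + K1) * (4 * pi\<^sup>2)"
        unfolding c0_def by (simp only: real_sqrt_mult[symmetric]) (simp only: real_sqrt_mult real_sqrt_abs, simp)
      then show ?thesis by simp
    qed
    moreover have "c0 * \<bar>v\<bar> \<le> c0 * ((\<kappa> * sqrt (kernel_bound_fun \<beta> chi r) + C) / (4 * pi\<^sup>2))"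
      using v c0 by (rule mult_left_mono)
    moreover have "c0 * ((\<kappa> * sqrt (kernel_bound_fun \<beta> chi r) + C) / (4 * pi\<^sup>2))
        = \<kappa> * (c0 * sqrt (kernel_bound_fun \<beta> chi r) / (4 * pi\<^sup>2)) + c0 * C / (4 * pi\<^sup>2)"
      by (simp add: field_simps)
    ultimately have "c0 * \<bar>v\<bar> \<le> \<kappa> * sqrt (L powr (1 - \<beta>) + K1) + c0 * C / (4 * pi\<^sup>2)"
      by simp
    then have "(c0 * \<bar>v\<bar>) powr q \<le> (\<kappa> * sqrt (L powr (1 - \<beta>) + K1) + c0 * C / (4 * pi\<^sup>2)) powr q"
      using c0 q by (intro powr_mono2) auto
    then have "p * (c0 * \<bar>v\<bar>) powr q \<le> p * (\<kappa> * sqrt (L powr (1 - \<beta>) + K1) + c0 * C / (4 * pi\<^sup>2)) powr q"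
      using p by (intro mult_left_mono) auto
    also have "\<dots> \<le> \<theta> * L + D" using gr[OF L] by (simp add: q_def)
    finally have "p * alpha_crit \<beta> * \<bar>v\<bar> powr q \<le> 4 * D + 4 * \<theta> * L"
      by (simp add: mult.assoc alpha)
    then have "exp (p * alpha_crit \<beta> * \<bar>v\<bar> powr q) \<le> exp (4 * D + 4 * \<theta> * L)" by simp
    \<comment> \<open>Since L = 1 - ln r, the exponential of 4 \<theta> L is exp (4 \<theta>) r^(-4
      \<theta>).\<close>
    also have "\<dots> = exp (4 * D + 4 * \<theta>) * r powr (- 4 * \<theta>)"
      using r by (simp add: L_def ln_div powr_def exp_add[symmetric] algebra_simps)
    finally show ?thesis .
  qed
  then show thesis using that[of \<theta> "exp (4 * D + 4 * \<theta>)"] \<theta> by (simp add: q_def)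
qed

text \<open>I depends on the parameters only and is obtained before v, so one bound serves all
  members of a sequence. Near the origin v may carry the additive constant C; outside the unit ball
  its bound is a pure multiple of the root of \<open>kernel_bound_fun\<close>, so that it inherits
  integrability at infinity.\<close>

lemma exp_integral_bound:
  assumes p: "0 < p" and nn: "0 \<le> \<kappa>" "0 \<le> C" and sub: "p * \<kappa> powr (2 / (1 - \<beta>)) < 1" and N: "0 \<le> N"
  obtains I :: ennreal where "I < \<infinity>"
    "\<And>v. (\<And>r. 0 < r \<Longrightarrow> r < 1 \<Longrightarrow> \<bar>v r\<bar> \<le> (\<kappa> * sqrt (kernel_bound_fun \<beta> chi r) + C) / (4 * pi\<^sup>2)) \<Longrightarrow>
      (\<And>r. 1 \<le> r \<Longrightarrow> \<bar>v r\<bar> \<le> N * sqrt (kernel_bound_fun \<beta> chi r) / (4 * pi\<^sup>2)) \<Longrightarrow>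
      (\<integral>\<^sup>+x. ennreal (exp (p * alpha_crit \<beta> * \<bar>v (norm (x::real^4))\<bar> powr (2 / (1 - \<beta>))) - 1) \<partial>lebesgue) \<le> I"
proof -
  define q where "q = 2 / (1 - \<beta>)"
  have q: "0 < q" using \<beta> by (simp add: q_def)
  have alpha: "0 \<le> alpha_crit \<beta>" by (simp add: alpha_crit_def)
  obtain \<theta> E where \<theta>: "\<theta> < 1" "0 \<le> E"
    and inner: "\<And>r v. 0 < r \<Longrightarrow> r < 1 \<Longrightarrow> \<bar>v\<bar> \<le> (\<kappa> * sqrt (kernel_bound_fun \<beta> chi r) + C) / (4 * pi\<^sup>2) \<Longrightarrow>
      exp (p * alpha_crit \<beta> * \<bar>v\<bar> powr q) \<le> E * r powr (- 4 * \<theta>)"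
    unfolding q_def by (rule exp_integrand_inner[OF p nn sub]) blast
  obtain B where B: "0 \<le> B" "\<And>r. 1 \<le> r \<Longrightarrow> kernel_bound_fun \<beta> chi r \<le> B"
    using kernel_bound_outer_le by blast
  define Z where "Z = p * alpha_crit \<beta> * (N / (4 * pi\<^sup>2)) powr q"
  have Z: "0 \<le> Z" using p alpha by (simp add: Z_def)
  define Z' where "Z' = Z * exp (Z * B powr (1 / (1 - \<beta>)))"
  have Z': "0 \<le> Z'" using Z by (simp add: Z'_def)
  define f1 where "f1 x = indicator {..<1} (norm (x::real^4)) * norm x powr (- 4 * \<theta>)" for x
  define f2 where "f2 x = indicator {1..} (norm (x::real^4)) * kernel_bound_fun \<beta> chi (norm x) powr (1 / (1 - \<beta>))" for x
  note [measurable] = kernel_bound_fun_measurable[OF \<beta> adm]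
  have [measurable]: "f1 \<in> borel_measurable lebesgue" "f2 \<in> borel_measurable lebesgue"
    unfolding f1_def[abs_def] f2_def[abs_def] by measurable
  define I where "I = ennreal E * (\<integral>\<^sup>+x. ennreal (f1 x) \<partial>lebesgue) + ennreal Z' * (\<integral>\<^sup>+x. ennreal (f2 x) \<partial>lebesgue)"
  have "I < \<infinity>"
    unfolding I_def f1_def f2_def
    using nn_integral_norm_powr_ball[OF \<theta>(1)] kernel_bound_outer
    by (simp add: ennreal_mult_less_top)
  moreover have "(\<integral>\<^sup>+x. ennreal (exp (p * alpha_crit \<beta> * \<bar>v (norm (x::real^4))\<bar> powr q) - 1) \<partial>lebesgue) \<le> I"
    if v: "\<And>r. 0 < r \<Longrightarrow> r < 1 \<Longrightarrow> \<bar>v r\<bar> \<le> (\<kappa> * sqrt (kernel_bound_fun \<beta> chi r) + C) / (4 * pi\<^sup>2)"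
      "\<And>r. 1 \<le> r \<Longrightarrow> \<bar>v r\<bar> \<le> N * sqrt (kernel_bound_fun \<beta> chi r) / (4 * pi\<^sup>2)" for v
  proof -
    have "AE x in lebesgue. ennreal (exp (p * alpha_crit \<beta> * \<bar>v (norm (x::real^4))\<bar> powr q) - 1)
        \<le> ennreal E * ennreal (f1 x) + ennreal Z' * ennreal (f2 x)"
      using AE_nonzero
    proof eventually_elim
      case (elim x)
      show ?case
      proof (cases "norm x < 1")
        case True
        have "exp (p * alpha_crit \<beta> * \<bar>v (norm x)\<bar> powr q) \<le> E * f1 x"
          using inner[OF _ True v(1)[OF _ True]] elim True by (simp add: f1_def)
        then have "ennreal (exp (p * alpha_crit \<beta> * \<bar>v (norm x)\<bar> powr q) - 1) \<le> ennreal (E * f1 x)"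
          by (intro ennreal_leI) simp
        then show ?thesis using \<theta>(2) by (simp add: ennreal_mult' add_increasing2)
      next
        case False
        let ?k = "kernel_bound_fun \<beta> chi (norm x)"
        have k: "0 \<le> ?k" "?k \<le> B" using kernel_bound_fun_nonneg[OF \<beta> adm] B(2) False by auto
        define X where "X = p * alpha_crit \<beta> * \<bar>v (norm x)\<bar> powr q"
        have "\<bar>v (norm x)\<bar> powr q \<le> (N / (4 * pi\<^sup>2) * sqrt ?k) powr q"
          using v(2)[of "norm x"] False q by (intro powr_mono2) auto
        also have "\<dots> = (N / (4 * pi\<^sup>2)) powr q * ?k powr (1 / (1 - \<beta>))"
        proof -
          have "sqrt ?k powr q = ?k powr (1 / (1 - \<beta>))"
            using k by (simp add: powr_half_sqrt[symmetric] powr_powr q_def)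
          then show ?thesis using N k by (subst powr_mult) simp_all
        qed
        finally have "p * alpha_crit \<beta> * \<bar>v (norm x)\<bar> powr q \<le> p * alpha_crit \<beta> * ((N / (4 * pi\<^sup>2)) powr q * ?k powr (1 / (1 - \<beta>)))"
          using p alpha by (intro mult_left_mono) auto
        then have X: "X \<le> Z * ?k powr (1 / (1 - \<beta>))" by (simp add: X_def Z_def mult.assoc)
        also have "\<dots> \<le> Z * B powr (1 / (1 - \<beta>))"
          using Z k \<beta> by (intro mult_left_mono powr_mono2) auto
        finally have "exp X \<le> exp (Z * B powr (1 / (1 - \<beta>)))" by simp
        moreover have "0 \<le> X" using p alpha by (simp add: X_def)
        ultimately have "X * exp X \<le> (Z * ?k powr (1 / (1 - \<beta>))) * exp (Z * B powr (1 / (1 - \<beta>)))"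
          using X by (intro mult_mono) auto
        also have "\<dots> = Z' * f2 x" using False by (simp add: Z'_def f2_def)
        finally have "exp X - 1 \<le> Z' * f2 x" using exp_minus_one_le[of X] by linarith
        then have "ennreal (exp X - 1) \<le> ennreal (Z' * f2 x)" by (rule ennreal_leI)
        then show ?thesis using Z' by (simp add: ennreal_mult' add_increasing X_def)
      qed
    qed
    then have "(\<integral>\<^sup>+x. ennreal (exp (p * alpha_crit \<beta> * \<bar>v (norm (x::real^4))\<bar> powr q) - 1) \<partial>lebesgue)
      \<le> (\<integral>\<^sup>+x. ennreal E * ennreal (f1 x) + ennreal Z' * ennreal (f2 x) \<partial>lebesgue)"
      by (rule nn_integral_mono_AE)
    also have "\<dots> = I" unfolding I_def by (simp add: nn_integral_add nn_integral_cmult)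
    finally show ?thesis .
  qed
  ultimately show thesis using that by (simp add: q_def)
qed

end

theorem theorem1p2:
  fixes \<beta> C1 C2 :: real
    and chi :: "real \<Rightarrow> real"
    and un :: "nat \<Rightarrow> real^4 \<Rightarrow> real"
    and u :: "real^4 \<Rightarrow> real"
  assumes "0 < \<beta>" and "\<beta> < 1"
    and "admissible_chi chi"
    and "C1 > 0" and "C2 > 0"
    and "\<And>k::nat. k \<ge> 1 \<Longrightarrow>
      (\<integral>\<^sup>+r\<in>{1..}. ennreal (r^3 * (LBINT y:{r..}. 1 / (chi y * y)) powr (real k / (1 - \<beta>))) \<partial>lborel)
        < ennreal (C1 ^ k)"
    and "\<And>k::nat. k \<ge> 1 \<Longrightarrow>
      (\<integral>\<^sup>+r\<in>{1..}. ennreal (r powr (3 - 2 * real k / (1 - \<beta>))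
          * (LBINT y:{1..r}. y / chi y) powr (real k / (1 - \<beta>))) \<partial>lborel)
        < ennreal (C2 ^ k)"
    and "\<And>n. un n \<in> X_space \<beta> chi"
    and "u \<in> X_space \<beta> chi"
    and "\<not> (AE x in lebesgue. u x = 0)"
    and "\<And>n. X_norm \<beta> chi (un n) = 1"
    and "weakly_converges \<beta> chi un u"
  shows "\<forall>p::real. 0 < p \<and> ereal p < P_crit \<beta> chi u \<longrightarrow>
    (SUP n. \<integral>\<^sup>+x. ennreal (exp (p * alpha_crit \<beta> * \<bar>un n x\<bar> powr (2 / (1 - \<beta>))) - 1) \<partial>lebesgue) < \<infinity>"
proof (intro allI impI, elim conjE)
  fix p :: real
  assume p: "0 < p" and pP: "ereal p < P_crit \<beta> chi u"
  note \<beta> = assms(1,2) and adm = assms(3) and un = assms(8) and u = assms(9)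
  have tail_finite: "(\<integral>\<^sup>+r\<in>{1..}. ennreal (r ^ 3 * (LBINT y:{r..}. 1 / (chi y * y)) powr (1 / (1 - \<beta>))) \<partial>lborel) < \<infinity>"
    using less_trans[OF assms(6)[of 1] ennreal_less_top] by simp
  have head_finite: "(\<integral>\<^sup>+r\<in>{1..}. ennreal (r powr (3 - 2 / (1 - \<beta>))
        * (LBINT y:{1..r}. y / chi y) powr (1 / (1 - \<beta>))) \<partial>lborel) < \<infinity>"
    using less_trans[OF assms(7)[of 1] ennreal_less_top] by simp
  note ctx = \<beta> adm tail_finite head_finite
  define q where "q = 2 / (1 - \<beta>)"
  have q: "0 < q" using \<beta> by (simp add: q_def)
  let ?w = "weight \<beta> chi" and ?k = "kernel_bound_fun \<beta> chi"
  define g where "g = weak_laplacian u"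
  define gn where "gn n = weak_laplacian (un n)" for n
  have gnX: "integrable lebesgue (\<lambda>x. ?w x * (gn n x)\<^sup>2)" "gn n \<in> borel_measurable lebesgue" for n
    using X_space_weak_laplacian[OF un] by (auto simp: gn_def)
  have gX: "integrable lebesgue (\<lambda>x. ?w x * (g x)\<^sup>2)" "g \<in> borel_measurable lebesgue"
    using X_space_weak_laplacian[OF u] by (auto simp: g_def)
  define dn where "dn n x = gn n x - g x" for n x
  have dn_meas: "dn n \<in> borel_measurable lebesgue" for n
    unfolding dn_def using gnX(2) gX(2) by measurable
  have dnX: "integrable lebesgue (\<lambda>x. ?w x * (dn n x)\<^sup>2)" for n
    using weighted_square_sum[OF weight_measurable[OF adm] gX(2) gnX(2)[of n] weight_nonneg[OF adm] gX(1) gnX(1)[of n], of "-1"]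
    by (simp add: has_bochner_integral_iff dn_def algebra_simps)
  let ?A = "\<lambda>n r. LINT y|lebesgue. \<bar>gn n y\<bar> / (max r (norm y))\<^sup>2"

  define e where "e n = (LINT x|lebesgue. ?w x * (dn n x)\<^sup>2)" for n
  have e_lim: "e \<longlonglongrightarrow> 1 - (X_norm \<beta> chi u)\<^sup>2"
    using weak_limit_energy[OF adm un assms(11) u assms(12)] by (simp add: e_def[abs_def] dn_def gn_def g_def)
  have e_nonneg: "0 \<le> e n" for n
    unfolding e_def using weight_nonneg[OF adm] by (intro integral_nonneg_AE AE_I2) simp
  \<comment> \<open>As a limit of nonnegative energies. This yields ||u|| <= 1, so the second branch
    of \<open>P_crit\<close> means norm one.\<close>
  have lim_nonneg: "0 \<le> 1 - (X_norm \<beta> chi u)\<^sup>2"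
    by (rule tendsto_lowerbound[OF e_lim]) (auto simp: e_nonneg)
  define \<kappa>0 where "\<kappa>0 = sqrt (1 - (X_norm \<beta> chi u)\<^sup>2)"
  have \<kappa>0: "0 \<le> \<kappa>0" using lim_nonneg by (simp add: \<kappa>0_def)
  have X0: "0 \<le> X_norm \<beta> chi u"
    unfolding X_norm_def using weight_nonneg[OF adm] by (auto intro!: integral_nonneg_AE AE_I2)
  \<comment> \<open>The condition on p restated: \<kappa>0 is the limit of the norms of the
    differences, and it is 0 when \<open>P_crit\<close> is infinite.\<close>
  have sub0: "p * \<kappa>0 powr q < 1"
  proof (cases "X_norm \<beta> chi u < 1")
    case True
    define t where "t = 1 - (X_norm \<beta> chi u)\<^sup>2"
    have t: "0 < t" using True X0 power_strict_mono[of "X_norm \<beta> chi u" 1 2] by (simp add: t_def)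
    have "p < t powr (- (1 / (1 - \<beta>)))" using pP True by (simp add: P_crit_def t_def)
    then have "p * t powr (1 / (1 - \<beta>)) < t powr (- (1 / (1 - \<beta>))) * t powr (1 / (1 - \<beta>))"
      using t by (intro mult_strict_right_mono) auto
    also have "\<dots> = 1" using t by (simp add: powr_add[symmetric])
    finally show ?thesis
      using t by (simp add: \<kappa>0_def t_def[symmetric] powr_half_sqrt[symmetric] powr_powr q_def)
  next
    case False
    then have "1 \<le> (X_norm \<beta> chi u)\<^sup>2" by simp
    then have "\<kappa>0 = 0" using lim_nonneg by (simp add: \<kappa>0_def)
    then show ?thesis using q by simp
  qed
  \<comment> \<open>Makes \<open>p * \<kappa> powr q\<close> the midpoint of
    \<open>p * \<kappa>0 powr q\<close> and 1: above \<kappa>0, still subcritical, and positive even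
    if \<kappa>0 = 0.\<close>
  define \<kappa> where "\<kappa> = ((1 + p * \<kappa>0 powr q) / (2 * p)) powr (1 / q)"
  have pq: "0 \<le> p * \<kappa>0 powr q" using p by simp
  have \<kappa>q: "\<kappa> powr q = (1 + p * \<kappa>0 powr q) / (2 * p)"
    using q p pq by (simp add: \<kappa>_def powr_powr)
  have sub: "p * \<kappa> powr q < 1" using sub0 p by (simp add: \<kappa>q)
  have "\<kappa>0 powr q < \<kappa> powr q" using sub0 p by (simp add: \<kappa>q field_simps)
  have \<kappa>: "\<kappa>0 < \<kappa>"
  proof (rule ccontr)
    assume "\<not> \<kappa>0 < \<kappa>"
    then have "\<kappa> powr q \<le> \<kappa>0 powr q" using q by (intro powr_mono2) (auto simp: \<kappa>_def)
    with \<open>\<kappa>0 powr q < \<kappa> powr q\<close> show False by simp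
  qed
  then have \<kappa>_pos: "0 < \<kappa>" using \<kappa>0 by simp
  \<comment> \<open>Splits the gap as \<kappa> = \<kappa>0 + 2 \<epsilon>: one share for the
    convergence of the norms, one for the potential of u.\<close>
  define \<epsilon> where "\<epsilon> = (\<kappa> - \<kappa>0) / 2"
  have \<epsilon>: "0 < \<epsilon>" using \<kappa> by (simp add: \<epsilon>_def)

  define F where "F n = (\<integral>\<^sup>+x. ennreal (exp (p * alpha_crit \<beta> * \<bar>un n x\<bar> powr q) - 1) \<partial>lebesgue)" for n
  have F_eq: "F n = (\<integral>\<^sup>+x. ennreal (exp (p * alpha_crit \<beta> * \<bar>newton (gn n) (norm (x::real^4))\<bar> powr q) - 1) \<partial>lebesgue)" for n
    unfolding F_def
    by (rule nn_integral_cong_AE) (use X_space_newton[OF ctx un[of n]] in eventually_elim, simp add: gn_def)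
  have norm1: "sqrt (LINT x|lebesgue. ?w x * (gn n x)\<^sup>2) = 1" for n
    using assms(11)[of n] by (simp add: X_norm_def gn_def)
  have newton_le: "\<bar>newton (gn n) r\<bar> \<le> b / (4 * pi\<^sup>2)" if "?A n r \<le> b" for n r b
    using newton_abs_integral[of "gn n" r] that by (smt (verit) divide_right_mono zero_le_power2 pi_gt_zero)
  have outer: "\<bar>newton (gn n) r\<bar> \<le> 1 * sqrt (?k r) / (4 * pi\<^sup>2)" if "1 \<le> r" for n r
    using newton_bound(2)[OF \<beta> adm gnX(2,1), of r n] that by (intro newton_le) (simp add: norm1)

  \<comment> \<open>The uniform estimate will hold from some N on. For a single n finiteness follows
    because its own potential has an arbitrarily small leading coefficient at the origin, here
    \<kappa>, at the price of a constant C that depends on n.\<close>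
  have F_fin: "F n < \<infinity>" for n
  proof -
    obtain C where C: "0 \<le> C" "\<And>r. 0 < r \<Longrightarrow> ?A n r \<le> \<kappa> * sqrt (?k r) + C"
      using newton_small[OF \<beta> adm gnX(2,1) \<kappa>_pos] by blast
    obtain I where I: "I < \<infinity>"
      "\<And>v. (\<And>r. 0 < r \<Longrightarrow> r < 1 \<Longrightarrow> \<bar>v r\<bar> \<le> (\<kappa> * sqrt (?k r) + C) / (4 * pi\<^sup>2)) \<Longrightarrow>
        (\<And>r. 1 \<le> r \<Longrightarrow> \<bar>v r\<bar> \<le> 1 * sqrt (?k r) / (4 * pi\<^sup>2)) \<Longrightarrow>
        (\<integral>\<^sup>+x. ennreal (exp (p * alpha_crit \<beta> * \<bar>v (norm (x::real^4))\<bar> powr q) - 1) \<partial>lebesgue) \<le> I"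
      unfolding q_def
      by (rule exp_integral_bound[OF ctx p less_imp_le[OF \<kappa>_pos] C(1) sub[unfolded q_def] zero_le_one]) blast
    have "F n \<le> I" unfolding F_eq by (rule I(2)[OF newton_le[OF C(2)] outer])
    then show ?thesis using I(1) by simp
  qed

  obtain C where C: "0 \<le> C"
    "\<And>r. 0 < r \<Longrightarrow> (LINT y|lebesgue. \<bar>g y\<bar> / (max r (norm y))\<^sup>2) \<le> \<epsilon> * sqrt (?k r) + C"
    using newton_small[OF \<beta> adm gX(2,1) \<epsilon>] by blast
  obtain I where I: "I < \<infinity>"
    "\<And>v. (\<And>r. 0 < r \<Longrightarrow> r < 1 \<Longrightarrow> \<bar>v r\<bar> \<le> (\<kappa> * sqrt (?k r) + C) / (4 * pi\<^sup>2)) \<Longrightarrow>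
      (\<And>r. 1 \<le> r \<Longrightarrow> \<bar>v r\<bar> \<le> 1 * sqrt (?k r) / (4 * pi\<^sup>2)) \<Longrightarrow>
      (\<integral>\<^sup>+x. ennreal (exp (p * alpha_crit \<beta> * \<bar>v (norm (x::real^4))\<bar> powr q) - 1) \<partial>lebesgue) \<le> I"
    unfolding q_def
    by (rule exp_integral_bound[OF ctx p less_imp_le[OF \<kappa>_pos] C(1) sub[unfolded q_def] zero_le_one]) blast
  have "(\<lambda>n. sqrt (e n)) \<longlonglongrightarrow> \<kappa>0" unfolding \<kappa>0_def by (intro tendsto_real_sqrt e_lim)
  moreover have "\<kappa>0 < \<kappa>0 + \<epsilon>" using \<epsilon> by simp
  ultimately have "\<forall>\<^sub>F n in sequentially. sqrt (e n) < \<kappa>0 + \<epsilon>" by (rule order_tendstoD(2))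
  then obtain N where N: "\<And>n. N \<le> n \<Longrightarrow> sqrt (e n) < \<kappa>0 + \<epsilon>"
    by (auto simp: eventually_sequentially)
  have abs: "integrable lebesgue (\<lambda>y. \<bar>f y\<bar> / (max r (norm y))\<^sup>2)"
    if "f \<in> borel_measurable lebesgue" "integrable lebesgue (\<lambda>x. ?w x * (f x)\<^sup>2)" "0 < r" for f r
    using integrable_abs[OF newton_bound(1)[OF \<beta> adm that]] by simp
  \<comment> \<open>The triangle inequality for \<open>gn n = dn n + g\<close> under the positive
    kernel: Cauchy-Schwarz gives the coefficient \<kappa>0 + \<epsilon> for the difference,
    \<open>newton_small\<close> gives \<epsilon> for g, and the sum is \<kappa>.\<close>
  have large: "F n \<le> I" if n: "N \<le> n" for n
  proof -
    have "?A n r \<le> \<kappa> * sqrt (?k r) + C" if r: "0 < r" for r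
    proof -
      have "?A n r \<le> (LINT y|lebesgue. \<bar>dn n y\<bar> / (max r (norm y))\<^sup>2 + \<bar>g y\<bar> / (max r (norm y))\<^sup>2)"
      proof (rule integral_mono)
        show "\<bar>gn n y\<bar> / (max r (norm y))\<^sup>2 \<le> \<bar>dn n y\<bar> / (max r (norm y))\<^sup>2 + \<bar>g y\<bar> / (max r (norm y))\<^sup>2" for y
          unfolding add_divide_distrib[symmetric] by (intro divide_right_mono) (auto simp: dn_def)
      qed (intro Bochner_Integration.integrable_add abs gnX gX dn_meas dnX r)+
      also have "\<dots> = (LINT y|lebesgue. \<bar>dn n y\<bar> / (max r (norm y))\<^sup>2) + (LINT y|lebesgue. \<bar>g y\<bar> / (max r (norm y))\<^sup>2)"
        by (intro Bochner_Integration.integral_add abs gX dn_meas dnX r)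
      also have "\<dots> \<le> sqrt (e n) * sqrt (?k r) + (\<epsilon> * sqrt (?k r) + C)"
        unfolding e_def by (intro add_mono newton_bound(2)[OF \<beta> adm dn_meas dnX r] C(2) r)
      also have "\<dots> \<le> (\<kappa>0 + \<epsilon>) * sqrt (?k r) + (\<epsilon> * sqrt (?k r) + C)"
        using N[OF n] kernel_bound_fun_nonneg[OF \<beta> adm, of r]
        by (intro add_right_mono mult_right_mono) auto
      also have "\<dots> = \<kappa> * sqrt (?k r) + C"
        by (simp add: \<epsilon>_def field_simps)
      finally show ?thesis .
    qed
    then show ?thesis unfolding F_eq by (intro I(2) newton_le outer)
  qed
  have "F n \<le> I + (\<Sum>m<N. F m)" for n
  proof (cases "N \<le> n")
    case True
    then show ?thesis using large[OF True] by (simp add: add_increasing2 sum_nonneg)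
  next
    case False
    then have "F n \<le> (\<Sum>m<N. F m)" by (intro member_le_sum) auto
    then show ?thesis by (simp add: add_increasing)
  qed
  then have "(SUP n. F n) \<le> I + (\<Sum>m<N. F m)" by (intro SUP_least)
  also have "\<dots> < \<infinity>" using I(1) F_fin by simp
  finally show "(SUP n. \<integral>\<^sup>+x. ennreal (exp (p * alpha_crit \<beta> * \<bar>un n x\<bar> powr (2 / (1 - \<beta>))) - 1) \<partial>lebesgue) < \<infinity>"
    by (simp add: F_def q_def)
qed

end
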